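(* Let $0<\gamma\le\infty$, $I=[0,\gamma)$, let $w$ be a decreasing weight function on $I$ such that $W(\infty)=\infty$ if $\gamma=\infty$, and let $\varphi$ be an Orlicz $N$-function. Then the following are equivalent: (i) the diameter of every nonempty relatively weakly open subset of the unit ball of the Orlicz-Lorentz function space $\Lambda_{\varphi,w}$ equipped with the Luxemburg norm is equal to $2$; (ii) $\varphi$ does not satisfy the $\Delta_2$ condition when $\gamma=\infty$, and $\varphi$ does not satisfy the $\Delta_2^\infty$ condition when $\gamma<\infty$.
   Context: Decreasing means non-increasing. $L^0=L^0(I)$ is the set of all (classes of a.e. equal) Lebesgue measurable functions $x:I\to\mathbb{R}$; $m$ is Lebesgue measure. For $x\in L^0$, $d_x(\lambda)=m\{t\in I:|x(t)|>\lambda\}$, $\lambda\ge 0$, and $x^*(t)=\inf\{\lambda\ge 0: d_x(\lambda)\le t\}$, $t\ge 0$, is the decreasing rearrangement (values in $[0,\infty]$, $\inf\emptyset=\infty$). A weight function is a decreasing function $w:I\to(0,\infty)$ that is locally integrable: $W(t)=\int_0^t w<\infty$ for all $t\in I$; if $\gamma=\infty$, $W(\infty)=\int_0^\infty w$. An Orlicz function is a convex $\varphi:[0,\infty)\to[0,\infty)$ with $\varphi(0)=0$ and $\varphi(u)>0$ for $u>0$ (and $\varphi(\infty)=\infty$). It is an Orlicz $N$-function if moreover $\lim_{u\to 0^+}\varphi(u)/u=0$ and $\lim_{u\to\infty}\varphi(u)/u=\infty$. $\varphi$ satisfies $\Delta_2$ if there is $K>0$ with $\varphi(2u)\le K\varphi(u)$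 for all $u\ge 0$; it satisfies $\Delta_2^\infty$ if there are $K>0$, $u_0\ge 0$ with $\varphi(2u)\le K\varphi(u)$ for all $u\ge u_0$. For $x\in L^0$ let $\rho(x)=\int_0^\gamma\varphi(x^*(t))w(t)\,dt$. The Orlicz-Lorentz space is $\Lambda_{\varphi,w}=\{x\in L^0:\rho(\lambda x)<\infty\text{ for some }\lambda>0\}$, a real Banach space with the Luxemburg norm $\|x\|=\inf\{\epsilon>0:\rho(x/\epsilon)\le 1\}$. The unit ball is the closed unit ball; a relatively weakly open subset of it is its intersection with a weakly open subset of the space; diameter is taken in the Luxemburg norm. *)

theory Defs
  imports "HOL-Analysis.Analysis"
begin

(* The real vector space of Lebesgue measurable functions on the real line modulo a.e. equality.
   L^0(I) is the subspace of the classes vanishing a.e. outside I (extension by zero). *)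

quotient_type meas_class =
  "real \<Rightarrow> real" / partial: "\<lambda>f g. f \<in> borel_measurable lebesgue \<and> g \<in> borel_measurable lebesgue \<and>
      (AE t in lebesgue. f t = g t)"
proof (rule part_equivpI)
  show "\<exists>f. f \<in> borel_measurable lebesgue \<and> f \<in> borel_measurable lebesgue \<and>
      (AE t in lebesgue. (f :: real \<Rightarrow> real) t = f t)"
    by (rule exI[of _ "\<lambda>_. 0"]) auto
  show "symp (\<lambda>f g :: real \<Rightarrow> real. f \<in> borel_measurable lebesgue \<and>
      g \<in> borel_measurable lebesgue \<and> (AE t in lebesgue. f t = g t))"
    by (rule sympI) (auto elim: eventually_mono)
  show "transp (\<lambda>f g :: real \<Rightarrow> real. f \<in> borel_measurable lebesgue \<and>
      g \<in> borel_measurable lebesgue \<and> (AE t in lebesgue. f t = g t))"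
    by (rule transpI) (auto elim: eventually_elim2)
qed

lemma meas_rel_refl:
  fixes f g :: "real \<Rightarrow> real"
  assumes "f \<in> borel_measurable lebesgue" "\<And>t. f t = g t"
  shows "f \<in> borel_measurable lebesgue \<and> g \<in> borel_measurable lebesgue \<and>
    (AE t in lebesgue. f t = g t)"
proof -
  have "f = g" using assms(2) by (rule ext)
  then show ?thesis using assms(1) by simp
qed

instantiation meas_class :: real_vector
begin

lift_definition zero_meas_class :: meas_class is "\<lambda>_. 0"
  by simp

lift_definition plus_meas_class :: "meas_class \<Rightarrow> meas_class \<Rightarrow> meas_class"
  is "\<lambda>f g t. f t + g t"
  by (elim conjE, intro conjI borel_measurable_add; (assumption | (erule (1) eventually_elim2, simp)))

lift_definition minus_meas_class :: "meas_class \<Rightarrow> meas_class \<Rightarrow> meas_class"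
  is "\<lambda>f g t. f t - g t"
  by (elim conjE, intro conjI borel_measurable_diff; (assumption | (erule (1) eventually_elim2, simp)))

lift_definition uminus_meas_class :: "meas_class \<Rightarrow> meas_class"
  is "\<lambda>f t. - f t"
  by (elim conjE, intro conjI borel_measurable_uminus; (assumption | (erule eventually_mono, simp)))

lift_definition scaleR_meas_class :: "real \<Rightarrow> meas_class \<Rightarrow> meas_class"
  is "\<lambda>c f t. c * f t"
  by (elim conjE, intro conjI borel_measurable_times borel_measurable_const;
      (assumption | (erule eventually_mono, simp)))

instance
  by standard
    (transfer; elim conjE, rule meas_rel_refl,
      (intro borel_measurable_add borel_measurable_diff borel_measurable_uminus
        borel_measurable_times borel_measurable_const; assumption),
      simp add: algebra_simps)+

end

definition half_open_interval :: "ereal \<Rightarrow> real set" where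
  "half_open_interval \<gamma> = {t. 0 \<le> t \<and> ereal t < \<gamma>}"

lemma half_open_interval_lebesgue: "half_open_interval \<gamma> \<in> sets lebesgue"
proof -
  have "{t \<in> space borel. 0 \<le> t \<and> ereal t < \<gamma>} \<in> sets borel"
    by measurable
  then show ?thesis by (simp add: half_open_interval_def)
qed

lift_definition vanishes_outside :: "meas_class \<Rightarrow> real set \<Rightarrow> bool"
  is "\<lambda>f A. AE t in lebesgue. t \<notin> A \<longrightarrow> f t = 0"
  by (intro ext iffI; elim conjE; erule (1) eventually_elim2; simp)

definition L0 :: "real set \<Rightarrow> meas_class set" where
  "L0 A = {x. vanishes_outside x A}"

lift_definition distribution :: "ereal \<Rightarrow> meas_class \<Rightarrow> real \<Rightarrow> ennreal"
  is "\<lambda>\<gamma> f l. emeasure lebesgue {t \<in> half_open_interval \<gamma>. l < \<bar>f t\<bar>}"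
proof -
  fix \<gamma> and f g :: "real \<Rightarrow> real"
  assume *: "f \<in> borel_measurable lebesgue \<and> g \<in> borel_measurable lebesgue \<and>
    (AE t in lebesgue. f t = g t)"
  have meas: "{t \<in> half_open_interval \<gamma>. l < \<bar>h t\<bar>} \<in> sets lebesgue"
    if h: "h \<in> borel_measurable lebesgue" for l and h :: "real \<Rightarrow> real"
  proof -
    have "{t \<in> space lebesgue. l < \<bar>h t\<bar>} \<in> sets lebesgue"
      by (rule borel_measurable_less[OF borel_measurable_const borel_measurable_abs[OF h]])
    from sets.Int[OF half_open_interval_lebesgue this]
    have "half_open_interval \<gamma> \<inter> {t \<in> space lebesgue. l < \<bar>h t\<bar>} \<in> sets lebesgue" .
    moreover have "half_open_interval \<gamma> \<inter> {t \<in> space lebesgue. l < \<bar>h t\<bar>} =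
        {t \<in> half_open_interval \<gamma>. l < \<bar>h t\<bar>}"
      by auto
    ultimately show ?thesis by (simp only:)
  qed
  show "(\<lambda>l. emeasure lebesgue {t \<in> half_open_interval \<gamma>. l < \<bar>f t\<bar>}) =
    (\<lambda>l. emeasure lebesgue {t \<in> half_open_interval \<gamma>. l < \<bar>g t\<bar>})"
    using * by (intro ext emeasure_eq_AE meas) (auto elim: eventually_mono)
qed

definition rearrangement :: "ereal \<Rightarrow> meas_class \<Rightarrow> real \<Rightarrow> ennreal" where
  "rearrangement \<gamma> x t = Inf {ennreal l |l. 0 \<le> l \<and> distribution \<gamma> x l \<le> ennreal t}"

(* Monotonicity and positivity are required on the open interval (0, \<gamma>) only: the value at the
   null point 0 plays no role, and a finite value w 0 bounding w from above would exclude the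
   unbounded weights that the integrability condition is there to admit. *)
definition decreasing_weight :: "ereal \<Rightarrow> (real \<Rightarrow> real) \<Rightarrow> bool" where
  "decreasing_weight \<gamma> w \<longleftrightarrow>
     (\<forall>t \<in> half_open_interval \<gamma> - {0}. 0 < w t) \<and>
     antimono_on (half_open_interval \<gamma> - {0}) w \<and>
     (\<forall>t \<in> half_open_interval \<gamma>. (\<integral>\<^sup>+s\<in>{0<..<t}. ennreal (w s) \<partial>lebesgue) < \<infinity>)"

definition Orlicz_function :: "(real \<Rightarrow> real) \<Rightarrow> bool" where
  "Orlicz_function \<phi> \<longleftrightarrow> convex_on {0..} \<phi> \<and> \<phi> 0 = 0 \<and> (\<forall>u>0. 0 < \<phi> u)"

definition Orlicz_N_function :: "(real \<Rightarrow> real) \<Rightarrow> bool" where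
  "Orlicz_N_function \<phi> \<longleftrightarrow> Orlicz_function \<phi> \<and>
     ((\<lambda>u. \<phi> u / u) \<longlongrightarrow> 0) (at_right 0) \<and> filterlim (\<lambda>u. \<phi> u / u) at_top at_top"

definition Delta2 :: "(real \<Rightarrow> real) \<Rightarrow> bool" where
  "Delta2 \<phi> \<longleftrightarrow> (\<exists>K>0. \<forall>u\<ge>0. \<phi> (2 * u) \<le> K * \<phi> u)"

definition Delta2_infinity :: "(real \<Rightarrow> real) \<Rightarrow> bool" where
  "Delta2_infinity \<phi> \<longleftrightarrow> (\<exists>K>0. \<exists>u0\<ge>0. \<forall>u\<ge>u0. \<phi> (2 * u) \<le> K * \<phi> u)"

definition Orlicz_ext :: "(real \<Rightarrow> real) \<Rightarrow> ennreal \<Rightarrow> ennreal" where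
  "Orlicz_ext \<phi> u = (if u = \<infinity> then \<infinity> else ennreal (\<phi> (enn2real u)))"

definition OL_modular :: "ereal \<Rightarrow> (real \<Rightarrow> real) \<Rightarrow> (real \<Rightarrow> real) \<Rightarrow> meas_class \<Rightarrow> ennreal" where
  "OL_modular \<gamma> \<phi> w x =
     (\<integral>\<^sup>+t\<in>half_open_interval \<gamma>. Orlicz_ext \<phi> (rearrangement \<gamma> x t) * ennreal (w t) \<partial>lebesgue)"

definition OL_space :: "ereal \<Rightarrow> (real \<Rightarrow> real) \<Rightarrow> (real \<Rightarrow> real) \<Rightarrow> meas_class set" where
  "OL_space \<gamma> \<phi> w =
     {x \<in> L0 (half_open_interval \<gamma>). \<exists>c>0. OL_modular \<gamma> \<phi> w (c *\<^sub>R x) < \<infinity>}"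

definition Luxemburg_norm ::
    "ereal \<Rightarrow> (real \<Rightarrow> real) \<Rightarrow> (real \<Rightarrow> real) \<Rightarrow> meas_class \<Rightarrow> real" where
  "Luxemburg_norm \<gamma> \<phi> w x = Inf {\<epsilon>. 0 < \<epsilon> \<and> OL_modular \<gamma> \<phi> w (x /\<^sub>R \<epsilon>) \<le> 1}"

(* Below, a normed space is given by a linear subspace S of an ambient real vector space together
   with a function N whose restriction to S is a norm. *)

definition dual_on :: "'a::real_vector set \<Rightarrow> ('a \<Rightarrow> real) \<Rightarrow> ('a \<Rightarrow> real) set" where
  "dual_on S N = {f. (\<forall>x\<in>S. \<forall>y\<in>S. f (x + y) = f x + f y) \<and>
     (\<forall>c. \<forall>x\<in>S. f (c *\<^sub>R x) = c * f x) \<and> (\<exists>C. \<forall>x\<in>S. \<bar>f x\<bar> \<le> C * N x)}"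

definition weak_topology_on :: "'a::real_vector set \<Rightarrow> ('a \<Rightarrow> real) \<Rightarrow> 'a topology" where
  "weak_topology_on S N =
     topology_generated_by {{x \<in> S. f x \<in> U} |f U. f \<in> dual_on S N \<and> open U}"

definition unit_ball_on :: "'a::real_vector set \<Rightarrow> ('a \<Rightarrow> real) \<Rightarrow> 'a set" where
  "unit_ball_on S N = {x \<in> S. N x \<le> 1}"

definition diameter_wrt :: "('a::real_vector \<Rightarrow> real) \<Rightarrow> 'a set \<Rightarrow> ereal" where
  "diameter_wrt N V = (SUP (x, y) \<in> V \<times> V. ereal (N (x - y)))"

end

theory Submission imports Defs begin

text \<open>Replacing \<open>x\<^sup>*\<close> by \<open>\<phi> \<circ> x\<^sup>*\<close>, the decreasing rearrangement of \<open>\<phi> \<circ> \<bar>x\<bar>\<close>, and slicing the weight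
  into indicators of initial intervals shows that a pointwise inequality
  \<open>\<phi> \<bar>h\<bar> \<le> a \<phi> \<bar>f\<bar> + b \<phi> \<bar>g\<bar>\<close> passes to the modulars: \<open>\<rho> h \<le> a \<rho> f + b \<rho> g\<close>.

  If \<open>\<phi>\<close> fails the growth condition, then for every \<open>\<eta> > 0\<close> there are multiples \<open>y\<^sub>k\<close> of indicators of pairwise
  disjoint sets \<open>A\<^sub>k\<close> with \<open>\<Sum> \<rho> y\<^sub>k\<close> as small as we like but \<open>\<rho> ((1 + \<eta>) y\<^sub>k) > 1\<close>. Given \<open>x\<close> with \<open>\<rho> x < 1\<close>, both
  functions which equal \<open>x\<close> off \<open>A\<^sub>k\<close> and \<open>\<plusminus> y\<^sub>k\<close> on \<open>A\<^sub>k\<close> stay in the unit ball and converge weakly to \<open>x\<close>, while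
  their distance is at least \<open>2 / (1 + \<eta>)\<close>.

  Conversely, superlinearity of \<open>\<phi>\<close> provides a slice of the unit ball, given by integration over a set
  \<open>B\<close>, all of whose members exceed a fixed level on more than \<open>3/4\<close> of \<open>B\<close>. Two such members \<open>y, z\<close> are
  simultaneously large on half of \<open>B\<close>, so cancellation gives \<open>\<rho> ((y - z) / 2) \<le> 1 - \<kappa>\<close>, and the doubling
  condition turns this into \<open>\<parallel>y - z\<parallel> \<le> 2 - \<delta>\<close>.\<close>

subsection \<open>Layer cakes and majorization on the half-line\<close>

text \<open>The weight may decay towards the end of the interval, so a gain of
  \<open>\<phi> \<bar>f\<bar>\<close> over \<open>\<phi> \<bar>h\<bar>\<close> on a set does not by
  itself bound the modulars apart: rearrangement may carry it to places of negligible weight. The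
  cure is to fix \<open>M\<close> inside the interval and then a height \<open>\<tau>\<close> with
  \<open>\<phi> (\<tau> / 2) W(M) > 1\<close>. A modular at most 1 forces
  \<open>\<phi> \<circ> f\<^sup>*\<close> below \<open>\<phi> (\<tau> / 2)\<close> beyond
  \<open>M\<close>, so everything above that level is counted with weight at least
  \<open>w M\<close>.

  This dictates the order of choices: the height \<open>\<tau>\<close> is prescribed before the set
  \<open>B\<close>, and the slice must push its members above it. The fraction 3/4 has a simple
  origin: two subsets of a set of measure at most \<open>a\<close>, each of measure above
  \<open>3 a / 4\<close>, meet in measure at least \<open>a / 2\<close>.

  No description of the dual space is used. One bounded functional is exhibited for the slice, and
  weak convergence to 0 is derived for all functionals at once from bounds on signed sums.\<close>

lemma sigma_finite_lebesgue: "sigma_finite_measure (lebesgue :: real measure)"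
proof -
  obtain A :: "real set set" where A: "countable A" "A \<subseteq> sets lborel" "\<Union>A = space lborel"
      "\<forall>a\<in>A. emeasure lborel a \<noteq> \<infinity>"
    using lborel.sigma_finite_countable by blast
  show ?thesis
    by standard (rule exI[of _ A], use A in \<open>auto simp: subset_eq main_part_sets sets_completionI_sub\<close>)
qed

lemma pair_sigma_finite_lebesgue: "pair_sigma_finite (lebesgue :: real measure) lborel"
  by (simp add: pair_sigma_finite_def sigma_finite_lebesgue lborel.sigma_finite_measure_axioms)

text \<open>Truncated subtraction is the length of the interval of levels between \<open>l\<close>
  and \<open>a\<close>. This pointwise layer cake also covers \<open>a = top\<close>, because
  \<open>{l<..}\<close> has infinite length.\<close>

lemma ennreal_minus_eq_nn_integral:
  fixes a :: ennreal
  assumes "0 \<le> l"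
  shows "a - ennreal l = (\<integral>\<^sup>+u. indicator {l<..} u * indicator {t. ennreal t < a} u \<partial>lborel)"
proof (cases a)
  case (real r)
  have "(\<integral>\<^sup>+u. indicator {l<..} u * indicator {t. ennreal t < a} u \<partial>lborel)
      = (\<integral>\<^sup>+u. indicator {l<..<r} u \<partial>lborel)"
    using real assms by (intro nn_integral_cong) (auto simp: indicator_def ennreal_less_iff)
  also have "\<dots> = a - ennreal l"
    using real assms by (cases "l \<le> r") (auto simp: ennreal_minus ennreal_neg)
  finally show ?thesis by simp
next
  case top
  have "of_nat n \<le> emeasure lborel {l<..}" for n
    using emeasure_mono[of "{l<..<l + real n}" "{l<..}" lborel] by (simp add: subset_eq ennreal_of_nat_eq_real_of_nat)
  then have "emeasure lborel {l<..} = \<infinity>"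
    by (metis ennreal_Ex_less_of_nat infinity_ennreal_def leD less_top)
  then show ?thesis using top by simp
qed

text \<open>Tonelli in the point \<open>t\<close> and the level \<open>u\<close>. With
  \<open>g = 1\<close> it expresses the excess of \<open>h\<close> over \<open>l\<close> through the
  distribution of \<open>h\<close>; with \<open>l = 0\<close> and \<open>h\<close> the weight it
  slices the weight into indicators of its superlevel sets.\<close>

lemma nn_integral_layer_cake:
  fixes g h :: "real \<Rightarrow> ennreal"
  assumes [measurable]: "g \<in> borel_measurable lebesgue" "h \<in> borel_measurable lebesgue"
    and l: "0 \<le> l"
  shows "(\<integral>\<^sup>+t. g t * (h t - ennreal l) \<partial>lebesgue) =
    (\<integral>\<^sup>+u. indicator {l<..} u * (\<integral>\<^sup>+t. g t * indicator {t. ennreal u < h t} t \<partial>lebesgue) \<partial>lborel)"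
proof -
  interpret pair_sigma_finite "lebesgue :: real measure" lborel
    by (rule pair_sigma_finite_lebesgue)
  have "(\<integral>\<^sup>+t. g t * (h t - ennreal l) \<partial>lebesgue)
      = (\<integral>\<^sup>+t. (\<integral>\<^sup>+u. g t * (indicator {l<..} u * indicator {u. ennreal u < h t} u) \<partial>lborel) \<partial>lebesgue)"
    by (subst nn_integral_cmult) (auto simp: ennreal_minus_eq_nn_integral[OF l])
  also have "\<dots> = (\<integral>\<^sup>+u. (\<integral>\<^sup>+t. g t * (indicator {l<..} u * indicator {t. ennreal u < h t} t) \<partial>lebesgue) \<partial>lborel)"
    by (subst Fubini') (simp_all add: indicator_def)
  also have "\<dots> = (\<integral>\<^sup>+u. indicator {l<..} u * (\<integral>\<^sup>+t. g t * indicator {t. ennreal u < h t} t \<partial>lebesgue) \<partial>lborel)"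
    by (intro nn_integral_cong, subst nn_integral_cmult[symmetric]) (auto simp: mult_ac)
  finally show ?thesis .
qed

lemma sets_lebesgue_superlevel:
  fixes h :: "real \<Rightarrow> ennreal"
  assumes [measurable]: "h \<in> borel_measurable lebesgue" shows "{t. c < h t} \<in> sets lebesgue"
proof -
  have "{t \<in> space lebesgue. c < h t} \<in> sets lebesgue" by measurable
  then show ?thesis by simp
qed

lemma nn_integral_minus_cong_distribution:
  fixes g h :: "real \<Rightarrow> ennreal"
  assumes [measurable]: "g \<in> borel_measurable lebesgue" "h \<in> borel_measurable lebesgue"
    and eq: "\<And>u. 0 < u \<Longrightarrow> emeasure lebesgue {t. ennreal u < g t} = emeasure lebesgue {t. ennreal u < h t}"
    and l: "0 \<le> l"
  shows "(\<integral>\<^sup>+t. g t - ennreal l \<partial>lebesgue) = (\<integral>\<^sup>+t. h t - ennreal l \<partial>lebesgue)"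
proof -
  have *: "(\<integral>\<^sup>+t. f t - ennreal l \<partial>lebesgue) =
     (\<integral>\<^sup>+u. indicator {l<..} u * emeasure lebesgue {t. ennreal u < f t} \<partial>lborel)"
    if [measurable]: "f \<in> borel_measurable lebesgue" for f :: "real \<Rightarrow> ennreal"
    using nn_integral_layer_cake[of "\<lambda>_. 1" f l] l by (simp add: sets_lebesgue_superlevel)
  show ?thesis
    unfolding *[OF assms(1)] *[OF assms(2)]
    by (intro nn_integral_cong) (use eq l in \<open>auto simp: indicator_def\<close>)
qed

lemma ennreal_le_add_diff: "x \<le> y + (x - y)" for x y :: ennreal
  by (cases "y \<le> x") (auto simp flip: ennreal_ineq_diff_add intro: add_increasing2)

text \<open>If \<open>J\<close> separates the values of \<open>H\<close> at level \<open>l\<close>,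
  the excess over \<open>l\<close> lives on \<open>J\<close> alone. For arbitrary \<open>J\<close>
  and \<open>l\<close> only the inequality \<open>nn_integral_le_level\<close> remains, so the two
  lemmas together tell at which level the minimum over \<open>l\<close> is attained.\<close>

lemma nn_integral_split_level:
  fixes H :: "real \<Rightarrow> ennreal"
  assumes [measurable]: "H \<in> borel_measurable lebesgue" "J \<in> sets lebesgue"
    and ge: "\<And>t. t \<in> J \<Longrightarrow> l \<le> H t" and le: "\<And>t. t \<notin> J \<Longrightarrow> H t \<le> l" and l: "l < top"
  shows "(\<integral>\<^sup>+t. H t * indicator J t \<partial>lebesgue) = l * emeasure lebesgue J + (\<integral>\<^sup>+t. H t - l \<partial>lebesgue)"
proof -
  have "(\<integral>\<^sup>+t. H t * indicator J t \<partial>lebesgue) = (\<integral>\<^sup>+t. l * indicator J t + (H t - l) \<partial>lebesgue)"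
  proof (intro nn_integral_cong)
    fix t
    show "H t * indicator J t = l * indicator J t + (H t - l)"
      using ge[of t] le[of t] l
      by (cases "t \<in> J") (auto simp: ennreal_ineq_diff_add diff_eq_0_iff_ennreal)
  qed
  also have "\<dots> = l * emeasure lebesgue J + (\<integral>\<^sup>+t. H t - l \<partial>lebesgue)"
    by (subst nn_integral_add) (auto simp: nn_integral_cmult)
  finally show ?thesis .
qed

lemma nn_integral_le_level:
  fixes H :: "real \<Rightarrow> ennreal"
  assumes [measurable]: "H \<in> borel_measurable lebesgue" "J \<in> sets lebesgue"
  shows "(\<integral>\<^sup>+t. H t * indicator J t \<partial>lebesgue) \<le> l * emeasure lebesgue J + (\<integral>\<^sup>+t. H t - l \<partial>lebesgue)"
proof -
  have "H t \<le> l + (H t - l)" for t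
    by (rule ennreal_le_add_diff)
  then have "(\<integral>\<^sup>+t. H t * indicator J t \<partial>lebesgue) \<le> (\<integral>\<^sup>+t. l * indicator J t + (H t - l) \<partial>lebesgue)"
    by (intro nn_integral_mono) (auto simp: indicator_def)
  also have "\<dots> = l * emeasure lebesgue J + (\<integral>\<^sup>+t. H t - l \<partial>lebesgue)"
    by (subst nn_integral_add) (auto simp: nn_integral_cmult)
  finally show ?thesis .
qed

text \<open>Monotonicity is asked for on the open half-line only, so the function may blow up at 0;
  the value 0 elsewhere makes every superlevel set an initial interval of the open
  half-line.\<close>

definition decreasing_profile :: "(real \<Rightarrow> ennreal) \<Rightarrow> bool" where
  "decreasing_profile H \<longleftrightarrow> (\<forall>t\<le>0. H t = 0) \<and> (\<forall>s t. 0 < s \<longrightarrow> s \<le> t \<longrightarrow> H t \<le> H s)"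

lemma decreasing_profile_superlevel_interval:
  assumes "decreasing_profile H" shows "is_interval {t. u < H t}"
  using assms unfolding decreasing_profile_def is_interval_1
  by (auto, metis leI less_le_trans not_less_zero)

lemma decreasing_profile_borel:
  assumes "decreasing_profile H" shows "H \<in> borel_measurable borel"
proof (rule borel_measurableI_greater)
  fix u
  show "{t \<in> space borel. u < H t} \<in> sets borel"
    using real_interval_borel_measurable[OF decreasing_profile_superlevel_interval[OF assms]] by simp
qed

lemma decreasing_profile_measurable[measurable_dest]:
  "decreasing_profile H \<Longrightarrow> H \<in> borel_measurable lebesgue"
  by (intro measurable_completion) (simp add: decreasing_profile_borel)

text \<open>On an initial interval \<open>J\<close> the partial integral of a decreasing function is the minimum over
  \<open>l\<close> of \<open>l |J| + \<integral> (H - l)\<^sub>+\<close>, an expression which only depends on the distribution function and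
  is jointly convex in \<open>l\<close> and \<open>H\<close>.\<close>

lemma decreasing_profile_majorization:
  fixes G H1 H2 :: "real \<Rightarrow> ennreal"
  assumes G[measurable]: "G \<in> borel_measurable lebesgue"
    and H1: "decreasing_profile H1" and H2: "decreasing_profile H2"
    and [measurable]: "F \<in> borel_measurable lebesgue" "F1 \<in> borel_measurable lebesgue"
      "F2 \<in> borel_measurable lebesgue"
    and GF: "\<And>l. 0 \<le> l \<Longrightarrow> (\<integral>\<^sup>+t. G t - ennreal l \<partial>lebesgue) = (\<integral>\<^sup>+t. F t - ennreal l \<partial>lebesgue)"
    and HF1: "\<And>l. 0 \<le> l \<Longrightarrow> (\<integral>\<^sup>+t. H1 t - ennreal l \<partial>lebesgue) = (\<integral>\<^sup>+t. F1 t - ennreal l \<partial>lebesgue)"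
    and HF2: "\<And>l. 0 \<le> l \<Longrightarrow> (\<integral>\<^sup>+t. H2 t - ennreal l \<partial>lebesgue) = (\<integral>\<^sup>+t. F2 t - ennreal l \<partial>lebesgue)"
    and le: "AE t in lebesgue. F t \<le> ennreal a * F1 t + ennreal b * F2 t"
    and ab: "0 < a" "0 < b"
    and v: "decreasing_profile v"
  shows "(\<integral>\<^sup>+t. G t * v t \<partial>lebesgue) \<le>
    ennreal a * (\<integral>\<^sup>+t. H1 t * v t \<partial>lebesgue) + ennreal b * (\<integral>\<^sup>+t. H2 t * v t \<partial>lebesgue)"
proof -
  note [measurable] = decreasing_profile_measurable[OF H1] decreasing_profile_measurable[OF H2]
    decreasing_profile_measurable[OF v] 
  have J: "(\<integral>\<^sup>+t. G t * indicator {t. ennreal u < v t} t \<partial>lebesgue) \<le>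
      ennreal a * (\<integral>\<^sup>+t. H1 t * indicator {t. ennreal u < v t} t \<partial>lebesgue)
        + ennreal b * (\<integral>\<^sup>+t. H2 t * indicator {t. ennreal u < v t} t \<partial>lebesgue)" (is "?L \<le> _")
    if u: "0 < u" for u
  proof -
    let ?J = "{t. ennreal u < v t}"
    have [measurable]: "?J \<in> sets lebesgue" by (simp add: sets_lebesgue_superlevel)
    have Jpos: "0 < t" if "t \<in> ?J" for t
      using that v u by (force simp: decreasing_profile_def not_less[symmetric])
    have Jdown: "s \<in> ?J" if "t \<in> ?J" "0 < s" "s \<le> t" for s t
      using that v by (auto simp: decreasing_profile_def intro: less_le_trans)
    show ?thesis
    proof (cases "?J = {}")
      case True
      then have "indicator ?J = (\<lambda>_. 0 :: ennreal)" by (simp add: fun_eq_iff)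
      then show ?thesis by simp
    next
      case False
      then obtain p where p: "p \<in> ?J" by blast
      have pp: "0 < p" using Jpos p by blast
      have "emeasure lebesgue {0<..<p} \<le> emeasure lebesgue ?J"
        using Jdown[OF p] by (intro emeasure_mono) (simp_all add: subset_eq sets_lebesgue_superlevel)
      moreover have "emeasure lebesgue {0<..<p} = ennreal p"
        using pp by simp
      ultimately have Jmeas: "0 < emeasure lebesgue ?J"
        using pp by (metis ennreal_less_zero_iff less_le_trans)
      \<comment> \<open>The infimum of \<open>H\<close> over \<open>?J\<close> separates its values,
        because every point of the open half-line outside \<open>?J\<close> lies to the right of
        \<open>?J\<close>. It may be \<open>top\<close>, which is treated apart.\<close>
      have key: "\<exists>l. (\<forall>t\<in>?J. l \<le> H t) \<and> (\<forall>t. t \<notin> ?J \<longrightarrow> H t \<le> l)"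
        if H: "decreasing_profile H" for H
      proof (intro exI conjI allI impI ballI)
        fix t assume "t \<in> ?J"
        then show "(INF t\<in>?J. H t) \<le> H t" by (rule INF_lower)
      next
        fix t assume t: "t \<notin> ?J"
        show "H t \<le> (INF t\<in>?J. H t)"
        proof (rule INF_greatest)
          fix s assume s: "s \<in> ?J"
          show "H t \<le> H s"
          proof (cases "0 < t")
            case True
            then have "s \<le> t" using s t Jdown[of s t] by force
            then show ?thesis using H Jpos[OF s] by (auto simp: decreasing_profile_def)
          next
            case False then show ?thesis using H by (auto simp: decreasing_profile_def)
          qed
        qed
      qed
      \<comment> \<open>Since \<open>?J\<close> has positive measure, an infinite separating level
        makes the integral over \<open>?J\<close> infinite; the coefficients \<open>a\<close> and
        \<open>b\<close> being positive, the right-hand side is then \<open>top\<close>.\<close>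
      have top: "(\<integral>\<^sup>+t. H t * indicator ?J t \<partial>lebesgue) = top" if "\<forall>t\<in>?J. top \<le> H t" for H :: "real \<Rightarrow> ennreal"
      proof -
        have "top * emeasure lebesgue ?J = (\<integral>\<^sup>+t. top * indicator ?J t \<partial>lebesgue)"
          by (subst nn_integral_cmult) auto
        also have "\<dots> = (\<integral>\<^sup>+t. H t * indicator ?J t \<partial>lebesgue)"
          using that by (intro nn_integral_cong) (auto simp: indicator_def top_unique)
        finally show ?thesis using Jmeas by (metis ennreal_top_mult less_irrefl)
      qed
      obtain l m where l: "\<forall>t\<in>?J. l \<le> H1 t" "\<forall>t. t \<notin> ?J \<longrightarrow> H1 t \<le> l"
        and m: "\<forall>t\<in>?J. m \<le> H2 t" "\<forall>t. t \<notin> ?J \<longrightarrow> H2 t \<le> m"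
        using key[OF H1] key[OF H2] by blast
      show ?thesis
      proof (cases "l = top \<or> m = top")
        case True
        then have "(\<integral>\<^sup>+t. H1 t * indicator ?J t \<partial>lebesgue) = top \<or> (\<integral>\<^sup>+t. H2 t * indicator ?J t \<partial>lebesgue) = top"
          using top[of H1] top[of H2] l(1) m(1) by fast
        then show ?thesis
          using ab by (elim disjE) (simp_all add: ennreal_mult_top)
      next
        case False
        then obtain l' m' where l': "l = ennreal l'" "0 \<le> l'" and m': "m = ennreal m'" "0 \<le> m'"
          by (metis ennreal_cases)
        \<comment> \<open>The levels \<open>l\<close> and \<open>m\<close> are the minimizing ones
          for the right-hand side. Their combination need not minimize on the left, but there an
          upper bound by any level is enough.\<close>
        let ?n = "a * l' + b * m'"
        have n: "ennreal ?n = ennreal a * l + ennreal b * m" and n0: "0 \<le> ?n"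
          using ab l' m' by (simp_all add: ennreal_mult' ennreal_plus)
        have pt: "F t - ennreal ?n \<le> ennreal a * (F1 t - l) + ennreal b * (F2 t - m)"
          if "F t \<le> ennreal a * F1 t + ennreal b * F2 t" for t
        proof -
          have "F t \<le> ennreal a * (l + (F1 t - l)) + ennreal b * (m + (F2 t - m))"
            by (rule order_trans[OF that]) (intro add_mono mult_left_mono ennreal_le_add_diff; simp)
          also have "\<dots> = ennreal ?n + (ennreal a * (F1 t - l) + ennreal b * (F2 t - m))"
            unfolding n by (simp add: algebra_simps)
          finally show ?thesis by (simp add: ennreal_minus_le_iff)
        qed
        have "?L \<le> ennreal ?n * emeasure lebesgue ?J + (\<integral>\<^sup>+t. F t - ennreal ?n \<partial>lebesgue)"
          using nn_integral_le_level[OF G, of ?J "ennreal ?n"] GF[OF n0] by simp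
        also have "(\<integral>\<^sup>+t. F t - ennreal ?n \<partial>lebesgue)
            \<le> (\<integral>\<^sup>+t. ennreal a * (F1 t - l) + ennreal b * (F2 t - m) \<partial>lebesgue)"
          using le by (intro nn_integral_mono_AE) (auto intro: pt elim: eventually_mono)
        also have "\<dots> = ennreal a * (\<integral>\<^sup>+t. F1 t - l \<partial>lebesgue) + ennreal b * (\<integral>\<^sup>+t. F2 t - m \<partial>lebesgue)"
          by (subst nn_integral_add) (auto simp: nn_integral_cmult)
        also have "\<dots> = ennreal a * (\<integral>\<^sup>+t. H1 t - l \<partial>lebesgue) + ennreal b * (\<integral>\<^sup>+t. H2 t - m \<partial>lebesgue)"
          using HF1[OF l'(2)] HF2[OF m'(2)] l' m' by simp
        also have "ennreal ?n * emeasure lebesgue ?J + \<dots> =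
          ennreal a * (l * emeasure lebesgue ?J + (\<integral>\<^sup>+t. H1 t - l \<partial>lebesgue))
          + ennreal b * (m * emeasure lebesgue ?J + (\<integral>\<^sup>+t. H2 t - m \<partial>lebesgue))"
          unfolding n by (simp add: algebra_simps)
        also have "\<dots> = ennreal a * (\<integral>\<^sup>+t. H1 t * indicator ?J t \<partial>lebesgue)
          + ennreal b * (\<integral>\<^sup>+t. H2 t * indicator ?J t \<partial>lebesgue)"
          using nn_integral_split_level[of H1 ?J l] nn_integral_split_level[of H2 ?J m] l m False
          by (simp add: less_top)
        finally show ?thesis by simp
      qed
    qed
  qed
  have lc: "(\<integral>\<^sup>+t. H t * v t \<partial>lebesgue) =
      (\<integral>\<^sup>+u. indicator {0<..} u * (\<integral>\<^sup>+t. H t * indicator {t. ennreal u < v t} t \<partial>lebesgue) \<partial>lborel)"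
    if "H \<in> borel_measurable lebesgue" for H :: "real \<Rightarrow> ennreal"
    using nn_integral_layer_cake[OF that, of v 0] by simp
  interpret sigma_finite_measure "lebesgue :: real measure" by (rule sigma_finite_lebesgue)
  have meas: "(\<lambda>u. (\<integral>\<^sup>+t. H t * indicator {t. ennreal u < v t} t \<partial>lebesgue)) \<in> borel_measurable borel"
    if [measurable]: "H \<in> borel_measurable lebesgue" for H :: "real \<Rightarrow> ennreal"
    unfolding indicator_def by measurable
  define I where "I H u = (\<integral>\<^sup>+t. H t * indicator {t. ennreal u < v t} t \<partial>lebesgue)" for H u
  have [measurable]: "I H1 \<in> borel_measurable borel" "I H2 \<in> borel_measurable borel"
    using meas[of H1] meas[of H2] unfolding I_def by simp_all
  have lcI: "(\<integral>\<^sup>+t. H t * v t \<partial>lebesgue) = (\<integral>\<^sup>+u. indicator {0<..} u * I H u \<partial>lborel)"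
    if "H \<in> borel_measurable lebesgue" for H :: "real \<Rightarrow> ennreal"
    unfolding I_def by (rule lc[OF that])
  have JI: "I G u \<le> ennreal a * I H1 u + ennreal b * I H2 u" if "0 < u" for u
    unfolding I_def by (rule J[OF that])
  have "(\<integral>\<^sup>+t. G t * v t \<partial>lebesgue) \<le>
      (\<integral>\<^sup>+u. ennreal a * (indicator {0<..} u * I H1 u) + ennreal b * (indicator {0<..} u * I H2 u) \<partial>lborel)"
    unfolding lcI[OF G]
  proof (intro nn_integral_mono)
    fix u :: real
    show "indicator {0<..} u * I G u \<le> ennreal a * (indicator {0<..} u * I H1 u) + ennreal b * (indicator {0<..} u * I H2 u)"
      using JI[of u] by (cases "0 < u") simp_all
  qed
  also have "\<dots> = ennreal a * (\<integral>\<^sup>+u. indicator {0<..} u * I H1 u \<partial>lborel)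
      + ennreal b * (\<integral>\<^sup>+u. indicator {0<..} u * I H2 u \<partial>lborel)"
    by (subst nn_integral_add) (simp_all add: nn_integral_cmult)
  also have "\<dots> = ennreal a * (\<integral>\<^sup>+t. H1 t * v t \<partial>lebesgue) + ennreal b * (\<integral>\<^sup>+t. H2 t * v t \<partial>lebesgue)"
    by (simp only: lcI[OF decreasing_profile_measurable[OF H1]] lcI[OF decreasing_profile_measurable[OF H2]])
  finally show ?thesis .
qed

lemma sets_lebesgue_intervals[measurable]:
  "{a<..<b} \<in> sets lebesgue" "{a..b} \<in> sets lebesgue" "{a<..b} \<in> sets lebesgue"
    "{a..<b} \<in> sets lebesgue" for a b :: real
  by (auto intro!: sets_completionI_sub)

lemma emeasure_below: "emeasure lebesgue {t. 0 < t \<and> ennreal t < d} = d"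
proof (cases d)
  case (real r)
  have "{t. 0 < t \<and> ennreal t < d} = {0<..<r}"
    using real by (auto simp: ennreal_less_iff)
  then show ?thesis using real by simp
next
  case top
  then have "{t. 0 < t \<and> ennreal t < d} = {0::real<..}" by auto
  moreover have "of_nat n \<le> emeasure lebesgue {0::real<..}" for n
    using emeasure_mono[of "{0<..<real n}" "{0<..}" lebesgue] by (simp add: subset_eq ennreal_of_nat_eq_real_of_nat)
  then have "emeasure lebesgue {0::real<..} = top"
    by (metis ennreal_Ex_less_of_nat infinity_ennreal_def leD less_top)
  ultimately show ?thesis using top by simp
qed

lemma sum_indicator_partition_le:
  fixes s :: "nat \<Rightarrow> real"
  assumes "mono s"
  shows "(\<Sum>k<n. indicator {s k..<s (Suc k)} t) = (indicator {s 0..<s n} t :: real)"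
proof (induction n)
  case (Suc n)
  have "s 0 \<le> s n" "s n \<le> s (Suc n)" using assms by (auto simp: mono_def)
  then show ?case using Suc by (auto simp: indicator_def)
qed simp

subsection \<open>Classes of measurable functions\<close>

lemma meas_class_cases:
  obtains f where "f \<in> borel_measurable lebesgue" "x = abs_meas_class f"
  using that[of "rep_meas_class x"] Quotient3_abs_rep[OF Quotient3_meas_class, of x]
    Quotient3_rep_reflp[OF Quotient3_meas_class, of x] by simp

lemma abs_meas_class_eqD:
  assumes "f \<in> borel_measurable lebesgue" "g \<in> borel_measurable lebesgue" "abs_meas_class f = abs_meas_class g"
  shows "AE t in lebesgue. f t = g t"
  using Quotient3_rel[OF Quotient3_meas_class, of f g] assms by blast

lemma abs_meas_class_scaleR:
  assumes "f \<in> borel_measurable lebesgue"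
  shows "c *\<^sub>R abs_meas_class f = abs_meas_class (\<lambda>t. c * f t)"
  by (intro scaleR_meas_class.abs_eq) (simp add: assms)

lemma abs_meas_class_add:
  assumes "f \<in> borel_measurable lebesgue" "g \<in> borel_measurable lebesgue"
  shows "abs_meas_class f + abs_meas_class g = abs_meas_class (\<lambda>t. f t + g t)"
  by (intro plus_meas_class.abs_eq) (simp_all add: assms)

lemma abs_meas_class_diff:
  assumes "f \<in> borel_measurable lebesgue" "g \<in> borel_measurable lebesgue"
  shows "abs_meas_class f - abs_meas_class g = abs_meas_class (\<lambda>t. f t - g t)"
  by (intro minus_meas_class.abs_eq) (simp_all add: assms)

lemma abs_meas_class_zero: "0 = abs_meas_class (\<lambda>_. 0)"
  by (simp add: zero_meas_class_def)

lemma abs_meas_class_sum: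
  fixes f :: "'i \<Rightarrow> real \<Rightarrow> real"
  assumes "\<And>k. f k \<in> borel_measurable lebesgue"
  shows "(\<Sum>k\<in>A. abs_meas_class (f k)) = abs_meas_class (\<lambda>t. \<Sum>k\<in>A. f k t)"
proof (induction A rule: infinite_finite_induct)
  case (insert k A)
  have [measurable]: "f j \<in> borel_measurable lebesgue" for j by (rule assms)
  have m: "(\<lambda>t. \<Sum>k\<in>A. f k t) \<in> borel_measurable lebesgue" by measurable
  show ?case using insert by (simp add: abs_meas_class_add[OF assms m])
qed (simp_all add: abs_meas_class_zero)

lemma rep_meas_class_measurable: "rep_meas_class x \<in> borel_measurable lebesgue"
  using Quotient3_rep_reflp[OF Quotient3_meas_class, of x] by simp

lemma rep_abs_meas_class_AE:
  assumes "f \<in> borel_measurable lebesgue"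
  shows "AE t in lebesgue. rep_meas_class (abs_meas_class f) t = f t"
  by (rule abs_meas_class_eqD[OF rep_meas_class_measurable assms])
    (rule Quotient3_abs_rep[OF Quotient3_meas_class])

text \<open>A representative is chosen because functionals are functions on all of
  \<open>meas_class\<close>. The value depends on the class alone and is the default 0 where the
  integrand is not integrable.\<close>

definition integral_over :: "real set \<Rightarrow> meas_class \<Rightarrow> real" where
  "integral_over B x = (LINT t|lebesgue. indicator B t * rep_meas_class x t)"

lemma integral_over_abs_meas_class:
  assumes [measurable]: "f \<in> borel_measurable lebesgue" "B \<in> sets lebesgue"
  shows "integral_over B (abs_meas_class f) = (LINT t|lebesgue. indicator B t * f t)"
  unfolding integral_over_def
proof (rule integral_cong_AE)
  have [measurable]: "rep_meas_class (abs_meas_class f) \<in> borel_measurable lebesgue"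
    by (rule rep_meas_class_measurable)
  show "(\<lambda>t. indicator B t * rep_meas_class (abs_meas_class f) t) \<in> borel_measurable lebesgue" by measurable
  show "(\<lambda>t. indicator B t * f t) \<in> borel_measurable lebesgue" by measurable
  show "AE t in lebesgue. indicator B t * rep_meas_class (abs_meas_class f) t = indicator B t * f t"
    using rep_abs_meas_class_AE[OF assms(1)] by (auto elim: eventually_mono)
qed

lemma distribution_abs_meas_class:
  assumes "f \<in> borel_measurable lebesgue"
  shows "distribution \<gamma> (abs_meas_class f) l = emeasure lebesgue {t \<in> half_open_interval \<gamma>. l < \<bar>f t\<bar>}"
  by (subst distribution.abs_eq) (simp_all add: assms)

lemma vanishes_outside_abs_meas_class:
  assumes "f \<in> borel_measurable lebesgue"
  shows "vanishes_outside (abs_meas_class f) A \<longleftrightarrow> (AE t in lebesgue. t \<notin> A \<longrightarrow> f t = 0)"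
  by (subst vanishes_outside.abs_eq) (simp_all add: assms)

lemma sets_superlevel_half_open:
  fixes f :: "real \<Rightarrow> real"
  assumes [measurable]: "f \<in> borel_measurable lebesgue"
  shows "{t \<in> half_open_interval \<gamma>. l < \<bar>f t\<bar>} \<in> sets lebesgue"
proof -
  have "{t \<in> space lebesgue. l < \<bar>f t\<bar>} \<in> sets lebesgue"
    by (rule borel_measurable_less[OF borel_measurable_const borel_measurable_abs[OF assms]])
  from sets.Int[OF half_open_interval_lebesgue this] show ?thesis
    by (rule back_subst[of "\<lambda>A. A \<in> sets lebesgue"]) auto
qed

section \<open>Distribution functions and decreasing rearrangements\<close>

lemma distribution_antimono:
  assumes f: "f \<in> borel_measurable lebesgue" and "l \<le> l'"
  shows "distribution \<gamma> (abs_meas_class f) l' \<le> distribution \<gamma> (abs_meas_class f) l"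
  unfolding distribution_abs_meas_class[OF f]
proof (rule emeasure_mono[OF _ sets_superlevel_half_open[OF f]])
  show "{t \<in> half_open_interval \<gamma>. l' < \<bar>f t\<bar>} \<subseteq> {t \<in> half_open_interval \<gamma>. l < \<bar>f t\<bar>}"
    using le_less_trans[OF assms(2)] by blast
qed

text \<open>The set where \<open>\<bar>f\<bar> > l\<close> is the increasing union of the sets where
  \<open>\<bar>f\<bar> > l + 1 / (n + 1)\<close>, so continuity from below applies. The gap between
  \<open>l\<close> and \<open>l'\<close> keeps the inequality strict when passing to the infimum
  that defines the rearrangement.\<close>

lemma distribution_right_continuous:
  assumes f: "f \<in> borel_measurable lebesgue" and t: "t < distribution \<gamma> (abs_meas_class f) l"
  obtains l' where "l < l'" "t < distribution \<gamma> (abs_meas_class f) l'"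
proof -
  let ?S = "\<lambda>n::nat. {t \<in> half_open_interval \<gamma>. l + 1 / Suc n < \<bar>f t\<bar>}"
  have eq: "(\<Union>n. ?S n) = {t \<in> half_open_interval \<gamma>. l < \<bar>f t\<bar>}"
  proof (intro set_eqI iffI)
    fix s assume "s \<in> {t \<in> half_open_interval \<gamma>. l < \<bar>f t\<bar>}"
    then show "s \<in> (\<Union>n. ?S n)"
      using reals_Archimedean[of "\<bar>f s\<bar> - l"] by (auto simp: field_simps)
  next
    fix s assume "s \<in> (\<Union>n. ?S n)"
    then obtain n where n: "s \<in> half_open_interval \<gamma>" "l + 1 / real (Suc n) < \<bar>f s\<bar>" by blast
    have "l < l + 1 / real (Suc n)" by simp
    from less_trans[OF this n(2)] n(1) show "s \<in> {t \<in> half_open_interval \<gamma>. l < \<bar>f t\<bar>}"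
      by blast
  qed
  have sup: "(SUP n. emeasure lebesgue (?S n)) = emeasure lebesgue (\<Union>n. ?S n)"
  proof (rule SUP_emeasure_incseq)
    show "range ?S \<subseteq> sets lebesgue" by (auto intro: sets_superlevel_half_open[OF f])
    show "incseq ?S"
    proof (intro monoI subsetI)
      fix m n :: nat and s assume "m \<le> n" and s: "s \<in> ?S m"
      then have "1 / real (Suc n) \<le> 1 / real (Suc m)" by (simp add: frac_le)
      then show "s \<in> ?S n" using s by auto
    qed
  qed
  have "t < (SUP n. emeasure lebesgue (?S n))"
    unfolding sup eq by (rule t[unfolded distribution_abs_meas_class[OF f]])
  then obtain n where n: "t < emeasure lebesgue (?S n)" unfolding less_SUP_iff by blast
  show ?thesis
  proof (rule that)
    show "l < l + 1 / real (Suc n)" by simp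
    show "t < distribution \<gamma> (abs_meas_class f) (l + 1 / real (Suc n))"
      unfolding distribution_abs_meas_class[OF f] by (rule n)
  qed
qed

text \<open>Rearrangement and distribution function are generalized inverses of each other.
  Superlevel sets of the rearrangement thus become initial intervals whose length is a value of the
  distribution function, the form in which equimeasurability is used.\<close>

lemma less_rearrangement_iff:
  assumes f: "f \<in> borel_measurable lebesgue" and l: "0 \<le> l"
  shows "ennreal l < rearrangement \<gamma> (abs_meas_class f) t \<longleftrightarrow>
    ennreal t < distribution \<gamma> (abs_meas_class f) l"
proof
  assume "ennreal t < distribution \<gamma> (abs_meas_class f) l"
  then obtain l' where l': "l < l'" "ennreal t < distribution \<gamma> (abs_meas_class f) l'"
    by (rule distribution_right_continuous[OF f])
  have "ennreal l' \<le> rearrangement \<gamma> (abs_meas_class f) t"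
    unfolding rearrangement_def
  proof (rule Inf_greatest)
    fix x assume "x \<in> {ennreal l |l. 0 \<le> l \<and> distribution \<gamma> (abs_meas_class f) l \<le> ennreal t}"
    then obtain k where k: "x = ennreal k" "0 \<le> k" "distribution \<gamma> (abs_meas_class f) k \<le> ennreal t" by blast
    then have "\<not> k \<le> l'"
      using distribution_antimono[OF f, of k l' \<gamma>] l'(2) by (meson leD order_trans)
    then show "ennreal l' \<le> x" using k by (simp add: ennreal_leI)
  qed
  then show "ennreal l < rearrangement \<gamma> (abs_meas_class f) t"
    using l'(1) l by (meson ennreal_less_iff less_le_trans)
next
  assume *: "ennreal l < rearrangement \<gamma> (abs_meas_class f) t"
  show "ennreal t < distribution \<gamma> (abs_meas_class f) l"
  proof (rule ccontr)
    assume "\<not> ?thesis"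
    then have "rearrangement \<gamma> (abs_meas_class f) t \<le> ennreal l"
      unfolding rearrangement_def using l by (intro Inf_lower) (auto simp: not_less)
    then show False using * by simp
  qed
qed

lemma rearrangement_antimono:
  "s \<le> t \<Longrightarrow> rearrangement \<gamma> x t \<le> rearrangement \<gamma> x s"
  unfolding rearrangement_def by (intro Inf_superset_mono) (blast intro: order_trans ennreal_leI)

subsection \<open>Orlicz functions\<close>

lemma Orlicz_function_nonneg: "Orlicz_function \<phi> \<Longrightarrow> 0 \<le> u \<Longrightarrow> 0 \<le> \<phi> u"
  by (cases "u = 0") (auto simp: Orlicz_function_def less_imp_le)

lemma Orlicz_function_convexD:
  assumes "Orlicz_function \<phi>" "0 \<le> a" "0 \<le> b" "a + b = 1" "0 \<le> x" "0 \<le> y"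
  shows "\<phi> (a * x + b * y) \<le> a * \<phi> x + b * \<phi> y"
proof -
  have a: "a = 1 - b" and b: "b \<le> 1" using assms(2,4) by simp_all
  have "convex_on {0..} \<phi>" using assms(1) by (simp add: Orlicz_function_def)
  from convex_onD[OF this assms(3) b, of x y] show ?thesis
    unfolding a using assms(5,6) by simp
qed

lemma Orlicz_function_scale:
  assumes "Orlicz_function \<phi>" "0 \<le> a" "a \<le> 1" "0 \<le> x"
  shows "\<phi> (a * x) \<le> a * \<phi> x"
proof -
  have "\<phi> 0 = 0" using assms(1) by (simp add: Orlicz_function_def)
  then show ?thesis using Orlicz_function_convexD[OF assms(1,2), of "1 - a" x 0] assms(3,4) by simp
qed

lemma Orlicz_function_less:
  assumes \<phi>: "Orlicz_function \<phi>" and "0 \<le> x" "x < y"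
  shows "\<phi> x < \<phi> y"
proof -
  have "\<phi> x \<le> (x / y) * \<phi> y"
    using Orlicz_function_scale[OF \<phi>, of "x / y" y] assms by simp
  also have "\<dots> < 1 * \<phi> y"
    using assms by (intro mult_strict_right_mono) (auto simp: Orlicz_function_def)
  finally show ?thesis by simp
qed

lemma Orlicz_function_mono:
  assumes "Orlicz_function \<phi>" "0 \<le> x" "x \<le> y"
  shows "\<phi> x \<le> \<phi> y"
  using Orlicz_function_less[OF assms(1,2), of y] assms(3) by (cases "x = y") auto

lemma Orlicz_function_less_iff:
  assumes "Orlicz_function \<phi>" "0 \<le> x" "0 \<le> y"
  shows "\<phi> x < \<phi> y \<longleftrightarrow> x < y"
  using Orlicz_function_less[OF assms(1,2), of y] Orlicz_function_mono[OF assms(1,3), of x] by force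

lemma Orlicz_function_superadditive:
  assumes \<phi>: "Orlicz_function \<phi>" and "0 \<le> x" "0 \<le> y"
  shows "\<phi> x + \<phi> y \<le> \<phi> (x + y)"
proof (cases "x + y = 0")
  case False
  have "\<phi> x \<le> (x / (x + y)) * \<phi> (x + y)" "\<phi> y \<le> (y / (x + y)) * \<phi> (x + y)"
    using Orlicz_function_scale[OF \<phi>, of "x / (x + y)" "x + y"]
      Orlicz_function_scale[OF \<phi>, of "y / (x + y)" "x + y"] assms False by auto
  then have "\<phi> x + \<phi> y \<le> (x / (x + y) + y / (x + y)) * \<phi> (x + y)" by (simp add: distrib_right)
  also have "x / (x + y) + y / (x + y) = 1" using False by (simp add: add_divide_distrib[symmetric])
  finally show ?thesis by simp
next
  case True
  then have "x = 0" "y = 0" using assms by simp_all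
  then show ?thesis using \<phi> by (simp add: Orlicz_function_def)
qed

lemma Orlicz_function_continuous:
  assumes \<phi>: "Orlicz_function \<phi>" shows "continuous_on {0..} \<phi>"
proof -
  have c: "convex_on {0..} \<phi>" using \<phi> by (simp add: Orlicz_function_def)
  have pos: "isCont \<phi> x" if "0 < x" for x
  proof -
    have "convex_on {0<..} \<phi>" by (rule convex_on_subset[OF c]) auto
    then have "continuous_on {0<..} \<phi>" by (intro convex_on_continuous) simp_all
    then show ?thesis using that by (simp add: continuous_on_eq_continuous_at)
  qed
  \<comment> \<open>Convexity gives continuity only in the interior; near the endpoint
    \<open>\<phi> u\<close> lies between 0 and \<open>u * \<phi> 1\<close>.\<close>
  have zero: "continuous (at 0 within {0..}) \<phi>"
    unfolding continuous_within
  proof (rule tendsto_sandwich[of "\<lambda>_. 0" _ _ "\<lambda>u. u * \<phi> 1"])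
    show "\<forall>\<^sub>F x in at 0 within {0..}. 0 \<le> \<phi> x"
      unfolding eventually_at
      by (rule exI[of _ 1]) (simp add: Orlicz_function_nonneg[OF \<phi>])
    show "\<forall>\<^sub>F x in at 0 within {0..}. \<phi> x \<le> x * \<phi> 1"
      unfolding eventually_at
    proof (intro exI[of _ 1] conjI ballI impI)
      fix x :: real assume "x \<in> {0..}" "x \<noteq> 0 \<and> dist x 0 < 1"
      then show "\<phi> x \<le> x * \<phi> 1" using Orlicz_function_scale[OF \<phi>, of x 1] by simp
    qed simp
    have "((\<lambda>u. u * \<phi> 1) \<longlongrightarrow> 0 * \<phi> 1) (at 0 within {0..})" by (intro tendsto_intros)
    then show "((\<lambda>u. u * \<phi> 1) \<longlongrightarrow> \<phi> 0) (at 0 within {0..})" using \<phi> by (simp add: Orlicz_function_def)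
    show "((\<lambda>_. 0) \<longlongrightarrow> \<phi> 0) (at 0 within {0..})" using \<phi> by (simp add: Orlicz_function_def)
  qed
  show ?thesis
    unfolding continuous_on_eq_continuous_within
  proof
    fix x :: real assume "x \<in> {0..}"
    then show "continuous (at x within {0..}) \<phi>"
      using zero continuous_at_imp_continuous_at_within[OF pos[of x]] by (cases "x = 0") simp_all
  qed
qed

lemma Orlicz_function_ge_linear:
  assumes \<phi>: "Orlicz_function \<phi>" and "1 \<le> u" shows "u * \<phi> 1 \<le> \<phi> u"
  using Orlicz_function_scale[OF \<phi>, of "1 / u" u] assms by (simp add: field_simps)

lemma Orlicz_function_surj:
  assumes \<phi>: "Orlicz_function \<phi>" and c: "0 \<le> c"
  obtains u where "0 \<le> u" "\<phi> u = c"
proof -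
  define N where "N = max 1 (c / \<phi> 1)"
  have p: "0 < \<phi> 1" using \<phi> by (simp add: Orlicz_function_def)
  have "c \<le> N * \<phi> 1" using p by (simp add: N_def field_simps max_def)
  then have "c \<le> \<phi> N" using Orlicz_function_ge_linear[OF \<phi>, of N] by (simp add: N_def)
  moreover have "continuous_on {0..N} \<phi>"
    using Orlicz_function_continuous[OF \<phi>] by (rule continuous_on_subset) auto
  moreover have "\<phi> 0 \<le> c" "0 \<le> N" using \<phi> c by (simp_all add: Orlicz_function_def N_def)
  ultimately obtain u where "0 \<le> u" "\<phi> u = c"
    using IVT'[of \<phi> 0 c N] by blast
  then show ?thesis by (rule that)
qed

lemma Orlicz_function_comp_abs_measurable:
  assumes \<phi>: "Orlicz_function \<phi>" and [measurable]: "f \<in> borel_measurable M"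
  shows "(\<lambda>t. \<phi> \<bar>f t\<bar>) \<in> borel_measurable M"
proof -
  have "continuous_on UNIV (\<lambda>x. \<phi> \<bar>x\<bar>)"
    by (rule continuous_on_compose2[OF Orlicz_function_continuous[OF \<phi>]]) (auto intro: continuous_on_rabs continuous_on_id)
  from borel_measurable_continuous_on[OF this assms(2)] show ?thesis .
qed

lemma Orlicz_ext_mono:
  assumes \<phi>: "Orlicz_function \<phi>" and "a \<le> b" shows "Orlicz_ext \<phi> a \<le> Orlicz_ext \<phi> b"
  using assms(2)
proof (cases "b = top")
  case False
  then have "a \<noteq> top" using assms(2) by (auto simp: top_unique)
  moreover have "enn2real a \<le> enn2real b"
    using assms(2) False by (simp add: enn2real_mono less_top)
  ultimately show ?thesis
    using False by (simp add: Orlicz_ext_def ennreal_leI Orlicz_function_mono[OF \<phi>])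
qed (simp add: Orlicz_ext_def)

lemma less_Orlicz_ext_iff:
  assumes \<phi>: "Orlicz_function \<phi>" and "0 \<le> l"
  shows "ennreal (\<phi> l) < Orlicz_ext \<phi> a \<longleftrightarrow> ennreal l < a"
  using assms(2)
  by (cases a) (simp_all add: Orlicz_ext_def ennreal_less_iff Orlicz_function_nonneg[OF \<phi>] Orlicz_function_less_iff[OF \<phi>])

text \<open>Were \<open>\<phi> ((1 + \<eta>) * u)\<close> at most \<open>M * \<phi> u\<close> for
  all \<open>u \<ge> u0\<close>, iterating until \<open>(1 + \<eta>) ^ n > 2\<close> would give
  doubling with constant \<open>M ^ n\<close>. Failure of doubling thus persists for dilations
  arbitrarily close to 1, which is what brings the diameter up to 2.\<close>

lemma Orlicz_function_not_doubling:
  assumes \<phi>: "Orlicz_function \<phi>" and no: "\<not> (\<exists>K>0. \<forall>u\<ge>u0. \<phi> (2 * u) \<le> K * \<phi> u)"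
    and u0: "0 \<le> u0" and \<eta>: "0 < \<eta>" and M: "0 < M"
  obtains u where "u0 \<le> u" "0 < u" "M * \<phi> u < \<phi> ((1 + \<eta>) * u)"
proof -
  have "\<exists>u\<ge>u0. M * \<phi> u < \<phi> ((1 + \<eta>) * u)"
  proof (rule ccontr)
    assume "\<not> ?thesis"
    then have le: "\<phi> ((1 + \<eta>) * u) \<le> M * \<phi> u" if "u0 \<le> u" for u using that by force
    have pow: "\<phi> ((1 + \<eta>) ^ n * u) \<le> M ^ n * \<phi> u" if u: "u0 \<le> u" for n u
    proof (induction n)
      case (Suc n)
      have "1 * u \<le> (1 + \<eta>) ^ n * u" using u u0 \<eta> by (intro mult_right_mono one_le_power) simp_all
      then have "\<phi> ((1 + \<eta>) * ((1 + \<eta>) ^ n * u)) \<le> M * \<phi> ((1 + \<eta>) ^ n * u)"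
        using u by (intro le) simp
      also have "\<dots> \<le> M * (M ^ n * \<phi> u)" using Suc M by (intro mult_left_mono) simp_all
      finally show ?case by (simp add: mult_ac)
    qed simp
    obtain n where n: "2 < (1 + \<eta>) ^ n" using real_arch_pow[of "1 + \<eta>" 2] \<eta> by auto
    have "\<phi> (2 * u) \<le> M ^ n * \<phi> u" if u: "u0 \<le> u" for u
    proof -
      have "\<phi> (2 * u) \<le> \<phi> ((1 + \<eta>) ^ n * u)"
        using u u0 n by (intro Orlicz_function_mono[OF \<phi>] mult_right_mono) simp_all
      then show ?thesis using pow[OF u, of n] by simp
    qed
    moreover have "0 < M ^ n" using M by simp
    ultimately show False using no by blast
  qed
  then obtain u where u: "u0 \<le> u" "M * \<phi> u < \<phi> ((1 + \<eta>) * u)" by blast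
  moreover have "u \<noteq> 0" using u \<phi> by (auto simp: Orlicz_function_def)
  ultimately show ?thesis using u0 by (intro that[of u]) simp_all
qed

subsection \<open>Weakly null sequences\<close>

text \<open>Induction over the generation of open sets from the subbasis: finite intersections and
  unions preserve that the sequence is eventually inside. Convergence along each single functional
  therefore suffices.\<close>

lemma openin_weak_topology_sequentially:
  assumes T: "openin (weak_topology_on S N) T" and x: "x \<in> T" "x \<in> S" and z: "\<And>k. z k \<in> S"
    and lim: "\<And>F. F \<in> dual_on S N \<Longrightarrow> (\<lambda>k. F (z k)) \<longlonglongrightarrow> F x"
  shows "\<forall>\<^sub>F k in sequentially. z k \<in> T"
proof -
  have "generate_topology_on {{x \<in> S. f x \<in> U} |f U. f \<in> dual_on S N \<and> open U} T"
    using T by (simp add: weak_topology_on_def openin_topology_generated_by_iff)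
  then show ?thesis using x(1)
  proof (induction rule: generate_topology_on.induct)
    case Empty then show ?case by simp
  next
    case (Int a b) then show ?case by (auto intro: eventually_elim2)
  next
    case (UN K)
    then obtain k where "k \<in> K" "x \<in> k" by blast
    then show ?case using UN.IH[of k] by (auto elim: eventually_mono)
  next
    case (Basis s)
    then obtain F U where F: "s = {x \<in> S. F x \<in> U}" "F \<in> dual_on S N" "open U" by blast
    then have "\<forall>\<^sub>F k in sequentially. F (z k) \<in> U"
      using Basis by (intro topological_tendstoD[OF lim]) auto
    then show ?case using F(1) z by (auto elim: eventually_mono)
  qed
qed

lemma dual_onD:
  assumes "F \<in> dual_on S N"
  shows "x \<in> S \<Longrightarrow> y \<in> S \<Longrightarrow> F (x + y) = F x + F y" "x \<in> S \<Longrightarrow> F (c *\<^sub>R x) = c * F x"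
  using assms by (auto simp: dual_on_def)

text \<open>Bounded signed partial sums make \<open>e\<^sub>k \<mapsto> z\<^sub>k\<close> a bounded operator on \<open>c\<^sub>0\<close>, so every functional
  is absolutely summable along \<open>z\<close>.\<close>

lemma dual_tendsto_0:
  fixes z :: "nat \<Rightarrow> 'a::real_vector"
  assumes F: "F \<in> dual_on S N" and z: "\<And>k. z k \<in> S" and "0 \<in> S"
    and sum: "\<And>c n. (\<And>k. \<bar>c k\<bar> \<le> 1) \<Longrightarrow> (\<Sum>k<n. c k *\<^sub>R z k) \<in> S \<and> N (\<Sum>k<n. c k *\<^sub>R z k) \<in> {0..1}"
    and scale: "\<And>c x. x \<in> S \<Longrightarrow> c *\<^sub>R x \<in> S"
  shows "(\<lambda>k. F (z k)) \<longlonglongrightarrow> 0"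
proof -
  obtain C where C: "\<And>x. x \<in> S \<Longrightarrow> \<bar>F x\<bar> \<le> C * N x" using F unfolding dual_on_def by blast
  \<comment> \<open>These signs make \<open>F\<close> of the partial sum equal to the sum of
    \<open>\<bar>F (z k)\<bar>\<close>, which the norm bound on signed sums controls by
    \<open>\<bar>C\<bar>\<close> uniformly in \<open>n\<close>.\<close>
  define c where "c k = sgn (F (z k))" for k
  have c: "\<bar>c k\<bar> \<le> 1" for k by (simp add: c_def sgn_if)
  have F0: "F 0 = 0" using dual_onD(2)[OF F \<open>0 \<in> S\<close>, of 0] by simp
  have "F (\<Sum>k<n. c k *\<^sub>R z k) = (\<Sum>k<n. \<bar>F (z k)\<bar>)" for n
  proof (induction n)
    case (Suc n)
    have "F ((\<Sum>k<n. c k *\<^sub>R z k) + c n *\<^sub>R z n) = F (\<Sum>k<n. c k *\<^sub>R z k) + c n * F (z n)"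
      using sum[of c n] c z scale dual_onD[OF F] by metis
    then show ?case using Suc by (simp add: c_def abs_sgn mult.commute)
  qed (simp add: F0)
  moreover have "F (\<Sum>k<n. c k *\<^sub>R z k) \<le> \<bar>C\<bar>" for n
  proof -
    have "F (\<Sum>k<n. c k *\<^sub>R z k) \<le> C * N (\<Sum>k<n. c k *\<^sub>R z k)"
      using C[of "\<Sum>k<n. c k *\<^sub>R z k"] sum[of c n] c by (auto simp: abs_le_iff)
    also have "\<dots> \<le> \<bar>C\<bar> * 1"
      using sum[of c n] c by (intro mult_mono) auto
    finally show ?thesis by simp
  qed
  ultimately have "summable (\<lambda>k. \<bar>F (z k)\<bar>)"
    by (intro summableI_nonneg_bounded[of _ "\<bar>C\<bar>"]) (simp_all add: le_fun_def flip: lessThan_Suc_atMost)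
  then show ?thesis using summable_LIMSEQ_zero tendsto_rabs_zero_iff by blast
qed

subsection \<open>The modular\<close>

locale orlicz_lorentz =
  fixes \<gamma> :: ereal and w \<phi> :: "real \<Rightarrow> real"
  assumes gamma_pos: "0 < \<gamma>" and weight: "decreasing_weight \<gamma> w" and orlicz: "Orlicz_function \<phi>"
begin

abbreviation I :: "real set" where "I \<equiv> half_open_interval \<gamma>"

definition rho :: "(real \<Rightarrow> real) \<Rightarrow> ennreal" where
  "rho f = OL_modular \<gamma> \<phi> w (abs_meas_class f)"

text \<open>The weight extended by 0, with the point 0 removed because \<open>w 0\<close> is
  unconstrained. The result is a \<open>decreasing_profile\<close> and can be sliced.\<close>

definition wt :: "real \<Rightarrow> ennreal" where
  "wt t = ennreal (w t) * indicator (I - {0}) t"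

text \<open>\<open>\<phi> \<circ> \<bar>f\<bar>\<close> on \<open>I\<close> and its decreasing rearrangement \<open>\<phi> \<circ> f\<^sup>*\<close> on the half-line.\<close>

definition comp_fun :: "(real \<Rightarrow> real) \<Rightarrow> real \<Rightarrow> ennreal" where
  "comp_fun f t = ennreal (\<phi> \<bar>f t\<bar>) * indicator I t"

definition comp_rearr :: "(real \<Rightarrow> real) \<Rightarrow> real \<Rightarrow> ennreal" where
  "comp_rearr f t = Orlicz_ext \<phi> (rearrangement \<gamma> (abs_meas_class f) t) * indicator {0<..} t"

lemma phi_0: "\<phi> 0 = 0"
  using orlicz by (simp add: Orlicz_function_def)

lemma wt_decreasing: "decreasing_profile wt"
  unfolding decreasing_profile_def
proof (intro conjI allI impI)
  fix t :: real assume "t \<le> 0"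
  then show "wt t = 0" by (auto simp: wt_def half_open_interval_def)
next
  fix s t :: real assume st: "0 < s" "s \<le> t"
  show "wt t \<le> wt s"
  proof (cases "ereal t < \<gamma>")
    case True
    then have "ereal s < \<gamma>" using st by (meson ereal_less_eq(3) le_less_trans)
    then have i: "s \<in> I - {0}" "t \<in> I - {0}" using True st by (auto simp: half_open_interval_def)
    then have "w t \<le> w s"
      using weight st(2) by (auto simp: decreasing_weight_def monotone_on_def)
    then show ?thesis using i by (simp add: wt_def ennreal_leI)
  next
    case False
    then show ?thesis by (simp add: wt_def half_open_interval_def)
  qed
qed

lemma wt_pos: "0 < t \<Longrightarrow> ereal t < \<gamma> \<Longrightarrow> 0 < wt t"
  using weight by (auto simp: wt_def decreasing_weight_def half_open_interval_def)

lemma wt_finite: "wt t < top"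
  by (simp add: wt_def ennreal_mult_less_top indicator_def)

lemma comp_rearr_decreasing: "decreasing_profile (comp_rearr f)"
  by (auto simp: decreasing_profile_def comp_rearr_def intro!: Orlicz_ext_mono[OF orlicz] rearrangement_antimono)

lemmas wt_measurable[measurable] = decreasing_profile_measurable[OF wt_decreasing]
lemmas comp_rearr_measurable[measurable] = decreasing_profile_measurable[OF comp_rearr_decreasing]

lemma I_measurable[measurable]: "I \<in> sets lebesgue"
  by (rule half_open_interval_lebesgue)

lemma comp_fun_measurable[measurable]:
  assumes [measurable]: "f \<in> borel_measurable lebesgue"
  shows "comp_fun f \<in> borel_measurable lebesgue"
proof -
  have [measurable]: "(\<lambda>t. \<phi> \<bar>f t\<bar>) \<in> borel_measurable lebesgue"
    by (rule Orlicz_function_comp_abs_measurable[OF orlicz assms])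
  show ?thesis unfolding comp_fun_def by measurable
qed

lemma rho_eq: "rho f = (\<integral>\<^sup>+t. comp_rearr f t * wt t \<partial>lebesgue)"
  unfolding rho_def OL_modular_def
proof (rule nn_integral_cong_AE)
  have "AE t in lborel. (t::real) \<noteq> 0" by (rule AE_lborel_singleton)
  then have "AE t in lebesgue. (t::real) \<noteq> 0" by (rule AE_completion)
  then show "AE t in lebesgue. Orlicz_ext \<phi> (rearrangement \<gamma> (abs_meas_class f) t) * ennreal (w t) * indicator I t =
      comp_rearr f t * wt t"
  proof (rule AE_mp, intro AE_I2 impI)
    fix t :: real assume "t \<noteq> 0"
    then show "Orlicz_ext \<phi> (rearrangement \<gamma> (abs_meas_class f) t) * ennreal (w t) * indicator I t =
      comp_rearr f t * wt t"
      by (cases "t \<in> I") (auto simp: comp_rearr_def wt_def half_open_interval_def)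
  qed
qed

text \<open>Equimeasurability of \<open>\<phi> \<circ> \<bar>f\<bar>\<close> and its rearrangement.
  Every level \<open>u\<close> is some \<open>\<phi> l\<close> since \<open>\<phi>\<close> is onto,
  and strict monotonicity of \<open>\<phi>\<close> reduces the claim to
  \<open>less_rearrangement_iff\<close> at \<open>l\<close>.\<close>

lemma emeasure_superlevel_comp:
  assumes f: "f \<in> borel_measurable lebesgue" and u: "0 < u"
  shows "emeasure lebesgue {t. ennreal u < comp_rearr f t} = emeasure lebesgue {t. ennreal u < comp_fun f t}"
proof -
  obtain l where l: "0 \<le> l" "\<phi> l = u" using Orlicz_function_surj[OF orlicz, of u] u by auto
  have "ennreal u < comp_rearr f t \<longleftrightarrow> 0 < t \<and> ennreal t < distribution \<gamma> (abs_meas_class f) l" for t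
    using less_Orlicz_ext_iff[OF orlicz l(1)] less_rearrangement_iff[OF f l(1)] l(2)
    by (simp add: comp_rearr_def indicator_def)
  moreover have "ennreal u < comp_fun f t \<longleftrightarrow> t \<in> I \<and> l < \<bar>f t\<bar>" for t
    using Orlicz_function_less_iff[OF orlicz l(1), of "\<bar>f t\<bar>"] l u
    by (simp add: comp_fun_def indicator_def ennreal_less_iff)
  ultimately show ?thesis
    by (simp only: emeasure_below distribution_abs_meas_class[OF f])
qed

lemma comp_rearr_minus:
  assumes f: "f \<in> borel_measurable lebesgue" and l: "0 \<le> l"
  shows "(\<integral>\<^sup>+t. comp_rearr f t - ennreal l \<partial>lebesgue) = (\<integral>\<^sup>+t. comp_fun f t - ennreal l \<partial>lebesgue)"
  using nn_integral_minus_cong_distribution[OF comp_rearr_measurable comp_fun_measurable[OF f]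
      emeasure_superlevel_comp[OF f] l] .

lemma rho_le_combination:
  assumes "f \<in> borel_measurable lebesgue" "g \<in> borel_measurable lebesgue" "h \<in> borel_measurable lebesgue"
    and "0 < a" "0 < b"
    and le: "AE t in lebesgue. t \<in> I \<longrightarrow> \<phi> \<bar>h t\<bar> \<le> a * \<phi> \<bar>f t\<bar> + b * \<phi> \<bar>g t\<bar>"
  shows "rho h \<le> ennreal a * rho f + ennreal b * rho g"
  unfolding rho_eq
proof (rule decreasing_profile_majorization)
  show "AE t in lebesgue. comp_fun h t \<le> ennreal a * comp_fun f t + ennreal b * comp_fun g t"
    using le
  proof (rule AE_mp, intro AE_I2 impI)
    fix t assume *: "t \<in> I \<longrightarrow> \<phi> \<bar>h t\<bar> \<le> a * \<phi> \<bar>f t\<bar> + b * \<phi> \<bar>g t\<bar>"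
    have "0 \<le> a * \<phi> \<bar>f t\<bar>" "0 \<le> b * \<phi> \<bar>g t\<bar>"
      using assms(4,5) Orlicz_function_nonneg[OF orlicz] by simp_all
    then show "comp_fun h t \<le> ennreal a * comp_fun f t + ennreal b * comp_fun g t"
      using * assms(4,5) Orlicz_function_nonneg[OF orlicz]
      by (cases "t \<in> I") (simp_all add: comp_fun_def ennreal_leI flip: ennreal_mult' ennreal_plus)
  qed
qed (use assms in \<open>simp_all add: comp_rearr_decreasing wt_decreasing comp_rearr_minus comp_rearr_measurable comp_fun_measurable\<close>)

lemma rho_mono_scale:
  assumes f: "f \<in> borel_measurable lebesgue" and h: "h \<in> borel_measurable lebesgue" and a: "0 < a"
    and le: "AE t in lebesgue. t \<in> I \<longrightarrow> \<phi> \<bar>h t\<bar> \<le> a * \<phi> \<bar>f t\<bar>"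
  shows "rho h \<le> ennreal a * rho f"
proof -
  \<comment> \<open>The two-term bound is used with \<open>f\<close> twice, because both of its
    coefficients have to be positive.\<close>
  have "rho h \<le> ennreal (a / 2) * rho f + ennreal (a / 2) * rho f"
    using a le by (intro rho_le_combination f h) (auto elim!: eventually_mono)
  also have "\<dots> = ennreal a * rho f"
    using a by (simp add: distrib_right[symmetric] flip: ennreal_plus)
  finally show ?thesis .
qed

lemma rho_mono:
  assumes f: "f \<in> borel_measurable lebesgue" and h: "h \<in> borel_measurable lebesgue"
    and le: "AE t in lebesgue. t \<in> I \<longrightarrow> \<bar>h t\<bar> \<le> \<bar>f t\<bar>"
  shows "rho h \<le> rho f"
proof -
  have "AE t in lebesgue. t \<in> I \<longrightarrow> \<phi> \<bar>h t\<bar> \<le> 1 * \<phi> \<bar>f t\<bar>"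
    using le by (rule AE_mp) (intro AE_I2 impI, simp add: Orlicz_function_mono[OF orlicz])
  from rho_mono_scale[OF f h _ this] show ?thesis by simp
qed

lemma rho_scale:
  assumes f: "f \<in> borel_measurable lebesgue" and c: "0 < c" "c \<le> 1"
  shows "rho (\<lambda>t. c * f t) \<le> ennreal c * rho f"
proof (rule rho_mono_scale[OF f _ c(1)])
  show "(\<lambda>t. c * f t) \<in> borel_measurable lebesgue" using f by measurable
  show "AE t in lebesgue. t \<in> I \<longrightarrow> \<phi> \<bar>c * f t\<bar> \<le> c * \<phi> \<bar>f t\<bar>"
    using c Orlicz_function_scale[OF orlicz, of c] by (intro AE_I2) (simp add: abs_mult)
qed

text \<open>Convexity of the modular in the form needed for differences: only absolute values enter,
  so \<open>h\<close> may be half the sum of \<open>f\<close> and \<open>g\<close>, half their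
  difference, or the mean of their absolute values.\<close>

lemma rho_midpoint:
  assumes f: "f \<in> borel_measurable lebesgue" and g: "g \<in> borel_measurable lebesgue"
    and h: "h \<in> borel_measurable lebesgue"
    and le: "AE t in lebesgue. t \<in> I \<longrightarrow> \<bar>h t\<bar> \<le> (\<bar>f t\<bar> + \<bar>g t\<bar>) / 2"
    and r: "rho f \<le> r" "rho g \<le> r"
  shows "rho h \<le> r"
proof -
  have "rho h \<le> ennreal (1/2) * rho f + ennreal (1/2) * rho g"
  proof (rule rho_le_combination[OF f g h])
    show "AE t in lebesgue. t \<in> I \<longrightarrow> \<phi> \<bar>h t\<bar> \<le> 1/2 * \<phi> \<bar>f t\<bar> + 1/2 * \<phi> \<bar>g t\<bar>"
      using le
    proof (rule AE_mp, intro AE_I2 impI)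
      fix t assume "t \<in> I \<longrightarrow> \<bar>h t\<bar> \<le> (\<bar>f t\<bar> + \<bar>g t\<bar>) / 2" "t \<in> I"
      then have "\<phi> \<bar>h t\<bar> \<le> \<phi> (1/2 * \<bar>f t\<bar> + 1/2 * \<bar>g t\<bar>)"
        by (intro Orlicz_function_mono[OF orlicz]) (simp_all add: field_simps)
      also have "\<dots> \<le> 1/2 * \<phi> \<bar>f t\<bar> + 1/2 * \<phi> \<bar>g t\<bar>"
        by (intro Orlicz_function_convexD[OF orlicz]) simp_all
      finally show "\<phi> \<bar>h t\<bar> \<le> 1/2 * \<phi> \<bar>f t\<bar> + 1/2 * \<phi> \<bar>g t\<bar>" .
    qed
  qed simp_all
  also have "\<dots> \<le> ennreal (1/2) * r + ennreal (1/2) * r"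
    using r by (intro add_mono mult_left_mono) simp_all
  also have "\<dots> = (ennreal (1/2) + ennreal (1/2)) * r" by (rule distrib_right[symmetric])
  also have "ennreal (1/2) + ennreal (1/2) = 1"
    by (subst ennreal_plus[symmetric]) simp_all
  also have "1 * r = r" by simp
  finally show ?thesis .
qed

lemma rho_add_disjoint:
  assumes f: "f \<in> borel_measurable lebesgue" and g: "g \<in> borel_measurable lebesgue"
    and disj: "\<And>t. f t = 0 \<or> g t = 0"
  shows "rho (\<lambda>t. f t + g t) \<le> rho f + rho g"
proof -
  have "rho (\<lambda>t. f t + g t) \<le> ennreal 1 * rho f + ennreal 1 * rho g"
  proof (rule rho_le_combination[OF f g])
    show "(\<lambda>t. f t + g t) \<in> borel_measurable lebesgue" using f g by measurable
    have "\<phi> \<bar>f t + g t\<bar> \<le> 1 * \<phi> \<bar>f t\<bar> + 1 * \<phi> \<bar>g t\<bar>" for t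
      using disj[of t] phi_0 by (elim disjE) simp_all
    then show "AE t in lebesgue. t \<in> I \<longrightarrow> \<phi> \<bar>f t + g t\<bar> \<le> 1 * \<phi> \<bar>f t\<bar> + 1 * \<phi> \<bar>g t\<bar>"
      by (intro AE_I2 impI)
  qed simp_all
  then show ?thesis by simp
qed

section \<open>The primitive of the weight and modulars of step functions\<close>

definition W :: "real \<Rightarrow> ennreal" where
  "W m = (\<integral>\<^sup>+t. wt t * indicator {0<..<m} t \<partial>lebesgue)"

lemma W_mono: "m \<le> n \<Longrightarrow> W m \<le> W n"
  unfolding W_def by (intro nn_integral_mono) (auto simp: indicator_def)

lemma W_0: "W 0 = 0" by (simp add: W_def)

lemma W_finite_inside:
  assumes "0 \<le> m" "ereal m < \<gamma>" shows "W m < top"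
proof -
  have "W m \<le> (\<integral>\<^sup>+s\<in>{0<..<m}. ennreal (w s) \<partial>lebesgue)"
    unfolding W_def by (intro nn_integral_mono) (auto simp: indicator_def wt_def)
  also have "\<dots> < top"
    using weight assms by (auto simp: decreasing_weight_def half_open_interval_def)
  finally show ?thesis .
qed

text \<open>Local integrability covers only \<open>m\<close> below \<open>\<gamma>\<close>. Beyond
  an interior point \<open>g\<close> the weight is bounded by its value at \<open>g\<close>, so for
  finite \<open>\<gamma>\<close> the total mass is finite too.\<close>

lemma W_finite: "W m < top"
proof (cases "0 \<le> m \<longrightarrow> ereal m < \<gamma>")
  case True
  then show ?thesis using W_finite_inside[of m] W_mono[of m 0] W_0 by (cases "0 \<le> m") auto
next
  case False
  then have m: "0 \<le> m" "\<gamma> \<le> ereal m" by auto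
  obtain g where g: "0 < g" "ereal g < \<gamma>" using gamma_pos
    by (metis ereal_dense2 ereal_less(2))
  have "W m \<le> (\<integral>\<^sup>+t. wt t * indicator {0<..<g} t + wt g * indicator {0..m} t \<partial>lebesgue)"
    unfolding W_def
  proof (intro nn_integral_mono)
    fix t show "wt t * indicator {0<..<m} t \<le> wt t * indicator {0<..<g} t + wt g * indicator {0..m} t"
      using wt_decreasing g by (auto simp: decreasing_profile_def indicator_def)
  qed
  also have "\<dots> = W g + (\<integral>\<^sup>+t. wt g * indicator {0..m} t \<partial>lebesgue)"
    unfolding W_def by (rule nn_integral_add) measurable
  also have "(\<integral>\<^sup>+t. wt g * indicator {0..m} t \<partial>lebesgue) = wt g * ennreal m"
    using m by (subst nn_integral_cmult_indicator) simp_all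
  also have "W g + wt g * ennreal m < top"
    using W_finite_inside[of g] g wt_finite[of g] by (simp add: ennreal_mult_less_top)
  finally show ?thesis .
qed

lemma W_pos:
  assumes "0 < m" shows "0 < W m"
proof -
  obtain g where g: "0 < g" "ereal g < min \<gamma> (ereal m)" using gamma_pos assms
    by (metis ereal_dense2 ereal_less(2) min_less_iff_conj)
  have "0 < wt g * ennreal g"
    using wt_pos[of g] g by (simp add: ennreal_zero_less_mult_iff)
  also have "\<dots> = (\<integral>\<^sup>+t. wt g * indicator {0<..<g} t \<partial>lebesgue)"
    using g by (subst nn_integral_cmult_indicator) simp_all
  also have "\<dots> \<le> W m"
    unfolding W_def
  proof (intro nn_integral_mono)
    fix t show "wt g * indicator {0<..<g} t \<le> wt t * indicator {0<..<m} t"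
      using wt_decreasing g by (auto simp: decreasing_profile_def indicator_def)
  qed
  finally show ?thesis .
qed

lemma W_continuous: "continuous_on {0..L} (\<lambda>m. enn2real (W m))"
proof -
  define f where "f t = enn2real (wt t * indicator {0<..<L} t)" for t
  have fe: "ennreal (f t) = wt t * indicator {0<..<L} t" for t
    using wt_finite[of t] by (simp add: f_def indicator_def)
  have fb: "f \<in> borel_measurable borel"
    unfolding f_def using decreasing_profile_borel[OF wt_decreasing] by measurable
  have f0: "0 \<le> f t" for t by (simp add: f_def)
  have "(\<integral>\<^sup>+t. f t \<partial>lborel) = W L"
    by (simp add: fe W_def nn_integral_completion)
  then have "f integrable_on UNIV"
    using W_finite[of L] by (intro nn_integral_integrable_on fb f0) simp
  then have int: "f integrable_on {0..m}" for m
    by (rule integrable_on_subinterval) simp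
  have "enn2real (W m) = integral {0..m} f" if "0 \<le> m" "m \<le> L" for m
  proof -
    have "(\<integral>\<^sup>+t. ennreal (indicator {0..m} t * f t) \<partial>lborel) = ennreal (integral {0..m} f)"
      by (rule nn_integral_has_integral_lebesgue[OF f0 integrable_integral[OF int]])
    moreover have "(\<integral>\<^sup>+t. ennreal (indicator {0..m} t * f t) \<partial>lborel) = (\<integral>\<^sup>+t. wt t * indicator {0<..<m} t \<partial>lborel)"
    proof (rule nn_integral_cong_AE)
      have "AE t in lborel. t \<noteq> m" by (rule AE_lborel_singleton)
      then show "AE t in lborel. ennreal (indicator {0..m} t * f t) = wt t * indicator {0<..<m} t"
      proof (rule AE_mp, intro AE_I2 impI)
        fix t assume "t \<noteq> m"
        then show "ennreal (indicator {0..m} t * f t) = wt t * indicator {0<..<m} t"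
          using that by (auto simp: indicator_def fe)
      qed
    qed
    ultimately have "W m = ennreal (integral {0..m} f)"
      by (simp add: W_def nn_integral_completion)
    then show ?thesis using f0 by (simp add: integral_nonneg int)
  qed
  then have "continuous_on {0..L} (\<lambda>m. enn2real (W m)) \<longleftrightarrow> continuous_on {0..L} (\<lambda>m. integral {0..m} f)"
    by (intro continuous_on_cong) simp_all
  moreover have "continuous_on {0..L} (\<lambda>m. integral {0..m} f)"
    by (rule indefinite_integral_continuous_1[OF int])
  ultimately show ?thesis by simp
qed

lemma W_IVT:
  assumes "0 \<le> L" "0 \<le> c" "ennreal c \<le> W L"
  obtains m where "0 \<le> m" "m \<le> L" "W m = ennreal c"
proof -
  have "c \<le> enn2real (W L)"
    using enn2real_mono[OF assms(3)] W_finite[of L] assms(2) by simp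
  then obtain m where m: "0 \<le> m" "m \<le> L" "enn2real (W m) = c"
    using IVT'[of "\<lambda>m. enn2real (W m)" 0 c L] W_continuous[of L] assms by (auto simp: W_0)
  then have "W m = ennreal c" using W_finite[of m] by auto
  then show ?thesis using m that by blast
qed

lemma W_small:
  assumes "0 < L" "0 < c"
  obtains m where "0 < m" "m \<le> L" "W m \<le> ennreal c"
proof -
  define d where "d = min c (enn2real (W L))"
  have "0 < d" using assms W_pos[of L] W_finite[of L] by (simp add: d_def enn2real_positive_iff)
  moreover have "ennreal d \<le> W L"
    using W_finite[of L] by (metis d_def enn2real_nonneg ennreal_enn2real ennreal_leI min.cobounded2)
  ultimately obtain m where m: "0 \<le> m" "m \<le> L" "W m = ennreal d"
    using W_IVT[of L d] assms by force
  then have "m \<noteq> 0" using \<open>0 < d\<close> W_0 by force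
  then show ?thesis using m by (intro that[of m]) (auto simp: d_def ennreal_leI)
qed

text \<open>The rearrangement of the step equals \<open>u\<close> on \<open>(0, m)\<close> wherever
  \<open>A\<close> lies. Disjoint steps can therefore be placed anywhere in the interval without
  changing their modulars.\<close>

lemma rho_step:
  assumes A: "A \<in> sets lebesgue" "A \<subseteq> I" "emeasure lebesgue A = ennreal m" "0 \<le> m" and u: "0 < u"
  shows "rho (\<lambda>t. u * indicator A t) = ennreal (\<phi> u) * W m"
proof -
  let ?f = "\<lambda>t. u * indicator A t :: real"
  have f: "?f \<in> borel_measurable lebesgue" using A(1) by measurable
  have d: "distribution \<gamma> (abs_meas_class ?f) l = (if l < u then ennreal m else 0)" if "0 \<le> l" for l
  proof -
    have "{t \<in> I. l < \<bar>?f t\<bar>} = (if l < u then A else {})"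
      using A(2) u that by (auto simp: indicator_def split: if_splits)
    then show ?thesis by (simp only: distribution_abs_meas_class[OF f] A(3) emeasure_empty split: if_split)
        simp
  qed
  have small: "\<not> ennreal t < distribution \<gamma> (abs_meas_class ?f) u" for t
    using d[of u] u by simp
  have R: "rearrangement \<gamma> (abs_meas_class ?f) t = (if t < m then ennreal u else 0)" if t: "0 < t" for t
  proof (cases "t < m")
    case True
    have "rearrangement \<gamma> (abs_meas_class ?f) t \<le> ennreal u"
      using less_rearrangement_iff[OF f, of u \<gamma> t] small[of t] u by (simp add: not_less)
    moreover have "ennreal u \<le> rearrangement \<gamma> (abs_meas_class ?f) t"
      unfolding rearrangement_def
    proof (rule Inf_greatest)
      fix x assume "x \<in> {ennreal l |l. 0 \<le> l \<and> distribution \<gamma> (abs_meas_class ?f) l \<le> ennreal t}"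
      then obtain l where l: "x = ennreal l" "0 \<le> l" "distribution \<gamma> (abs_meas_class ?f) l \<le> ennreal t" by blast
      then have "\<not> l < u" using d[of l] True t A(4) by (auto simp: ennreal_le_iff)
      then show "ennreal u \<le> x" using l by (simp add: ennreal_leI)
    qed
    ultimately show ?thesis using True by simp
  next
    case False
    then have "\<not> ennreal 0 < rearrangement \<gamma> (abs_meas_class ?f) t"
      unfolding less_rearrangement_iff[OF f order_refl] using d[of 0] u t by (simp add: not_less ennreal_leI)
    then show ?thesis using False by simp
  qed
  have "comp_rearr ?f t = ennreal (\<phi> u) * indicator {0<..<m} t" for t
  proof (cases "0 < t")
    case True
    then show ?thesis
      using u phi_0 by (cases "t < m") (simp_all add: comp_rearr_def R[OF True] Orlicz_ext_def)
  qed (simp add: comp_rearr_def)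
  then have "rho ?f = (\<integral>\<^sup>+t. ennreal (\<phi> u) * (wt t * indicator {0<..<m} t) \<partial>lebesgue)"
    unfolding rho_eq by (intro nn_integral_cong) (simp add: mult_ac)
  also have "\<dots> = ennreal (\<phi> u) * W m"
    unfolding W_def by (rule nn_integral_cmult) measurable
  finally show ?thesis .
qed

text \<open>Hardy-Littlewood: the integral of \<open>\<phi> \<circ> \<bar>f\<bar>\<close> over
  \<open>B\<close> is at most that of its rearrangement over \<open>{0<..a}\<close>, where the
  weight is at least \<open>wt a\<close>. This bounds ordinary integrals by the modular and
  ultimately makes integration over \<open>B\<close> a bounded functional.\<close>

lemma rho_ge_integral:
  assumes f: "f \<in> borel_measurable lebesgue" and B[measurable]: "B \<in> sets lebesgue" "B \<subseteq> I"
    and a: "emeasure lebesgue B \<le> ennreal a" "0 < a"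
  shows "wt a * (\<integral>\<^sup>+t. ennreal (\<phi> \<bar>f t\<bar>) * indicator B t \<partial>lebesgue) \<le> rho f"
proof -
  let ?G = "comp_rearr f"
  have "(\<integral>\<^sup>+t. ennreal (\<phi> \<bar>f t\<bar>) * indicator B t \<partial>lebesgue) = (\<integral>\<^sup>+t. comp_fun f t * indicator B t \<partial>lebesgue)"
    using B(2) by (intro nn_integral_cong) (auto simp: comp_fun_def indicator_def)
  also have "\<dots> \<le> (\<integral>\<^sup>+t. ?G t * indicator {0<..a} t \<partial>lebesgue)"
  proof (cases "?G a = top")
    case True
    have "?G t = top" if "0 < t" "t \<le> a" for t
      using comp_rearr_decreasing[of f] that True by (metis decreasing_profile_def top_unique)
    then have "(\<integral>\<^sup>+t. ?G t * indicator {0<..a} t \<partial>lebesgue) = (\<integral>\<^sup>+t. top * indicator {0<..a} t \<partial>lebesgue)"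
      by (intro nn_integral_cong) (simp add: indicator_def)
    also have "\<dots> = top"
      using a(2) by (subst nn_integral_cmult) (simp_all add: ennreal_top_mult)
    finally show ?thesis by simp
  next
    case False
    then obtain l where l: "?G a = ennreal l" "0 \<le> l" by (metis ennreal_cases)
    have "(\<integral>\<^sup>+t. comp_fun f t * indicator B t \<partial>lebesgue)
        \<le> ennreal l * emeasure lebesgue B + (\<integral>\<^sup>+t. comp_fun f t - ennreal l \<partial>lebesgue)"
      by (rule nn_integral_le_level[OF comp_fun_measurable[OF f] B(1)])
    also have "\<dots> \<le> ennreal l * emeasure lebesgue {0<..a} + (\<integral>\<^sup>+t. ?G t - ennreal l \<partial>lebesgue)"
      using a by (intro add_mono mult_left_mono) (simp_all add: comp_rearr_minus[OF f l(2)])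
    also have "\<dots> = (\<integral>\<^sup>+t. ?G t * indicator {0<..a} t \<partial>lebesgue)"
    proof (rule nn_integral_split_level[symmetric])
      show "ennreal l \<le> ?G t" if "t \<in> {0<..a}" for t
        using that comp_rearr_decreasing[of f] unfolding l(1)[symmetric] decreasing_profile_def by simp
      show "?G t \<le> ennreal l" if "t \<notin> {0<..a}" for t
        using that comp_rearr_decreasing[of f] a(2) unfolding l(1)[symmetric] decreasing_profile_def
        by (cases "t \<le> 0") simp_all
    qed simp_all
    finally show ?thesis .
  qed
  finally have "wt a * (\<integral>\<^sup>+t. ennreal (\<phi> \<bar>f t\<bar>) * indicator B t \<partial>lebesgue)
      \<le> (\<integral>\<^sup>+t. wt a * (?G t * indicator {0<..a} t) \<partial>lebesgue)"
    by (subst nn_integral_cmult) (simp_all add: mult_left_mono)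
  also have "\<dots> \<le> rho f"
    unfolding rho_eq
  proof (intro nn_integral_mono)
    fix t show "wt a * (?G t * indicator {0<..a} t) \<le> ?G t * wt t"
      using wt_decreasing by (cases "t \<in> {0<..a}") (auto simp: decreasing_profile_def mult.commute intro!: mult_right_mono)
  qed
  finally show ?thesis .
qed

lemma comp_rearr_mono:
  assumes f: "f \<in> borel_measurable lebesgue" and h: "h \<in> borel_measurable lebesgue"
    and le: "\<And>t. t \<in> I \<Longrightarrow> \<bar>h t\<bar> \<le> \<bar>f t\<bar>"
  shows "comp_rearr h t \<le> comp_rearr f t"
proof -
  have "distribution \<gamma> (abs_meas_class h) l \<le> distribution \<gamma> (abs_meas_class f) l" for l
    unfolding distribution_abs_meas_class[OF f] distribution_abs_meas_class[OF h]
    by (rule emeasure_mono[OF _ sets_superlevel_half_open[OF f]]) (use le in \<open>force\<close>)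
  then have "rearrangement \<gamma> (abs_meas_class h) t \<le> rearrangement \<gamma> (abs_meas_class f) t"
    unfolding rearrangement_def by (intro Inf_superset_mono) (blast intro: order_trans)
  then show ?thesis
    unfolding comp_rearr_def by (intro mult_right_mono Orlicz_ext_mono[OF orlicz]) simp_all
qed

text \<open>The rearrangements of \<open>f\<close> and \<open>h\<close> need not respect
  \<open>D\<close>, so the gain is measured by the excesses over
  \<open>\<beta> = \<phi> (\<tau> / 2)\<close>, whose integrals are invariant under rearrangement.
  From \<open>h\<close> to \<open>f\<close> the excess integral grows by at least
  \<open>\<beta>\<close> times the measure of \<open>D\<close>, and by \<open>lvl\<close> the
  rearranged excess of \<open>f\<close> vanishes beyond \<open>M\<close>, hence sits where the
  weight is at least \<open>wt M\<close>.\<close>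

lemma rho_gain:
  assumes f: "f \<in> borel_measurable lebesgue" and h: "h \<in> borel_measurable lebesgue"
    and D[measurable]: "D \<in> sets lebesgue" and DI: "D \<subseteq> I" and rf: "rho f \<le> 1"
    and M: "0 < M" and \<tau>: "0 < \<tau>" and lvl: "1 < ennreal (\<phi> (\<tau> / 2)) * W M"
    and le: "\<And>t. t \<in> I \<Longrightarrow> \<bar>h t\<bar> \<le> \<bar>f t\<bar>"
    and gain: "\<And>t. t \<in> D \<Longrightarrow> \<bar>h t\<bar> + \<tau> \<le> \<bar>f t\<bar>"
  shows "rho h + wt M * (ennreal (\<phi> (\<tau> / 2)) * emeasure lebesgue D) \<le> 1"
proof -
  let ?G = "comp_rearr f" and ?H = "comp_rearr h"
  define \<beta> where "\<beta> = \<phi> (\<tau> / 2)"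
  have \<beta>: "0 \<le> \<beta>" using \<tau> Orlicz_function_nonneg[OF orlicz] by (simp add: \<beta>_def)
  have dec: "?G t \<le> ?G s" "wt t \<le> wt s" if "0 < s" "s \<le> t" for s t
    using that comp_rearr_decreasing[of f] wt_decreasing by (auto simp: decreasing_profile_def)
  have zero: "?G t = 0" "?H t = 0" if "t \<le> 0" for t
    using that by (simp_all add: comp_rearr_def)
  have GM: "?G M \<le> ennreal \<beta>"
  proof (rule ccontr)
    assume "\<not> ?thesis"
    then have "ennreal \<beta> \<le> ?G t" if "0 < t" "t < M" for t
      using dec(1)[of t M] that by simp
    then have "(\<integral>\<^sup>+t. ennreal \<beta> * (wt t * indicator {0<..<M} t) \<partial>lebesgue) \<le> rho f"
      unfolding rho_eq by (intro nn_integral_mono) (auto simp: indicator_def mult_right_mono)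
    then have "ennreal \<beta> * W M \<le> rho f"
      unfolding W_def by (subst (asm) nn_integral_cmult) simp_all
    then show False using lvl rf by (simp add: \<beta>_def)
  qed
  have minus: "x - b \<le> (y - b) + (x - y)" if "y \<le> x" for x y b :: ennreal
  proof -
    have "x \<le> b + (y - b) + (x - y)"
      using ennreal_le_add_diff[of y b] that add_mono[OF ennreal_le_add_diff[of y b] order_refl[of "x - y"]]
      by (simp flip: ennreal_ineq_diff_add)
    then show ?thesis by (simp add: ennreal_minus_le_iff add.assoc)
  qed
  \<comment> \<open>Lowering \<open>?G\<close> to \<open>?H\<close> lowers the excess by at most
    \<open>?G t - ?H t\<close>. Up to \<open>M\<close> each unit of this difference is worth at
    least \<open>wt M\<close> in the modular; beyond \<open>M\<close> the excess of
    \<open>?G\<close> is zero.\<close>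
  have pt: "?H t * wt t + wt M * (?G t - ennreal \<beta>) \<le> ?G t * wt t + wt M * (?H t - ennreal \<beta>)" for t
  proof -
    consider "t \<le> 0" | "0 < t" "t \<le> M" | "M < t" by linarith
    then show ?thesis
    proof cases
      case 1 then show ?thesis by (simp add: zero)
    next
      case 2
      have HG: "?H t \<le> ?G t" by (rule comp_rearr_mono[OF f h le])
      have "?H t * wt t + wt M * (?G t - ennreal \<beta>)
          \<le> ?H t * wt t + wt M * ((?H t - ennreal \<beta>) + (?G t - ?H t))"
        using minus[OF HG] by (intro add_mono mult_left_mono) simp_all
      also have "\<dots> = (?H t * wt t + wt M * (?G t - ?H t)) + wt M * (?H t - ennreal \<beta>)"
        by (simp add: distrib_left add_ac)
      also have "\<dots> \<le> (?H t * wt t + wt t * (?G t - ?H t)) + wt M * (?H t - ennreal \<beta>)"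
        using dec(2)[of t M] 2 by (intro add_mono mult_right_mono) simp_all
      also have "?H t * wt t + wt t * (?G t - ?H t) = (?H t + (?G t - ?H t)) * wt t"
        by (simp only: distrib_left mult.commute[of _ "wt t"])
      also have "?H t + (?G t - ?H t) = ?G t" using HG by (simp flip: ennreal_ineq_diff_add)
      finally show ?thesis .
    next
      case 3
      then have "?G t \<le> ennreal \<beta>" using dec(1)[of M t] M GM by simp
      then have "?G t - ennreal \<beta> = 0" by (simp add: diff_eq_0_iff_ennreal le_less_trans)
      then show ?thesis using comp_rearr_mono[OF f h le, of t]
        by (simp add: add_increasing2 mult_right_mono)
    qed
  qed
  let ?X = "\<integral>\<^sup>+t. comp_fun h t - ennreal \<beta> \<partial>lebesgue" and ?Y = "\<integral>\<^sup>+t. comp_fun f t - ennreal \<beta> \<partial>lebesgue"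
  have "(\<integral>\<^sup>+t. ?H t * wt t + wt M * (?G t - ennreal \<beta>) \<partial>lebesgue)
      \<le> (\<integral>\<^sup>+t. ?G t * wt t + wt M * (?H t - ennreal \<beta>) \<partial>lebesgue)"
    by (intro nn_integral_mono pt)
  then have *: "rho h + wt M * ?Y \<le> rho f + wt M * ?X"
    by (simp add: nn_integral_add nn_integral_cmult rho_eq comp_rearr_minus[OF f \<beta>] comp_rearr_minus[OF h \<beta>])
  have ptF: "(comp_fun h t - ennreal \<beta>) + ennreal \<beta> * indicator D t \<le> comp_fun f t - ennreal \<beta>" for t
  proof (cases "t \<in> D")
    case True
    \<comment> \<open>Two copies of \<open>\<beta>\<close> are needed because
      \<open>\<phi> \<bar>h t\<bar>\<close> may lie below \<open>\<beta>\<close>: one pays for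
      subtracting the level from \<open>\<phi> \<bar>f t\<bar>\<close>, the other is the gain. Hence
      the level is \<open>\<phi>\<close> of half of \<open>\<tau>\<close>.\<close>
    have "\<beta> + \<beta> \<le> \<phi> \<tau>"
      using Orlicz_function_superadditive[OF orlicz, of "\<tau>/2" "\<tau>/2"] \<tau> by (simp add: \<beta>_def)
    moreover have "\<phi> \<bar>h t\<bar> + \<phi> \<tau> \<le> \<phi> (\<bar>h t\<bar> + \<tau>)"
      using \<tau> by (intro Orlicz_function_superadditive[OF orlicz]) simp_all
    moreover have "\<phi> (\<bar>h t\<bar> + \<tau>) \<le> \<phi> \<bar>f t\<bar>"
      using gain[OF True] \<tau> by (intro Orlicz_function_mono[OF orlicz]) simp_all
    ultimately have "max 0 (\<phi> \<bar>h t\<bar> - \<beta>) + \<beta> \<le> \<phi> \<bar>f t\<bar> - \<beta>"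
      using Orlicz_function_nonneg[OF orlicz, of "\<bar>h t\<bar>"] \<beta> by (simp add: max_def)
    then have "ennreal (max 0 (\<phi> \<bar>h t\<bar> - \<beta>)) + ennreal \<beta> \<le> ennreal (\<phi> \<bar>f t\<bar> - \<beta>)"
      using \<beta> by (simp add: ennreal_leI flip: ennreal_plus)
    then show ?thesis
      using True DI \<beta> by (auto simp: comp_fun_def indicator_def ennreal_minus ennreal_max_0)
  next
    case False
    have "comp_fun h t \<le> comp_fun f t"
      using le[of t] by (auto simp: comp_fun_def indicator_def intro!: ennreal_leI Orlicz_function_mono[OF orlicz])
    then show ?thesis using False by (simp add: ennreal_minus_mono)
  qed
  note [measurable] = comp_fun_measurable[OF h] comp_fun_measurable[OF f]
  have "?X + ennreal \<beta> * emeasure lebesgue D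
      = (\<integral>\<^sup>+t. (comp_fun h t - ennreal \<beta>) + ennreal \<beta> * indicator D t \<partial>lebesgue)"
    by (subst nn_integral_add) (simp_all add: nn_integral_cmult_indicator)
  also have "\<dots> \<le> ?Y" by (intro nn_integral_mono ptF)
  finally have XY: "?X + ennreal \<beta> * emeasure lebesgue D \<le> ?Y" .
  \<comment> \<open>Finiteness of \<open>wt M * ?X\<close> has to be secured before this term can be
    cancelled from both sides.\<close>
  have "wt M * (\<integral>\<^sup>+t. ?G t - ennreal \<beta> \<partial>lebesgue) = (\<integral>\<^sup>+t. wt M * (?G t - ennreal \<beta>) \<partial>lebesgue)"
    by (simp add: nn_integral_cmult)
  also have "\<dots> \<le> rho f"
    unfolding rho_eq
  proof (intro nn_integral_mono)
    fix t
    consider "t \<le> 0" | "0 < t" "t \<le> M" | "M < t" by linarith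
    then show "wt M * (?G t - ennreal \<beta>) \<le> ?G t * wt t"
    proof cases
      case 1 then show ?thesis by (simp add: zero)
    next
      case 2
      have "wt M * (?G t - ennreal \<beta>) \<le> wt t * ?G t"
        using dec(2)[of t M] 2 by (intro mult_mono) simp_all
      then show ?thesis by (simp add: mult.commute)
    next
      case 3
      then have "?G t \<le> ennreal \<beta>" using dec(1)[of M t] M GM by simp
      then have "?G t - ennreal \<beta> = 0" by (simp add: diff_eq_0_iff_ennreal le_less_trans)
      then show ?thesis by simp
    qed
  qed
  finally have "wt M * ?Y \<le> 1" using rf by (simp add: comp_rearr_minus[OF f \<beta>])
  moreover have "wt M * ?X \<le> wt M * ?Y"
    using XY by (intro mult_left_mono) (auto intro: order_trans[rotated])
  ultimately have "wt M * ?X \<le> 1" by (rule order_trans[rotated])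
  then have fin: "wt M * ?X < top" by (rule le_less_trans) simp
  have "wt M * ?X + (rho h + wt M * (ennreal \<beta> * emeasure lebesgue D))
      = rho h + wt M * (?X + ennreal \<beta> * emeasure lebesgue D)"
    by (simp add: distrib_left add_ac)
  also have "\<dots> \<le> rho h + wt M * ?Y" using XY by (intro add_mono mult_left_mono) simp_all
  also have "\<dots> \<le> wt M * ?X + rho f" using * by (simp add: add.commute)
  finally have "rho h + wt M * (ennreal \<beta> * emeasure lebesgue D) \<le> rho f"
    using fin by (auto simp add: ennreal_add_left_cancel_le)
  then show ?thesis using rf by (simp add: \<beta>_def)
qed

subsection \<open>The Luxemburg norm\<close>

abbreviation "N \<equiv> Luxemburg_norm \<gamma> \<phi> w"
abbreviation "S \<equiv> OL_space \<gamma> \<phi> w"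

lemma OL_modular_scaleR:
  assumes "f \<in> borel_measurable lebesgue"
  shows "OL_modular \<gamma> \<phi> w (c *\<^sub>R abs_meas_class f) = rho (\<lambda>t. c * f t)"
  by (simp add: rho_def abs_meas_class_scaleR[OF assms])

lemma Luxemburg_norm_abs:
  assumes "f \<in> borel_measurable lebesgue"
  shows "N (abs_meas_class f) = Inf {\<epsilon>. 0 < \<epsilon> \<and> rho (\<lambda>t. f t / \<epsilon>) \<le> 1}"
  by (simp add: Luxemburg_norm_def OL_modular_scaleR[OF assms] divide_inverse mult.commute)

lemma bdd_below_Luxemburg: "bdd_below {\<epsilon>. 0 < \<epsilon> \<and> rho (\<lambda>t. f t / \<epsilon>) \<le> 1}"
  by (rule bdd_belowI[of _ 0]) simp

lemma norm_le:
  assumes "f \<in> borel_measurable lebesgue" "0 < \<epsilon>" "rho (\<lambda>t. f t / \<epsilon>) \<le> 1"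
  shows "N (abs_meas_class f) \<le> \<epsilon>"
  unfolding Luxemburg_norm_abs[OF assms(1)]
  by (rule cInf_lower[OF _ bdd_below_Luxemburg]) (simp add: assms)

lemma mem_space_iff:
  assumes "f \<in> borel_measurable lebesgue"
  shows "abs_meas_class f \<in> S \<longleftrightarrow>
    (AE t in lebesgue. t \<notin> I \<longrightarrow> f t = 0) \<and> (\<exists>c>0. rho (\<lambda>t. c * f t) < \<infinity>)"
  by (simp add: OL_space_def L0_def vanishes_outside_abs_meas_class[OF assms] OL_modular_scaleR[OF assms])

lemma mem_spaceI:
  assumes "f \<in> borel_measurable lebesgue" "AE t in lebesgue. t \<notin> I \<longrightarrow> f t = 0" "rho f < \<infinity>"
  shows "abs_meas_class f \<in> S"
  unfolding mem_space_iff[OF assms(1)] using assms(2,3) by (intro conjI exI[of _ 1]) simp_all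

text \<open>Some multiple has finite modular \<open>r\<close>, and scaling it by
  \<open>1 / (r + 1)\<close> brings the modular down to at most 1 by convexity. So the set defining
  the norm is nonempty; the real infimum of an empty set would carry no information.\<close>

lemma mem_space_rho_le_1:
  assumes f: "f \<in> borel_measurable lebesgue" and S: "abs_meas_class f \<in> S"
  obtains \<epsilon> where "0 < \<epsilon>" "rho (\<lambda>t. f t / \<epsilon>) \<le> 1"
proof -
  obtain c where c: "0 < c" "rho (\<lambda>t. c * f t) < \<infinity>"
    using S by (auto simp: mem_space_iff[OF f])
  then obtain r where r: "rho (\<lambda>t. c * f t) = ennreal r" "0 \<le> r"
    by (metis ennreal_cases infinity_ennreal_def less_irrefl)
  define d where "d = 1 / (r + 1)"
  have d: "0 < d" "d \<le> 1" "d * r \<le> 1" using r(2) by (simp_all add: d_def field_simps)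
  have "rho (\<lambda>t. d * (c * f t)) \<le> ennreal d * ennreal r"
    using rho_scale[of "\<lambda>t. c * f t" d] d f r(1) by simp
  also have "\<dots> \<le> 1" using d r by (simp flip: ennreal_mult')
  finally show ?thesis
    using c(1) d(1) by (intro that[of "1 / (d * c)"]) (simp_all add: mult_ac)
qed

text \<open>The strict inequality avoids the question of whether the infimum is attained; the price
  is that later arguments divide by a number slightly larger than the norm.\<close>

lemma rho_le_1_of_norm_less:
  assumes f: "f \<in> borel_measurable lebesgue" and S: "abs_meas_class f \<in> S"
    and less: "N (abs_meas_class f) < \<epsilon>"
  shows "rho (\<lambda>t. f t / \<epsilon>) \<le> 1"
proof -
  obtain e0 where "0 < e0" "rho (\<lambda>t. f t / e0) \<le> 1" by (rule mem_space_rho_le_1[OF f S])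
  then have "{\<epsilon>. 0 < \<epsilon> \<and> rho (\<lambda>t. f t / \<epsilon>) \<le> 1} \<noteq> {}" by blast
  from cInf_lessD[OF this] less obtain e where e: "0 < e" "rho (\<lambda>t. f t / e) \<le> 1" "e < \<epsilon>"
    unfolding Luxemburg_norm_abs[OF f] by blast
  have "rho (\<lambda>t. f t / \<epsilon>) \<le> rho (\<lambda>t. f t / e)"
  proof (rule rho_mono)
    show "AE t in lebesgue. t \<in> I \<longrightarrow> \<bar>f t / \<epsilon>\<bar> \<le> \<bar>f t / e\<bar>"
      using e by (intro AE_I2) (simp add: abs_divide frac_le)
  qed (use f in measurable)
  then show ?thesis using e(2) by (rule order_trans)
qed

lemma norm_ge:
  assumes f: "f \<in> borel_measurable lebesgue" and S: "abs_meas_class f \<in> S"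
    and gt: "1 < rho (\<lambda>t. f t / \<epsilon>)"
  shows "\<epsilon> \<le> N (abs_meas_class f)"
  using rho_le_1_of_norm_less[OF f S, of \<epsilon>] gt by (meson leD leI)

lemma unit_ball_diff_norm_le:
  assumes x: "x \<in> unit_ball_on S N" and y: "y \<in> unit_ball_on S N"
  shows "N (x - y) \<le> 2"
proof (rule field_le_epsilon)
  fix e :: real assume e: "0 < e"
  obtain f where f: "f \<in> borel_measurable lebesgue" "x = abs_meas_class f" by (rule meas_class_cases)
  obtain g where g: "g \<in> borel_measurable lebesgue" "y = abs_meas_class g" by (rule meas_class_cases)
  have "rho (\<lambda>t. f t / (1 + e / 2)) \<le> 1"
    using x e f by (intro rho_le_1_of_norm_less) (auto simp: unit_ball_on_def)
  moreover have "rho (\<lambda>t. g t / (1 + e / 2)) \<le> 1"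
    using y e g by (intro rho_le_1_of_norm_less) (auto simp: unit_ball_on_def)
  ultimately have "rho (\<lambda>t. (f t - g t) / (2 + e)) \<le> 1"
  proof (rule rho_midpoint[rotated -2])
    have half: "\<bar>x / (1 + e / 2)\<bar> / 2 = \<bar>x\<bar> / (2 + e)" for x
    proof -
      have "x / (1 + e / 2) / 2 = x / (2 + e)" using e by (simp add: field_simps)
      then show ?thesis using e by (metis abs_divide abs_numeral abs_of_pos add_pos_pos zero_less_numeral)
    qed
    have "\<bar>(f t - g t) / (2 + e)\<bar> \<le> (\<bar>f t / (1 + e / 2)\<bar> + \<bar>g t / (1 + e / 2)\<bar>) / 2" for t
      unfolding add_divide_distrib half using e
      by (simp add: abs_divide divide_right_mono flip: add_divide_distrib)
    then show "AE t in lebesgue. t \<in> I \<longrightarrow>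
        \<bar>(f t - g t) / (2 + e)\<bar> \<le> (\<bar>f t / (1 + e / 2)\<bar> + \<bar>g t / (1 + e / 2)\<bar>) / 2" by simp
  qed (use f g in measurable)
  then show "N (x - y) \<le> 2 + e"
    using f g e by (simp add: abs_meas_class_diff norm_le)
qed

lemma norm_nonneg:
  assumes f: "f \<in> borel_measurable lebesgue" and S: "abs_meas_class f \<in> S"
  shows "0 \<le> N (abs_meas_class f)"
proof -
  obtain e0 where "0 < e0" "rho (\<lambda>t. f t / e0) \<le> 1" by (rule mem_space_rho_le_1[OF f S])
  then show ?thesis
    unfolding Luxemburg_norm_abs[OF f] by (intro cInf_greatest) auto
qed

lemma mem_unit_ballI:
  assumes f: "f \<in> borel_measurable lebesgue" and z: "AE t in lebesgue. t \<notin> I \<longrightarrow> f t = 0" and r: "rho f \<le> 1"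
  shows "abs_meas_class f \<in> unit_ball_on S N"
  unfolding unit_ball_on_def
  using mem_spaceI[OF f z le_less_trans[OF r]] norm_le[OF f, of 1] r by simp

section \<open>Scalar multiples and weakly null sequences in the space\<close>

lemma rho_0: "rho (\<lambda>_. 0) = 0"
proof -
  have "comp_rearr (\<lambda>_. 0) t = 0" for t
  proof (cases "0 < t")
    case True
    have "rearrangement \<gamma> (abs_meas_class (\<lambda>_. 0)) t \<le> ennreal 0"
      using less_rearrangement_iff[of "\<lambda>_. 0" 0 \<gamma> t]
      by (simp add: distribution_abs_meas_class not_less[symmetric])
    then show ?thesis by (simp add: comp_rearr_def Orlicz_ext_def phi_0)
  qed (simp add: comp_rearr_def)
  then show ?thesis by (simp add: rho_eq)
qed

lemma space_0: "0 \<in> S"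
  unfolding abs_meas_class_zero by (rule mem_spaceI) (simp_all add: rho_0)

lemma space_scaleR:
  assumes x: "x \<in> S" shows "c *\<^sub>R x \<in> S"
proof (cases "c = 0")
  case True then show ?thesis by (simp add: space_0)
next
  case False
  obtain f where f: "f \<in> borel_measurable lebesgue" "x = abs_meas_class f" by (rule meas_class_cases)
  obtain d where d: "0 < d" "rho (\<lambda>t. d * f t) < \<infinity>"
    and z: "AE t in lebesgue. t \<notin> I \<longrightarrow> f t = 0"
    using x mem_space_iff[OF f(1)] f(2) by blast
  have cf: "(\<lambda>t. c * f t) \<in> borel_measurable lebesgue" using f(1) by measurable
  have "rho (\<lambda>t. (d / \<bar>c\<bar>) * (c * f t)) \<le> rho (\<lambda>t. d * f t)"
  proof (rule rho_mono)
    show "AE t in lebesgue. t \<in> I \<longrightarrow> \<bar>(d / \<bar>c\<bar>) * (c * f t)\<bar> \<le> \<bar>d * f t\<bar>"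
      using False by (intro AE_I2) (simp add: abs_mult)
  qed (use f cf in measurable)
  then have "rho (\<lambda>t. (d / \<bar>c\<bar>) * (c * f t)) < \<infinity>" using d(2) by (rule le_less_trans)
  moreover have "0 < d / \<bar>c\<bar>" using d False by simp
  moreover have "AE t in lebesgue. t \<notin> I \<longrightarrow> c * f t = 0" using z by (auto elim: eventually_mono)
  ultimately show ?thesis
    unfolding f(2) abs_meas_class_scaleR[OF f(1)] mem_space_iff[OF cf] by blast
qed

text \<open>On representatives the norm bound for signed sums becomes a modular bound, which
  disjointness or domination can supply. Each \<open>z k\<close> is itself such a sum, with one
  nonzero coefficient, and hence lies in the space.\<close>

lemma dual_tendsto_0_of_rho:
  fixes z :: "nat \<Rightarrow> real \<Rightarrow> real"
  assumes F: "F \<in> dual_on S N" and z: "\<And>k. z k \<in> borel_measurable lebesgue"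
    and zero: "\<And>k. AE t in lebesgue. t \<notin> I \<longrightarrow> z k t = 0"
    and sum: "\<And>c n. (\<And>k. \<bar>c k\<bar> \<le> 1) \<Longrightarrow> rho (\<lambda>t. \<Sum>k<n. c k * z k t) \<le> 1"
  shows "(\<lambda>k. F (abs_meas_class (z k))) \<longlonglongrightarrow> 0"
proof (rule dual_tendsto_0[OF F])
  note [measurable] = z
  have *: "abs_meas_class (\<lambda>t. \<Sum>k<n. c k * z k t) \<in> unit_ball_on S N" if "\<And>k. \<bar>c k\<bar> \<le> 1" for c n
  proof (rule mem_unit_ballI)
    have "AE t in lebesgue. \<forall>k\<in>{..<n}. t \<notin> I \<longrightarrow> z k t = 0"
      using zero by (intro AE_finite_allI) simp_all
    then show "AE t in lebesgue. t \<notin> I \<longrightarrow> (\<Sum>k<n. c k * z k t) = 0"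
      by (rule AE_mp) (intro AE_I2 impI sum.neutral ballI, simp)
    show "(\<lambda>t. \<Sum>k<n. c k * z k t) \<in> borel_measurable lebesgue" by measurable
  qed (rule sum[OF that])
  have eq: "(\<Sum>k<n. c k *\<^sub>R abs_meas_class (z k)) = abs_meas_class (\<lambda>t. \<Sum>k<n. c k * z k t)" for c n
    by (subst abs_meas_class_sum[symmetric]) (simp_all add: abs_meas_class_scaleR z)
  have m: "(\<lambda>t. \<Sum>k<n. c k * z k t) \<in> borel_measurable lebesgue" for c n by measurable
  show "(\<Sum>k<n. c k *\<^sub>R abs_meas_class (z k)) \<in> S \<and> N (\<Sum>k<n. c k *\<^sub>R abs_meas_class (z k)) \<in> {0..1}"
    if "\<And>k. \<bar>c k\<bar> \<le> 1" for c n
    using *[of c n] that norm_nonneg[OF m] unfolding eq by (auto simp: unit_ball_on_def)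
  show "abs_meas_class (z k) \<in> S" for k
  proof -
    let ?c = "\<lambda>j. if j = k then 1 else 0 :: real"
    have "(\<lambda>t. \<Sum>j<Suc k. ?c j * z j t) = z k"
      by (simp add: fun_eq_iff if_distrib[of "\<lambda>x. x * _"] sum.If_cases cong: if_cong)
    then show ?thesis using *[of ?c "Suc k"] by (simp add: unit_ball_on_def)
  qed
qed (simp_all add: space_0 space_scaleR)

lemma ereal_le_less_gamma: "x \<le> y \<Longrightarrow> ereal y < \<gamma> \<Longrightarrow> ereal x < \<gamma>"
  by (meson ereal_less_eq(3) le_less_trans)

text \<open>Overwriting an element of small modular by \<open>\<plusminus> y\<^sub>k\<close> on pairwise disjoint sets
  \<open>A\<^sub>k\<close>, where \<open>y\<^sub>k\<close> has tiny modular but almost full norm, moves it by a weakly null sequence.\<close>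

lemma diameter_two:
  assumes steps: "\<And>\<eta> \<epsilon> L. 0 < \<eta> \<Longrightarrow> 0 < \<epsilon> \<Longrightarrow> 0 < L \<Longrightarrow> ereal L < \<gamma> \<Longrightarrow>
      \<exists>u m. 0 < u \<and> 0 < m \<and> (\<gamma> < \<infinity> \<longrightarrow> m \<le> L) \<and> ennreal (\<phi> u) * W m \<le> ennreal \<epsilon> \<and>
        1 < ennreal (\<phi> ((1 + \<eta>) * u)) * W m"
    and V: "openin (subtopology (weak_topology_on S N) (unit_ball_on S N)) V" "V \<noteq> {}"
  shows "diameter_wrt N V = 2"
proof -
  obtain T where T: "openin (weak_topology_on S N) T" "V = T \<inter> unit_ball_on S N"
    using V(1) by (auto simp: openin_subtopology)
  obtain x where x: "x \<in> V" using V(2) by blast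
  obtain f where f[measurable]: "f \<in> borel_measurable lebesgue" and xf: "x = abs_meas_class f"
    by (rule meas_class_cases)
  have xS: "abs_meas_class f \<in> S" and xN: "N (abs_meas_class f) \<le> 1" and xT: "abs_meas_class f \<in> T"
    using x T(2) by (auto simp: unit_ball_on_def xf)
  have fz: "AE t in lebesgue. t \<notin> I \<longrightarrow> f t = 0" using xS by (simp add: mem_space_iff)

  have "\<forall>\<^sub>F k in sequentially. (1 - 1 / real (Suc (Suc k))) *\<^sub>R abs_meas_class f \<in> T"
  proof (rule openin_weak_topology_sequentially[OF T(1) xT xS])
    fix F assume F: "F \<in> dual_on S N"
    have "(\<lambda>k. (1 - 1 / real (Suc (Suc k))) * F (abs_meas_class f)) \<longlonglongrightarrow> (1 - 0) * F (abs_meas_class f)"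
      by (intro tendsto_intros LIMSEQ_Suc lim_1_over_n)
    then show "(\<lambda>k. F ((1 - 1 / real (Suc (Suc k))) *\<^sub>R abs_meas_class f)) \<longlonglongrightarrow> F (abs_meas_class f)"
      by (simp add: dual_onD(2)[OF F xS])
  qed (rule space_scaleR[OF xS])
  then obtain k0 where k0: "(1 - 1 / real (Suc (Suc k0))) *\<^sub>R abs_meas_class f \<in> T"
    by (auto simp: eventually_sequentially)
  \<comment> \<open>Shrinking by \<open>c\<close> keeps the point in the weakly open set
    \<open>T\<close> and lowers the modular to at most \<open>1 - \<delta>\<close>, which leaves
    room for an inserted step. The shift by 2 in the index makes \<open>c\<close> positive.\<close>
  define c where "c = 1 - 1 / real (Suc (Suc k0))"
  have c: "0 < c" "c < 1" by (simp_all add: c_def field_simps)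
  define g where "g t = c * f t" for t
  have g[measurable]: "g \<in> borel_measurable lebesgue" unfolding g_def by measurable
  have gT: "abs_meas_class g \<in> T"
    using k0 unfolding c_def[symmetric] abs_meas_class_scaleR[OF f] g_def[abs_def] .
  have gz: "AE t in lebesgue. t \<notin> I \<longrightarrow> g t = 0" using fz by (auto simp: g_def elim: eventually_mono)
  define \<delta> where "\<delta> = (1 - c) / 2"
  have \<delta>: "0 < \<delta>" "\<delta> < 1" using c by (simp_all add: \<delta>_def)
  have rg: "rho g \<le> ennreal (1 - \<delta>)"
  proof -
    \<comment> \<open>A divisor above 1 is needed because the norm may equal 1; this one satisfies
      \<open>c * e = (1 + c) / 2 = 1 - \<delta>\<close>.\<close>
    define e where "e = (1 + c) / (2 * c)"
    have e: "1 < e" "c * e = 1 - \<delta>" using c by (simp_all add: e_def \<delta>_def field_simps)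
    have "rho (\<lambda>t. f t / e) \<le> 1" using xN e by (intro rho_le_1_of_norm_less f xS) simp
    have "rho (\<lambda>t. (c * e) * (f t / e)) \<le> ennreal (c * e) * rho (\<lambda>t. f t / e)"
      using c e \<delta> by (intro rho_scale) simp_all
    also have "\<dots> \<le> ennreal (c * e) * 1" using \<open>rho (\<lambda>t. f t / e) \<le> 1\<close> by (intro mult_left_mono) simp_all
    finally have "rho (\<lambda>t. (c * e) * (f t / e)) \<le> ennreal (1 - \<delta>)" using e by simp
    moreover have "(c * e) * (f t / e) = g t" for t using e(1) by (simp add: g_def)
    ultimately show ?thesis by simp
  qed
  have rg1: "rho g \<le> 1" using rg \<delta>(1) by (simp add: order_trans[OF rg] ennreal_le_1)
  have gS: "abs_meas_class g \<in> S" using mem_unit_ballI[OF g gz rg1] by (simp add: unit_ball_on_def)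

  have lower: "ereal (2 / (1 + \<eta>)) \<le> diameter_wrt N V" if \<eta>: "0 < \<eta>" for \<eta>
  proof -
    \<comment> \<open>Step \<open>k\<close> receives the fraction \<open>1 / 2 ^ Suc k\<close> of
      the modular budget \<open>\<delta>\<close> and, for finite \<open>\<gamma>\<close>, of the
      length \<open>L0\<close>, so all steps fit side by side into the interval. For
      \<open>\<gamma> = \<infinity>\<close> the value 1 is a mere default, lengths being
      unrestricted.\<close>
    define L0 where "L0 = (if \<gamma> = \<infinity> then 1 else real_of_ereal \<gamma> / 2)"
    have L0: "0 < L0" "ereal L0 < \<gamma>" "\<gamma> < \<infinity> \<Longrightarrow> \<gamma> = ereal (2 * L0)"
      using gamma_pos by (cases \<gamma>; simp add: L0_def)+
    have "\<exists>p. 0 < fst p \<and> 0 < snd p \<and> (\<gamma> < \<infinity> \<longrightarrow> snd p \<le> L0 / 2 ^ Suc k) \<and>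
        ennreal (\<phi> (fst p)) * W (snd p) \<le> ennreal (\<delta> / 2 ^ Suc k) \<and>
        1 < ennreal (\<phi> ((1 + \<eta>) * fst p)) * W (snd p)" for k :: nat
    proof -
      have "L0 / 2 ^ Suc k \<le> L0 / 1"
        using L0(1) one_le_power[of "2::real" "Suc k"] by (intro divide_left_mono) simp_all
      then have "ereal (L0 / 2 ^ Suc k) < \<gamma>" using ereal_le_less_gamma[OF _ L0(2)] by simp
      then show ?thesis using steps[OF \<eta>, of "\<delta> / 2 ^ Suc k" "L0 / 2 ^ Suc k"] \<delta>(1) L0(1) by auto
    qed
    then obtain p where p: "\<And>k::nat. 0 < fst (p k)" "\<And>k. 0 < snd (p k)"
        "\<And>k. \<gamma> < \<infinity> \<Longrightarrow> snd (p k) \<le> L0 / 2 ^ Suc k"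
        "\<And>k. ennreal (\<phi> (fst (p k))) * W (snd (p k)) \<le> ennreal (\<delta> / 2 ^ Suc k)"
        "\<And>k. 1 < ennreal (\<phi> ((1 + \<eta>) * fst (p k))) * W (snd (p k))"
      by metis
    define u where "u k = fst (p k)" for k
    define m where "m k = snd (p k)" for k
    define s where "s n = (\<Sum>k<n. m k)" for n
    define A where "A k = {s k..<s (Suc k)}" for k
    have s: "mono s" unfolding s_def by (intro monoI sum_mono2) (auto simp: m_def p(2) less_imp_le)
    have geom: "(\<Sum>k<n. 1 / 2 ^ Suc k) \<le> (1 :: real)" for n
    proof -
      have "(\<Sum>k<n. 1 / 2 ^ Suc k) = (1 :: real) - 1 / 2 ^ n" by (induction n) (simp_all add: field_simps)
      then show ?thesis by simp
    qed
    have s_lt: "ereal (s n) < \<gamma>" for n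
    proof (cases "\<gamma> < \<infinity>")
      case True
      have "s n \<le> (\<Sum>k<n. L0 * (1 / 2 ^ Suc k))" unfolding s_def m_def using p(3)[OF True] by (intro sum_mono) simp
      also have "\<dots> \<le> L0 * 1" unfolding sum_distrib_left[symmetric] using geom L0(1) by (intro mult_left_mono) simp_all
      finally show ?thesis using ereal_le_less_gamma[OF _ L0(2)] by simp
    qed simp
    have s0: "0 \<le> s k" for k using s by (auto simp: mono_def s_def[of 0] dest: spec[of _ 0])
    have A_I: "A k \<subseteq> I" for k
    proof
      fix t assume "t \<in> A k"
      then have "0 \<le> t" "t < s (Suc k)" using s0[of k] by (auto simp: A_def)
      then show "t \<in> I" using ereal_le_less_gamma[OF _ s_lt[of "Suc k"]] by (simp add: half_open_interval_def)
    qed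
    have A_m[measurable]: "A k \<in> sets lebesgue" for k by (simp add: A_def)
    have A_e: "emeasure lebesgue (A k) = ennreal (m k)" for k
      using p(2)[of k] by (simp add: A_def s_def m_def)
    have A_sum: "(\<Sum>k<n. indicator (A k) t) \<le> (1::real)" for n t
      unfolding A_def sum_indicator_partition_le[OF s] by (simp add: indicator_def)
    have A_disj: "t \<notin> A j" if "t \<in> A k" "j < k" for t j k
      using that monoD[OF s, of "Suc j" k] by (auto simp: A_def)
    have ry: "rho (\<lambda>t. a * (u k * indicator (A k) t)) \<le> ennreal (\<delta> / 2 ^ Suc k)" if "\<bar>a\<bar> \<le> 1" for a k
    proof -
      have "rho (\<lambda>t. a * (u k * indicator (A k) t)) \<le> rho (\<lambda>t. u k * indicator (A k) t)"
        using that by (intro rho_mono AE_I2) (simp_all add: abs_mult mult_left_le_one_le)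
      also have "\<dots> = ennreal (\<phi> (u k)) * W (m k)"
        using p(1,2)[of k] by (intro rho_step A_m A_I A_e) (simp_all add: u_def m_def less_imp_le)
      also have "\<dots> \<le> ennreal (\<delta> / 2 ^ Suc k)" using p(4)[of k] by (simp add: u_def m_def)
      finally show ?thesis .
    qed
    have ry\<delta>: "rho (\<lambda>t. a * (u k * indicator (A k) t)) \<le> ennreal \<delta>" if "\<bar>a\<bar> \<le> 1" for a k
    proof -
      have "\<delta> / 2 ^ Suc k \<le> \<delta> / 1"
        using \<delta>(1) one_le_power[of "2::real" "Suc k"] by (intro divide_left_mono) simp_all
      then show ?thesis using order_trans[OF ry[OF that, of k] ennreal_leI] by simp
    qed
    let ?y = "\<lambda>k t. u k * indicator (A k) t" and ?h = "\<lambda>k t. g t * indicator (A k) t"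
    have y_m[measurable]: "?y k \<in> borel_measurable lebesgue" for k by measurable
    have h_m[measurable]: "?h k \<in> borel_measurable lebesgue" for k by measurable
    have y_z: "AE t in lebesgue. t \<notin> I \<longrightarrow> ?y k t = 0" for k
      using A_I[of k] by (intro AE_I2) (auto simp: indicator_def)
    have h_z: "AE t in lebesgue. t \<notin> I \<longrightarrow> ?h k t = 0" for k
      using A_I[of k] by (intro AE_I2) (auto simp: indicator_def)
    have y0: "(\<lambda>k. F (abs_meas_class (?y k))) \<longlonglongrightarrow> 0" if F: "F \<in> dual_on S N" for F
    proof (rule dual_tendsto_0_of_rho[OF F y_m y_z])
      fix a :: "nat \<Rightarrow> real" and n assume a: "\<And>k. \<bar>a k\<bar> \<le> 1"
      have "rho (\<lambda>t. \<Sum>k<n. a k * ?y k t) \<le> ennreal (\<Sum>k<n. \<delta> * (1 / 2 ^ Suc k))"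
      proof (induction n)
        case (Suc n)
        have "rho (\<lambda>t. (\<Sum>k<n. a k * ?y k t) + a n * ?y n t)
            \<le> rho (\<lambda>t. \<Sum>k<n. a k * ?y k t) + rho (\<lambda>t. a n * ?y n t)"
        proof (rule rho_add_disjoint)
          fix t show "(\<Sum>k<n. a k * ?y k t) = 0 \<or> a n * ?y n t = 0"
            using A_disj[of t n] by (cases "t \<in> A n") (auto intro!: sum.neutral)
        qed measurable
        also have "\<dots> \<le> ennreal (\<Sum>k<n. \<delta> * (1 / 2 ^ Suc k)) + ennreal (\<delta> * (1 / 2 ^ Suc n))"
          using Suc ry[OF a, of n n] by (intro add_mono) simp_all
        also have "\<dots> = ennreal (\<Sum>k<Suc n. \<delta> * (1 / 2 ^ Suc k))"
          using \<delta>(1) by (simp add: sum_nonneg flip: ennreal_plus)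
        finally show ?case by simp
      qed (simp add: rho_0)
      also have "(\<Sum>k<n. \<delta> * (1 / 2 ^ Suc k)) \<le> \<delta> * 1"
        unfolding sum_distrib_left[symmetric] using geom \<delta>(1) by (intro mult_left_mono) simp_all
      then have "ennreal (\<Sum>k<n. \<delta> * (1 / 2 ^ Suc k)) \<le> 1" using \<delta>(2) by (simp add: ennreal_le_1)
      finally show "rho (\<lambda>t. \<Sum>k<n. a k * ?y k t) \<le> 1" .
    qed
    \<comment> \<open>Nothing is claimed about the norms of the pieces of \<open>g\<close> on the
      sets \<open>A k\<close>. They tend weakly to 0 because their signed partial sums stay below
      \<open>\<bar>g\<bar>\<close> in absolute value.\<close>
    have h0: "(\<lambda>k. F (abs_meas_class (?h k))) \<longlonglongrightarrow> 0" if F: "F \<in> dual_on S N" for F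
    proof (rule dual_tendsto_0_of_rho[OF F h_m h_z])
      fix a :: "nat \<Rightarrow> real" and n assume a: "\<And>k. \<bar>a k\<bar> \<le> 1"
      have "rho (\<lambda>t. \<Sum>k<n. a k * ?h k t) \<le> rho g"
      proof (rule rho_mono[OF g _ AE_I2], measurable, intro impI)
        fix t
        have "\<bar>\<Sum>k<n. a k * ?h k t\<bar> \<le> (\<Sum>k<n. \<bar>g t\<bar> * indicator (A k) t)"
        proof (intro sum_norm_le[where 'a=real, unfolded real_norm_def])
          fix k show "\<bar>a k * ?h k t\<bar> \<le> \<bar>g t\<bar> * indicator (A k) t"
            using a[of k] by (simp add: abs_mult indicator_def mult_left_le_one_le)
        qed
        also have "\<dots> \<le> \<bar>g t\<bar> * 1"
          unfolding sum_distrib_left[symmetric] using A_sum by (intro mult_left_mono) simp_all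
        finally show "\<bar>\<Sum>k<n. a k * ?h k t\<bar> \<le> \<bar>g t\<bar>" by simp
      qed
      then show "rho (\<lambda>t. \<Sum>k<n. a k * ?h k t) \<le> 1" using rg1 by (rule order_trans)
    qed
    define v where "v a k t = (g t - ?h k t) + a * ?y k t" for a :: real and k t
    have v_m[measurable]: "v a k \<in> borel_measurable lebesgue" for a k unfolding v_def by measurable
    have v_ball: "abs_meas_class (v a k) \<in> unit_ball_on S N" if "\<bar>a\<bar> \<le> 1" for a k
    proof (rule mem_unit_ballI[OF v_m])
      show "AE t in lebesgue. t \<notin> I \<longrightarrow> v a k t = 0"
        using gz A_I[of k] by (auto simp: v_def indicator_def elim!: eventually_mono)
      have "rho (v a k) \<le> rho (\<lambda>t. g t - ?h k t) + rho (\<lambda>t. a * ?y k t)"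
        unfolding v_def by (rule rho_add_disjoint) (measurable, auto simp add: indicator_def)
      also have "rho (\<lambda>t. g t - ?h k t) \<le> rho g"
        by (rule rho_mono[OF g _ AE_I2]) (measurable, simp add: indicator_def)
      then have "rho (\<lambda>t. g t - ?h k t) + rho (\<lambda>t. a * ?y k t) \<le> ennreal (1 - \<delta>) + ennreal \<delta>"
        using rg ry\<delta>[OF that, of k] by (intro add_mono) (auto intro: order_trans)
      also have "\<dots> = 1" using \<delta> by (simp flip: ennreal_plus)
      finally show "rho (v a k) \<le> 1" .
    qed
    have v_ev: "\<forall>\<^sub>F k in sequentially. abs_meas_class (v a k) \<in> T" if a: "\<bar>a\<bar> \<le> 1" for a
    proof (rule openin_weak_topology_sequentially[OF T(1) gT gS])
      show "abs_meas_class (v a k) \<in> S" for k using v_ball[OF a] by (simp add: unit_ball_on_def)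
      fix F assume F: "F \<in> dual_on S N"
      have yS: "abs_meas_class (?y k) \<in> S" for k
        using ry\<delta>[of 1 k] by (intro mem_spaceI y_m y_z) (auto intro: le_less_trans)
      have hS: "abs_meas_class (?h k) \<in> S" for k
      proof (intro mem_spaceI h_m h_z)
        have "rho (?h k) \<le> rho g" by (rule rho_mono[OF g h_m AE_I2]) (simp add: indicator_def)
        from order_trans[OF this rg1] show "rho (?h k) < \<infinity>" by (rule le_less_trans) simp
      qed
      have vS: "abs_meas_class (v a k) \<in> S" for k using v_ball[OF a] by (simp add: unit_ball_on_def)
      have "F (abs_meas_class (v a k)) = F (abs_meas_class g) - F (abs_meas_class (?h k)) + a * F (abs_meas_class (?y k))" for k
      proof -
        \<comment> \<open>Written with sums on both sides, because members of the dual are additive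
          only on the space and all four terms are known to lie in it.\<close>
        have "abs_meas_class (v a k) + abs_meas_class (?h k) = abs_meas_class g + a *\<^sub>R abs_meas_class (?y k)"
          by (simp add: abs_meas_class_scaleR abs_meas_class_add) (simp add: v_def)
        then have "F (abs_meas_class (v a k)) + F (abs_meas_class (?h k)) = F (abs_meas_class g) + a * F (abs_meas_class (?y k))"
          using dual_onD(1)[OF F vS[of k] hS[of k]] dual_onD(1)[OF F gS space_scaleR[OF yS[of k]], of a]
            dual_onD(2)[OF F yS[of k], of a] by simp
        then show ?thesis by simp
      qed
      moreover have "(\<lambda>k. F (abs_meas_class g) - F (abs_meas_class (?h k)) + a * F (abs_meas_class (?y k)))
          \<longlonglongrightarrow> F (abs_meas_class g) - 0 + a * 0"
        by (intro tendsto_intros h0[OF F] y0[OF F])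
      ultimately show "(\<lambda>k. F (abs_meas_class (v a k))) \<longlonglongrightarrow> F (abs_meas_class g)" by simp
    qed
    have "\<forall>\<^sub>F k in sequentially. abs_meas_class (v 1 k) \<in> T \<and> abs_meas_class (v (-1) k) \<in> T"
      using v_ev[of 1] v_ev[of "-1"] by (intro eventually_conj) simp_all
    then obtain k where k: "abs_meas_class (v 1 k) \<in> T" "abs_meas_class (v (-1) k) \<in> T"
      by (auto simp: eventually_sequentially)
    then have kV: "abs_meas_class (v 1 k) \<in> V" "abs_meas_class (v (-1) k) \<in> V"
      using v_ball[of 1 k] v_ball[of "-1" k] T(2) by auto
    have d_eq: "abs_meas_class (v 1 k) - abs_meas_class (v (-1) k) = abs_meas_class (\<lambda>t. 2 * ?y k t)"
      by (simp add: abs_meas_class_diff) (simp add: v_def)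
    have d_m: "(\<lambda>t. 2 * ?y k t) \<in> borel_measurable lebesgue" by measurable
    have dS: "abs_meas_class (\<lambda>t. 2 * ?y k t) \<in> S"
    proof -
      have "abs_meas_class (?y k) \<in> S"
        using ry\<delta>[of 1 k] by (intro mem_spaceI y_m y_z) (auto intro: le_less_trans)
      then show ?thesis using space_scaleR[of _ 2] abs_meas_class_scaleR[OF y_m, of 2 k] by metis
    qed
    have "rho (\<lambda>t. 2 * ?y k t / (2 / (1 + \<eta>))) = rho (\<lambda>t. ((1 + \<eta>) * u k) * indicator (A k) t)"
      using \<eta> by (intro arg_cong[where f=rho]) (simp add: fun_eq_iff field_simps)
    also have "\<dots> = ennreal (\<phi> ((1 + \<eta>) * u k)) * W (m k)"
      using p(1,2)[of k] \<eta> by (intro rho_step A_m A_I A_e) (simp_all add: u_def m_def less_imp_le)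
    also have "\<dots> > 1" using p(5)[of k] by (simp add: u_def m_def)
    finally have "2 / (1 + \<eta>) \<le> N (abs_meas_class (\<lambda>t. 2 * ?y k t))"
      by (intro norm_ge d_m dS)
    then have "ereal (2 / (1 + \<eta>)) \<le> ereal (N (abs_meas_class (v 1 k) - abs_meas_class (v (-1) k)))"
      unfolding d_eq by simp
    also have "\<dots> \<le> diameter_wrt N V"
      unfolding diameter_wrt_def using kV by (intro SUP_upper2[of "(abs_meas_class (v 1 k), abs_meas_class (v (-1) k))"]) auto
    finally show ?thesis .
  qed
  show ?thesis
  proof (rule antisym)
    show "diameter_wrt N V \<le> 2"
      unfolding diameter_wrt_def
    proof (intro SUP_least)
      fix q assume "q \<in> V \<times> V"
      then show "(case q of (x, y) \<Rightarrow> ereal (N (x - y))) \<le> 2"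
        using unit_ball_diff_norm_le[of "fst q" "snd q"] T(2) by (auto simp: case_prod_beta)
    qed
    show "2 \<le> diameter_wrt N V"
    proof (rule LIMSEQ_le_const2)
      have "(\<lambda>n. 2 / (1 + 1 / real (Suc n))) \<longlonglongrightarrow> 2 / (1 + 0)"
        by (intro tendsto_intros LIMSEQ_Suc lim_1_over_n) simp
      then show "(\<lambda>n. ereal (2 / (1 + 1 / real (Suc n)))) \<longlonglongrightarrow> 2" by simp
      show "\<exists>n0. \<forall>n\<ge>n0. ereal (2 / (1 + 1 / real (Suc n))) \<le> diameter_wrt N V"
        by (intro exI[of _ 0] allI impI lower) simp
    qed
  qed
qed

subsection \<open>The growth condition\<close>

lemma phi_pos: "0 < u \<Longrightarrow> 0 < \<phi> u"
  using orlicz by (simp add: Orlicz_function_def)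

lemma W_unbounded:
  assumes \<gamma>: "\<gamma> = \<infinity>" and inf: "(\<integral>\<^sup>+t\<in>{0<..}. ennreal (w t) \<partial>lebesgue) = \<infinity>"
  obtains L where "0 < L" "ennreal c \<le> W L"
proof -
  have "(SUP n. W (real n)) = (\<integral>\<^sup>+t. (SUP n. wt t * indicator {0<..<real n} t) \<partial>lebesgue)"
    unfolding W_def
  proof (rule nn_integral_monotone_convergence_SUP[symmetric])
    show "incseq (\<lambda>n t. wt t * indicator {0<..<real n} t)"
      by (intro incseq_SucI le_funI) (auto simp: indicator_def)
  qed simp
  also have "\<dots> = (\<integral>\<^sup>+t\<in>{0<..}. ennreal (w t) \<partial>lebesgue)"
  proof (rule nn_integral_cong)
    fix t :: real
    show "(SUP n. wt t * indicator {0<..<real n} t) = ennreal (w t) * indicator {0<..} t"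
    proof (cases "0 < t")
      case True
      obtain n where n: "t < real n" using reals_Archimedean2 by blast
      have "wt t * indicator {0<..<real n} t \<le> (SUP n. wt t * indicator {0<..<real n} t)"
        by (rule SUP_upper) simp
      then have "wt t \<le> (SUP n. wt t * indicator {0<..<real n} t)" using n True by simp
      moreover have "(SUP n. wt t * indicator {0<..<real n} t) \<le> wt t"
        by (intro SUP_least) (simp add: indicator_def)
      moreover have "t \<in> I - {0}" using True \<gamma> by (simp add: half_open_interval_def)
      then have "wt t = ennreal (w t)" by (simp add: wt_def)
      ultimately show ?thesis using True by simp
    qed simp
  qed
  finally have "(SUP n. W (real n)) = top" using inf by simp
  moreover have "ennreal c < top" by simp
  ultimately have "ennreal c < (SUP n. W (real n))" by metis
  then obtain n where "ennreal c < W (real n)" unfolding less_SUP_iff by blast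
  then show ?thesis
    using W_mono[of "real n" "real (Suc n)"] by (intro that[of "real (Suc n)"]) simp_all
qed

text \<open>Choose \<open>u\<close> whose dilation multiplies \<open>\<phi>\<close> by more than
  \<open>2 / \<epsilon>\<close>, then \<open>m\<close> with
  \<open>W m = \<epsilon> / \<phi> u\<close>: the step has modular exactly
  \<open>\<epsilon>\<close>, its dilation by \<open>1 + \<eta>\<close> more than 2. The hypothesis
  \<open>W\<close> says that this mass is available within the admissible length.\<close>

lemma step_exists:
  assumes no: "\<not> (\<exists>K>0. \<forall>u\<ge>u0. \<phi> (2 * u) \<le> K * \<phi> u)" and u0: "0 \<le> u0"
    and \<eta>: "0 < \<eta>" and \<epsilon>: "0 < \<epsilon>"
    and W: "\<And>u. u0 \<le> u \<Longrightarrow> 0 < u \<Longrightarrow> \<exists>L'\<ge>0. (\<gamma> < \<infinity> \<longrightarrow> L' \<le> L) \<and> ennreal (\<epsilon> / \<phi> u) \<le> W L'"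
  shows "\<exists>u m. 0 < u \<and> 0 < m \<and> (\<gamma> < \<infinity> \<longrightarrow> m \<le> L) \<and> ennreal (\<phi> u) * W m \<le> ennreal \<epsilon> \<and>
        1 < ennreal (\<phi> ((1 + \<eta>) * u)) * W m"
proof -
  obtain u where u: "u0 \<le> u" "0 < u" "2 / \<epsilon> * \<phi> u < \<phi> ((1 + \<eta>) * u)"
    using Orlicz_function_not_doubling[OF orlicz no u0 \<eta>, of "2 / \<epsilon>"] \<epsilon> by auto
  have p: "0 < \<phi> u" by (rule phi_pos[OF u(2)])
  obtain L' where L': "0 \<le> L'" "\<gamma> < \<infinity> \<Longrightarrow> L' \<le> L" "ennreal (\<epsilon> / \<phi> u) \<le> W L'"
    using W[OF u(1,2)] by blast
  obtain m where m: "0 \<le> m" "m \<le> L'" "W m = ennreal (\<epsilon> / \<phi> u)"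
    using W_IVT[OF L'(1) _ L'(3)] p \<epsilon> by auto
  have "m \<noteq> 0" using m(3) W_0 p \<epsilon> by auto
  moreover have "ennreal (\<phi> u) * W m = ennreal \<epsilon>"
    using p \<epsilon> unfolding m(3) by (simp flip: ennreal_mult')
  moreover have "1 < \<phi> ((1 + \<eta>) * u) * (\<epsilon> / \<phi> u)"
    using u(3) p \<epsilon> by (simp add: field_simps)
  then have "1 < ennreal (\<phi> ((1 + \<eta>) * u)) * W m"
    using p \<epsilon> phi_pos[of "(1 + \<eta>) * u"] \<eta> u(2) unfolding m(3)
    by (simp flip: ennreal_mult' add: one_less_ennreal)
  ultimately show ?thesis using u(2) m(1,2) L'(2) by (intro exI[of _ u] exI[of _ m]) auto
qed

text \<open>Doubling may fail at small \<open>u\<close> only, where the required mass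
  \<open>\<epsilon> / \<phi> u\<close> is large; the infinite total weight provides it, and no bound
  on the length applies.\<close>

lemma steps_infinite:
  assumes "\<gamma> = \<infinity>" "(\<integral>\<^sup>+t\<in>{0<..}. ennreal (w t) \<partial>lebesgue) = \<infinity>" "\<not> Delta2 \<phi>" "0 < \<eta>" "0 < \<epsilon>"
  shows "\<exists>u m. 0 < u \<and> 0 < m \<and> (\<gamma> < \<infinity> \<longrightarrow> m \<le> L) \<and> ennreal (\<phi> u) * W m \<le> ennreal \<epsilon> \<and>
        1 < ennreal (\<phi> ((1 + \<eta>) * u)) * W m"
proof (rule step_exists[of 0])
  fix u :: real
  obtain L' where "0 < L'" "ennreal (\<epsilon> / \<phi> u) \<le> W L'" by (rule W_unbounded[OF assms(1,2)])
  then show "\<exists>L'\<ge>0. (\<gamma> < \<infinity> \<longrightarrow> L' \<le> L) \<and> ennreal (\<epsilon> / \<phi> u) \<le> W L'"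
    using assms(1) by (auto intro!: exI[of _ L'])
qed (use assms in \<open>simp_all add: Delta2_def\<close>)

text \<open>The threshold \<open>u0\<close> is chosen so that
  \<open>\<epsilon> / \<phi> u \<le> W L\<close> for all \<open>u \<ge> u0\<close>; the required
  mass then fits into length \<open>L\<close>. Failure of doubling at infinity supplies heights
  above any such threshold.\<close>

lemma steps_finite:
  assumes no: "\<not> Delta2_infinity \<phi>" and "0 < \<eta>" "0 < \<epsilon>" and L: "0 < L"
  shows "\<exists>u m. 0 < u \<and> 0 < m \<and> (\<gamma> < \<infinity> \<longrightarrow> m \<le> L) \<and> ennreal (\<phi> u) * W m \<le> ennreal \<epsilon> \<and>
        1 < ennreal (\<phi> ((1 + \<eta>) * u)) * W m"
proof -
  define r where "r = enn2real (W L)"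
  have r: "0 < r" "W L = ennreal r"
    using W_pos[OF L] W_finite[of L] by (simp_all add: r_def enn2real_positive_iff)
  obtain u0 where u0: "0 \<le> u0" "\<phi> u0 = \<epsilon> / r"
    using Orlicz_function_surj[OF orlicz, of "\<epsilon> / r"] r assms by auto
  show ?thesis
  proof (rule step_exists[of u0])
    fix u :: real assume u: "u0 \<le> u" "0 < u"
    have "\<epsilon> / r \<le> \<phi> u" using Orlicz_function_mono[OF orlicz u0(1) u(1)] u0(2) by simp
    then have "\<epsilon> / \<phi> u \<le> r" using r phi_pos[OF u(2)] by (simp add: field_simps)
    then show "\<exists>L'\<ge>0. (\<gamma> < \<infinity> \<longrightarrow> L' \<le> L) \<and> ennreal (\<epsilon> / \<phi> u) \<le> W L'"
      using L r by (intro exI[of _ L]) (simp add: ennreal_leI)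
  qed (use assms u0 in \<open>auto simp: Delta2_infinity_def\<close>)
qed

section \<open>Modular doubling and the norm of integration over small sets\<close>

lemma rho_double:
  assumes "\<gamma> = \<infinity> \<and> Delta2 \<phi> \<or> \<gamma> < \<infinity> \<and> Delta2_infinity \<phi>"
  obtains K :: real where "0 \<le> K"
    "\<And>f. f \<in> borel_measurable lebesgue \<Longrightarrow> rho f \<le> 1 \<Longrightarrow> rho (\<lambda>t. 2 * f t) \<le> ennreal K"
  using assms
proof (elim disjE conjE)
  assume "\<gamma> = \<infinity>" "Delta2 \<phi>"
  then obtain K where K: "0 < K" "\<And>u. 0 \<le> u \<Longrightarrow> \<phi> (2 * u) \<le> K * \<phi> u" by (auto simp: Delta2_def)
  have "rho (\<lambda>t. 2 * f t) \<le> ennreal K" if f[measurable]: "f \<in> borel_measurable lebesgue" "rho f \<le> 1" for f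
  proof -
    have "rho (\<lambda>t. 2 * f t) \<le> ennreal K * rho f"
      using K by (intro rho_mono_scale f AE_I2) (measurable, simp add: abs_mult)
    also have "\<dots> \<le> ennreal K * 1" using f by (intro mult_left_mono) simp_all
    finally show ?thesis by simp
  qed
  then show thesis using K(1) by (intro that[of K]) simp_all
next
  assume \<gamma>: "\<gamma> < \<infinity>" and "Delta2_infinity \<phi>"
  then obtain K u0 where K: "0 < K" "0 \<le> u0" "\<And>u. u0 \<le> u \<Longrightarrow> \<phi> (2 * u) \<le> K * \<phi> u"
    by (auto simp: Delta2_infinity_def)
  obtain r where r: "\<gamma> = ereal r" "0 < r" using \<gamma> gamma_pos by (cases \<gamma>) auto
  have Ir: "I = {0..<r}" by (auto simp: r half_open_interval_def)
  \<comment> \<open>Where \<open>\<bar>f\<bar>\<close> is below \<open>u0\<close>, the doubled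
    function is dominated by the constant \<open>c\<close>, whose modular over the bounded interval
    is finite. Adding 1 keeps the constant positive when \<open>u0 = 0\<close>, as
    \<open>rho_step\<close> requires.\<close>
  define c where "c = 2 * (u0 + 1)"
  have c: "0 < c" "2 * u0 \<le> c" using K(2) by (simp_all add: c_def)
  let ?g = "\<lambda>t. c * indicator I t :: real"
  have g: "rho ?g = ennreal (\<phi> c) * W r"
  proof (rule rho_step[OF I_measurable])
    show "emeasure lebesgue I = ennreal r" unfolding Ir using r(2) by simp
  qed (use c r in simp_all)
  define B where "B = K + \<phi> c * enn2real (W r)"
  have le: "\<phi> (2 * u) \<le> K * \<phi> u + \<phi> c" if "0 \<le> u" for u
  proof (cases "u0 \<le> u")
    case True
    then show ?thesis using K(3)[of u] Orlicz_function_nonneg[OF orlicz, of c] c(1) by simp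
  next
    case False
    then have "\<phi> (2 * u) \<le> \<phi> c" using that c by (intro Orlicz_function_mono[OF orlicz]) simp_all
    moreover have "0 \<le> K * \<phi> u" using K(1) Orlicz_function_nonneg[OF orlicz that] by simp
    ultimately show ?thesis by simp
  qed
  have "rho (\<lambda>t. 2 * f t) \<le> ennreal B" if f[measurable]: "f \<in> borel_measurable lebesgue" "rho f \<le> 1" for f
  proof -
    have "rho (\<lambda>t. 2 * f t) \<le> ennreal K * rho f + ennreal 1 * rho ?g"
      using K(1) c le by (intro rho_le_combination f AE_I2) (measurable, simp_all add: abs_mult)
    also have "\<dots> \<le> ennreal K * 1 + ennreal 1 * rho ?g" using f by (intro add_mono mult_left_mono) simp_all
    also have "\<dots> = ennreal B"
      using W_finite[of r] K c Orlicz_function_nonneg[OF orlicz, of c]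
      by (simp add: g B_def ennreal_plus ennreal_mult')
    finally show ?thesis .
  qed
  moreover have "0 \<le> B" using K c Orlicz_function_nonneg[OF orlicz, of c] by (simp add: B_def)
  ultimately show thesis by (intro that[of B])
qed

text \<open>\<open>Psi a\<close> is the norm of integration over sets of measure at most \<open>a\<close>.\<close>

definition Psi :: "real \<Rightarrow> ennreal" where
  "Psi a = (SUP (f, B) \<in> {(f, B). f \<in> borel_measurable lebesgue \<and> rho f \<le> 1 \<and> B \<in> sets lebesgue \<and> B \<subseteq> I \<and>
      emeasure lebesgue B \<le> ennreal a}. \<integral>\<^sup>+t. ennreal \<bar>f t\<bar> * indicator B t \<partial>lebesgue)"

lemma Psi_upper:
  assumes "f \<in> borel_measurable lebesgue" "rho f \<le> 1" "B \<in> sets lebesgue" "B \<subseteq> I"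
    "emeasure lebesgue B \<le> ennreal a"
  shows "(\<integral>\<^sup>+t. ennreal \<bar>f t\<bar> * indicator B t \<partial>lebesgue) \<le> Psi a"
  unfolding Psi_def using assms by (intro SUP_upper2[of "(f, B)"]) auto

lemma less_PsiE:
  assumes "x < Psi a"
  obtains f B where "f \<in> borel_measurable lebesgue" "rho f \<le> 1" "B \<in> sets lebesgue" "B \<subseteq> I"
    "emeasure lebesgue B \<le> ennreal a" "x < (\<integral>\<^sup>+t. ennreal \<bar>f t\<bar> * indicator B t \<partial>lebesgue)"
proof -
  obtain q where "q \<in> {(f, B). f \<in> borel_measurable lebesgue \<and> rho f \<le> 1 \<and> B \<in> sets lebesgue \<and> B \<subseteq> I \<and>
      emeasure lebesgue B \<le> ennreal a}"
    and "x < (case q of (f, B) \<Rightarrow> \<integral>\<^sup>+t. ennreal \<bar>f t\<bar> * indicator B t \<partial>lebesgue)"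
    using assms unfolding Psi_def less_SUP_iff by (elim bexE)
  then show ?thesis using that[of "fst q" "snd q"] by (simp only: case_prod_beta mem_Collect_eq)
qed

text \<open>Split at height \<open>u0\<close>: below it \<open>f\<close> contributes at most
  \<open>u0 * a\<close>, and above it \<open>\<bar>f\<bar> \<le> \<phi> \<bar>f\<bar> / R\<close> is
  controlled by the modular through \<open>rho_ge_integral\<close>. The weight is taken at a fixed
  \<open>a0\<close>, so a large \<open>R\<close> followed by a small \<open>a\<close> makes the
  bound as small as desired.\<close>

lemma Psi_le:
  assumes a: "0 < a0" "ereal a0 < \<gamma>" and "0 \<le> a" "a \<le> a0" and R: "0 < R" and u0: "0 \<le> u0"
    and lin: "\<And>u. u0 \<le> u \<Longrightarrow> R * u \<le> \<phi> u"
  shows "Psi a \<le> ennreal (u0 * a + 1 / (R * enn2real (wt a0)))"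
  unfolding Psi_def
proof (intro SUP_least, clarify)
  fix f B
  assume f[measurable]: "f \<in> borel_measurable lebesgue" and rf: "rho f \<le> 1"
    and B[measurable]: "B \<in> sets lebesgue" and BI: "B \<subseteq> I" and Ba: "emeasure lebesgue B \<le> ennreal a"
  define \<omega> where "\<omega> = enn2real (wt a0)"
  have \<omega>: "0 < \<omega>" "wt a0 = ennreal \<omega>"
    using wt_pos[OF a] wt_finite[of a0] by (simp_all add: \<omega>_def enn2real_positive_iff)
  have [measurable]: "(\<lambda>t. \<phi> \<bar>f t\<bar>) \<in> borel_measurable lebesgue"
    by (rule Orlicz_function_comp_abs_measurable[OF orlicz f])
  let ?X = "\<integral>\<^sup>+t. ennreal (\<phi> \<bar>f t\<bar>) * indicator B t \<partial>lebesgue"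
  have "ennreal \<omega> * ?X \<le> 1"
    using rho_ge_integral[OF f B BI, of a0] Ba assms(4) a rf unfolding \<omega>(2)
    by (meson ennreal_leI order_trans)
  then have "ennreal (1 / \<omega>) * (ennreal \<omega> * ?X) \<le> ennreal (1 / \<omega>) * 1" by (intro mult_left_mono) simp_all
  then have X: "?X \<le> ennreal (1 / \<omega>)"
    using \<omega>(1) by (simp add: mult.assoc[symmetric] ennreal_mult'[symmetric])
  have pt: "ennreal \<bar>f t\<bar> * indicator B t \<le> ennreal u0 * indicator B t + ennreal (1 / R) * (ennreal (\<phi> \<bar>f t\<bar>) * indicator B t)" for t
  proof -
    have n: "0 \<le> \<phi> \<bar>f t\<bar>" by (rule Orlicz_function_nonneg[OF orlicz]) simp
    have "\<bar>f t\<bar> \<le> u0 + (1 / R) * \<phi> \<bar>f t\<bar>"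
    proof (cases "u0 \<le> \<bar>f t\<bar>")
      case True
      then show ?thesis using lin[OF True] R u0 by (simp add: field_simps add_increasing)
    next
      case False
      then show ?thesis using n R by (simp add: add_increasing2)
    qed
    then have "ennreal \<bar>f t\<bar> \<le> ennreal u0 + ennreal (1 / R) * ennreal (\<phi> \<bar>f t\<bar>)"
      using n R u0 by (simp add: ennreal_leI flip: ennreal_mult' ennreal_plus)
    then show ?thesis by (simp add: indicator_def)
  qed
  have "(\<integral>\<^sup>+t. ennreal \<bar>f t\<bar> * indicator B t \<partial>lebesgue) \<le>
      (\<integral>\<^sup>+t. ennreal u0 * indicator B t + ennreal (1 / R) * (ennreal (\<phi> \<bar>f t\<bar>) * indicator B t) \<partial>lebesgue)"
    by (intro nn_integral_mono pt)
  also have "\<dots> = ennreal u0 * emeasure lebesgue B + ennreal (1 / R) * ?X"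
    by (subst nn_integral_add) (simp_all add: nn_integral_cmult_indicator nn_integral_cmult)
  also have "\<dots> \<le> ennreal u0 * ennreal a + ennreal (1 / R) * ennreal (1 / \<omega>)"
    using Ba X by (intro add_mono mult_left_mono) simp_all
  also have "\<dots> = ennreal (u0 * a + 1 / (R * \<omega>))"
  proof -
    have "ennreal u0 * ennreal a = ennreal (u0 * a)" "ennreal (1 / R) * ennreal (1 / \<omega>) = ennreal (1 / (R * \<omega>))"
      using u0 R \<omega>(1) by (simp_all flip: ennreal_mult')
    then show ?thesis using u0 R \<omega>(1) assms(3) by (simp add: ennreal_plus)
  qed
  finally show "(\<integral>\<^sup>+t. ennreal \<bar>f t\<bar> * indicator B t \<partial>lebesgue) \<le> ennreal (u0 * a + 1 / (R * enn2real (wt a0)))"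
    unfolding \<omega>_def .
qed

text \<open>\<open>Psi a / a\<close> is unbounded near \<open>0\<close>, whereas \<open>Psi a \<le> Psi (3 a / 4) + \<tau> a\<close> for all small \<open>a\<close>
  would give \<open>Psi a \<le> 4 \<tau> a\<close> by iteration, since \<open>Psi\<close> tends to \<open>0\<close>.\<close>

lemma Psi_gap:
  assumes sup: "filterlim (\<lambda>u. \<phi> u / u) at_top at_top" and M: "0 < M" "ereal M < \<gamma>" and \<tau>: "0 < \<tau>"
  obtains a where "0 < a" "a \<le> M" "Psi (3 / 4 * a) + ennreal (\<tau> * a) < Psi a" "Psi a < top"
proof -
  have lin: "\<exists>u0\<ge>0. \<forall>u\<ge>u0. R * u \<le> \<phi> u" if "0 < R" for R
  proof -
    have "\<forall>\<^sub>F u in at_top. R \<le> \<phi> u / u" using sup by (simp add: filterlim_at_top)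
    then obtain u1 where u1: "\<And>u. u1 \<le> u \<Longrightarrow> R \<le> \<phi> u / u" by (auto simp: eventually_at_top_linorder)
    have "R * u \<le> \<phi> u" if "max u1 1 \<le> u" for u using u1[of u] that by (simp add: field_simps)
    then show ?thesis by (intro exI[of _ "max u1 1"]) simp
  qed
  define \<omega> where "\<omega> = enn2real (wt M)"
  have \<omega>: "0 < \<omega>" using wt_pos[OF M] wt_finite[of M] by (simp add: \<omega>_def enn2real_positive_iff)
  have fin: "Psi a < top" if "0 \<le> a" "a \<le> M" for a
  proof -
    obtain u0 where "0 \<le> u0" "\<And>u. u0 \<le> u \<Longrightarrow> 1 * u \<le> \<phi> u" using lin[of 1] by auto
    from Psi_le[OF M that _ this] show ?thesis by (auto intro: le_less_trans)
  qed
  \<comment> \<open>The factor 5 has to beat \<open>4 + 1 / 2\<close>: four from the geometric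
    series with ratio \<open>3 / 4\<close>, one half from the remaining term
    \<open>Psi (r k)\<close>. The length \<open>a0\<close> is so small that height
    \<open>5 * \<tau>\<close> on \<open>{0..<a0}\<close> has modular at most 1.\<close>
  have p5: "0 < \<phi> (5 * \<tau>)" using \<tau> by (intro phi_pos) simp
  obtain a0 where a0: "0 < a0" "a0 \<le> M" "W a0 \<le> ennreal (1 / \<phi> (5 * \<tau>))"
    using W_small[OF M(1), of "1 / \<phi> (5 * \<tau>)"] p5 by auto
  define r where "r k = (3 / 4) ^ k * a0" for k :: nat
  have r: "0 < r k" "r k \<le> M" for k
  proof -
    show "0 < r k" using a0 by (simp add: r_def)
    have "(3 / 4) ^ k * a0 \<le> 1 * a0" using a0 by (intro mult_right_mono power_le_one) simp_all
    then have "r k \<le> a0" by (simp only: r_def mult_1)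
    then show "r k \<le> M" using a0(2) by (rule order_trans)
  qed
  have low: "ennreal (5 * \<tau> * a0) \<le> Psi a0"
  proof -
    let ?A = "{0..<a0}"
    have AI: "?A \<subseteq> I"
    proof
      fix t assume "t \<in> ?A"
      then show "t \<in> I" using M a0 ereal_le_less_gamma[of t M] by (auto simp: half_open_interval_def)
    qed
    let ?f = "\<lambda>t. 5 * \<tau> * indicator ?A t :: real"
    have "rho ?f = ennreal (\<phi> (5 * \<tau>)) * W a0"
      using \<tau> a0 by (intro rho_step AI) simp_all
    also have "\<dots> \<le> ennreal (\<phi> (5 * \<tau>)) * ennreal (1 / \<phi> (5 * \<tau>))" using a0 by (intro mult_left_mono) simp_all
    also have "\<dots> = 1" using p5 by (simp flip: ennreal_mult')
    finally have "(\<integral>\<^sup>+t. ennreal \<bar>?f t\<bar> * indicator ?A t \<partial>lebesgue) \<le> Psi a0"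
      using a0 by (intro Psi_upper AI) simp_all
    also have "(\<integral>\<^sup>+t. ennreal \<bar>?f t\<bar> * indicator ?A t \<partial>lebesgue) = (\<integral>\<^sup>+t. ennreal (5 * \<tau>) * indicator ?A t \<partial>lebesgue)"
      using \<tau> by (intro nn_integral_cong) (simp add: indicator_def)
    also have "\<dots> = ennreal (5 * \<tau> * a0)"
      using a0 \<tau> by (subst nn_integral_cmult_indicator) (simp_all add: ennreal_mult')
    finally show ?thesis .
  qed
  have "\<exists>k. Psi (3 / 4 * r k) + ennreal (\<tau> * r k) < Psi (r k)"
  proof (rule ccontr)
    assume "\<not> ?thesis"
    then have step: "Psi (r k) \<le> Psi (r (Suc k)) + ennreal (\<tau> * r k)" for k
      by (simp add: not_less r_def mult.assoc)
    \<comment> \<open>Since \<open>r j - r (Suc j) = r j / 4\<close>, each increment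
      \<open>\<tau> * r j\<close> equals \<open>4 * \<tau> * (r j - r (Suc j))\<close> and the sum
      telescopes.\<close>
    have it: "Psi a0 \<le> Psi (r k) + ennreal (4 * \<tau> * (a0 - r k))" for k
    proof (induction k)
      case (Suc k)
      have rk: "r (Suc k) = 3 / 4 * r k" by (simp add: r_def)
      have rka: "r k \<le> a0" using a0(1) by (simp add: r_def mult_left_le_one_le power_le_one)
      have "Psi a0 \<le> (Psi (r (Suc k)) + ennreal (\<tau> * r k)) + ennreal (4 * \<tau> * (a0 - r k))"
        using Suc step[of k] by (meson add_right_mono order_trans)
      also have "\<dots> = Psi (r (Suc k)) + (ennreal (\<tau> * r k) + ennreal (4 * \<tau> * (a0 - r k)))"
        by (simp add: add.assoc)
      also have "ennreal (\<tau> * r k) + ennreal (4 * \<tau> * (a0 - r k)) = ennreal (\<tau> * r k + 4 * \<tau> * (a0 - r k))"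
        using \<tau> r(1)[of k] rka by (intro ennreal_plus[symmetric]) simp_all
      also have "\<tau> * r k + 4 * \<tau> * (a0 - r k) = 4 * \<tau> * (a0 - r (Suc k))"
        by (simp add: rk algebra_simps)
      finally show ?case .
    qed (simp add: r_def)
    \<comment> \<open>This \<open>R\<close> makes
      \<open>1 / (R * \<omega>) = \<tau> * a0 / 4\<close>; it determines \<open>u0\<close>, and then
      \<open>k\<close> makes \<open>u0 * r k \<le> \<tau> * a0 / 4\<close>. Together
      \<open>Psi (r k) \<le> \<tau> * a0 / 2\<close>.\<close>
    define R where "R = 4 / (\<omega> * \<tau> * a0)"
    have R: "0 < R" using \<omega> \<tau> a0 by (simp add: R_def)
    obtain u0 where u0: "0 \<le> u0" "\<And>u. u0 \<le> u \<Longrightarrow> R * u \<le> \<phi> u" using lin[OF R] by auto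
    obtain k where k: "(3 / 4) ^ k < \<tau> / (4 * (u0 + 1))"
      using real_arch_pow_inv[of "\<tau> / (4 * (u0 + 1))" "3 / 4"] \<tau> u0 by auto
    have "u0 * r k \<le> (u0 + 1) * r k" using r(1)[of k] by (intro mult_right_mono) simp_all
    also have "\<dots> \<le> (u0 + 1) * (\<tau> / (4 * (u0 + 1)) * a0)"
      unfolding r_def using k u0 a0 by (intro mult_left_mono mult_right_mono) simp_all
    also have "\<dots> = \<tau> * a0 / 4" using u0 by (simp add: field_simps)
    finally have "u0 * r k + 1 / (R * \<omega>) \<le> \<tau> * a0 / 2" using \<omega> \<tau> a0 by (simp add: R_def)
    then have "Psi (r k) \<le> ennreal (\<tau> * a0 / 2)"
      using Psi_le[OF M less_imp_le[OF r(1)] r(2) R u0] unfolding \<omega>_def[symmetric]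
      by (meson ennreal_leI order_trans)
    moreover have "ennreal (4 * \<tau> * (a0 - r k)) \<le> ennreal (4 * \<tau> * a0)"
      using \<tau> r(1)[of k] by (intro ennreal_leI mult_left_mono) simp_all
    ultimately have "Psi a0 \<le> ennreal (\<tau> * a0 / 2) + ennreal (4 * \<tau> * a0)"
      using it[of k] by (meson add_mono order_trans)
    from order_trans[OF low this] have "ennreal (5 * \<tau> * a0) \<le> ennreal (\<tau> * a0 / 2 + 4 * \<tau> * a0)"
      using \<tau> a0(1) by (subst ennreal_plus) simp_all
    then show False using \<tau> a0 by (simp add: ennreal_le_iff)
  qed
  then obtain k where "Psi (3 / 4 * r k) + ennreal (\<tau> * r k) < Psi (r k)" by blast
  then show ?thesis using r[of k] fin[of "r k"] by (intro that[of "r k"]) simp_all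
qed

section \<open>Integration over a set as a bounded functional, and the slice it cuts out\<close>

lemma integrable_over:
  assumes f[measurable]: "f \<in> borel_measurable lebesgue" and S: "abs_meas_class f \<in> S"
    and B[measurable]: "B \<in> sets lebesgue" and BI: "B \<subseteq> I" "emeasure lebesgue B \<le> ennreal a" and fin: "Psi a < top"
  shows "integrable lebesgue (\<lambda>t. indicator B t * f t)"
proof -
  obtain e where e: "0 < e" "rho (\<lambda>t. f t / e) \<le> 1" by (rule mem_space_rho_le_1[OF f S])
  have m: "(\<lambda>t. f t / e) \<in> borel_measurable lebesgue" by measurable
  have "(\<integral>\<^sup>+t. ennreal (norm (indicator B t * (f t / e))) \<partial>lebesgue) = (\<integral>\<^sup>+t. ennreal \<bar>f t / e\<bar> * indicator B t \<partial>lebesgue)"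
    by (intro nn_integral_cong) (simp add: indicator_def)
  also have "\<dots> < \<infinity>" using Psi_upper[OF m e(2) B BI] fin by (simp add: le_less_trans)
  finally have "integrable lebesgue (\<lambda>t. indicator B t * (f t / e))" by (intro integrableI_bounded) measurable
  then have "integrable lebesgue (\<lambda>t. e * (indicator B t * (f t / e)))" by (rule integrable_mult_right)
  then show ?thesis using e(1) by simp
qed

lemma integral_over_le:
  assumes f[measurable]: "f \<in> borel_measurable lebesgue" and r: "rho f \<le> 1"
    and B[measurable]: "B \<in> sets lebesgue" and BI: "B \<subseteq> I" "emeasure lebesgue B \<le> ennreal a" and fin: "Psi a < top"
  shows "\<bar>LINT t|lebesgue. indicator B t * f t\<bar> \<le> enn2real (Psi a)"
proof -
  have "(\<integral>\<^sup>+t. ennreal (norm (indicator B t * f t)) \<partial>lebesgue) = (\<integral>\<^sup>+t. ennreal \<bar>f t\<bar> * indicator B t \<partial>lebesgue)"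
    by (intro nn_integral_cong) (simp add: indicator_def)
  also have "\<dots> \<le> Psi a" by (rule Psi_upper[OF f r B BI])
  finally have le: "(\<integral>\<^sup>+t. ennreal (norm (indicator B t * f t)) \<partial>lebesgue) \<le> Psi a" .
  from le_less_trans[OF this fin] have "integrable lebesgue (\<lambda>t. indicator B t * f t)"
    by (intro integrableI_bounded) simp_all
  from order_trans[OF integral_norm_bound_ennreal[OF this] le]
  have "ennreal \<bar>LINT t|lebesgue. indicator B t * f t\<bar> \<le> Psi a" by simp
  from enn2real_mono[OF this] fin show ?thesis by simp
qed

lemma integral_over_dual:
  assumes B[measurable]: "B \<in> sets lebesgue" and BI: "B \<subseteq> I" "emeasure lebesgue B \<le> ennreal a" and fin: "Psi a < top"
  shows "integral_over B \<in> dual_on S N"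
  unfolding dual_on_def
proof (intro CollectI conjI ballI allI exI)
  fix x y assume xy: "x \<in> S" "y \<in> S"
  obtain f where f[measurable]: "f \<in> borel_measurable lebesgue" and xf: "x = abs_meas_class f" by (rule meas_class_cases)
  obtain g where g[measurable]: "g \<in> borel_measurable lebesgue" and yg: "y = abs_meas_class g" by (rule meas_class_cases)
  have fg: "(\<lambda>t. f t + g t) \<in> borel_measurable lebesgue" by measurable
  show "integral_over B (x + y) = integral_over B x + integral_over B y"
    using integrable_over[OF f _ B BI fin] integrable_over[OF g _ B BI fin] xy
    unfolding xf yg abs_meas_class_add[OF f g] integral_over_abs_meas_class[OF fg B]
      integral_over_abs_meas_class[OF f B] integral_over_abs_meas_class[OF g B]
    by (simp add: distrib_left)
next
  fix c x assume "x \<in> S"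
  obtain f where f[measurable]: "f \<in> borel_measurable lebesgue" and xf: "x = abs_meas_class f" by (rule meas_class_cases)
  have cf: "(\<lambda>t. c * f t) \<in> borel_measurable lebesgue" by measurable
  show "integral_over B (c *\<^sub>R x) = c * integral_over B x"
    unfolding xf abs_meas_class_scaleR[OF f] integral_over_abs_meas_class[OF cf B] integral_over_abs_meas_class[OF f B]
    by (subst integral_mult_right_zero[symmetric]) (simp add: mult_ac)
next
  fix x assume x: "x \<in> S"
  obtain f where f[measurable]: "f \<in> borel_measurable lebesgue" and xf: "x = abs_meas_class f" by (rule meas_class_cases)
  let ?C = "enn2real (Psi a)"
  show "\<bar>integral_over B x\<bar> \<le> ?C * N x"
  proof (rule field_le_epsilon)
    fix d :: real assume d: "0 < d"
    \<comment> \<open>The slack is \<open>d / (?C + 1)\<close> rather than \<open>d / ?C\<close> to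
      cover \<open>?C = 0\<close>; multiplied by \<open>?C\<close> it stays below
      \<open>d\<close>.\<close>
    define e where "e = N x + d / (?C + 1)"
    have C: "0 \<le> ?C" by simp
    have Nx: "0 \<le> N x" "N x < e" using norm_nonneg[OF f] x d C by (simp_all add: xf e_def add_nonneg_pos)
    have "rho (\<lambda>t. f t / e) \<le> 1" using x Nx by (intro rho_le_1_of_norm_less f) (simp_all add: xf)
    then have "\<bar>LINT t|lebesgue. indicator B t * (f t / e)\<bar> \<le> ?C"
      by (intro integral_over_le[OF _ _ B BI fin]) measurable
    also have "(LINT t|lebesgue. indicator B t * (f t / e)) = (LINT t|lebesgue. indicator B t * f t) / e"
      by simp
    finally have "\<bar>integral_over B x\<bar> \<le> ?C * e"
      using Nx unfolding xf integral_over_abs_meas_class[OF f B] by (simp add: abs_divide field_simps)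
    also have "\<dots> = ?C * N x + ?C / (?C + 1) * d" by (simp add: e_def distrib_left)
    also have "?C / (?C + 1) \<le> 1" using C unfolding divide_le_eq_1 by linarith
    then have "?C * N x + ?C / (?C + 1) * d \<le> ?C * N x + 1 * d"
      using d by (intro add_left_mono mult_right_mono) simp_all
    finally show "\<bar>integral_over B x\<bar> \<le> ?C * N x + d" by simp
  qed
qed

text \<open>If \<open>f\<close> reached \<open>\<tau>\<close> only on a part of \<open>B\<close> of
  measure at most \<open>b\<close>, that part would contribute at most \<open>Psi b\<close> to the
  integral and the rest at most \<open>\<tau> * a\<close>. The conclusion concerns \<open>f\<close>
  and not \<open>\<bar>f\<bar>\<close>: two members of the slice then share their sign where both
  are large, as cancellation requires.\<close>

lemma large_on_most:
  assumes f[measurable]: "f \<in> borel_measurable lebesgue" and r: "rho f \<le> 1"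
    and B[measurable]: "B \<in> sets lebesgue" and BI: "B \<subseteq> I" and Ba: "emeasure lebesgue B \<le> ennreal a" and fin: "Psi a < top"
    and \<tau>: "0 < \<tau>" and z: "AE t in lebesgue. t \<notin> I \<longrightarrow> f t = 0"
    and big: "Psi b + ennreal (\<tau> * a) < ennreal (LINT t|lebesgue. indicator B t * f t)" and a: "0 < a"
  shows "ennreal b < emeasure lebesgue {t \<in> B. \<tau> \<le> f t}"
proof (rule ccontr)
  let ?D = "{t \<in> B. \<tau> \<le> f t}"
  assume "\<not> ?thesis"
  then have Db: "emeasure lebesgue ?D \<le> ennreal b" by simp
  have D[measurable]: "?D \<in> sets lebesgue"
  proof -
    have "B \<inter> {t \<in> space lebesgue. \<tau> \<le> f t} \<in> sets lebesgue" by measurable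
    then show ?thesis by (rule back_subst[of "\<lambda>A. A \<in> sets lebesgue"]) auto
  qed
  have "ennreal (LINT t|lebesgue. indicator B t * f t) \<le> (\<integral>\<^sup>+t. ennreal (max 0 (indicator B t * f t)) \<partial>lebesgue)"
  proof -
    have i: "integrable lebesgue (\<lambda>t. indicator B t * f t)"
      by (rule integrable_over[OF f mem_spaceI[OF f z] B BI Ba fin]) (use r in \<open>simp add: le_less_trans\<close>)
    then have "ennreal (LINT t|lebesgue. indicator B t * f t) \<le> ennreal (LINT t|lebesgue. max 0 (indicator B t * f t))"
      by (intro ennreal_leI integral_mono integrable_max) simp_all
    also have "\<dots> = (\<integral>\<^sup>+t. ennreal (max 0 (indicator B t * f t)) \<partial>lebesgue)"
      using i by (intro nn_integral_eq_integral[symmetric] integrable_max) simp_all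
    finally show ?thesis .
  qed
  also have "\<dots> \<le> (\<integral>\<^sup>+t. ennreal \<bar>f t\<bar> * indicator ?D t + ennreal \<tau> * indicator B t \<partial>lebesgue)"
  proof (intro nn_integral_mono)
    fix t
    show "ennreal (max 0 (indicator B t * f t)) \<le> ennreal \<bar>f t\<bar> * indicator ?D t + ennreal \<tau> * indicator B t"
      using \<tau> by (cases "t \<in> B"; cases "\<tau> \<le> f t") (auto simp: indicator_def intro!: ennreal_leI add_increasing2)
  qed
  also have "\<dots> = (\<integral>\<^sup>+t. ennreal \<bar>f t\<bar> * indicator ?D t \<partial>lebesgue) + ennreal \<tau> * emeasure lebesgue B"
    by (subst nn_integral_add) (simp_all add: nn_integral_cmult_indicator)
  also have "\<dots> \<le> Psi b + ennreal \<tau> * ennreal a"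
    using BI Ba by (intro add_mono mult_left_mono Psi_upper f r D Db) auto
  also have "\<dots> = Psi b + ennreal (\<tau> * a)" using \<tau> a by (simp add: ennreal_mult')
  finally show False using big by simp
qed

text \<open>Since \<open>(1 + s) * h = (1 - s) * h + s * (2 * h)\<close>, convexity bounds the
  modular by \<open>rho h + s * K\<close>, and the gap \<open>\<kappa>\<close> absorbs the second
  term. This is where doubling turns a modular gap into a norm gap.\<close>

lemma norm_drop:
  assumes h[measurable]: "h \<in> borel_measurable lebesgue" and r: "rho h + ennreal \<kappa> \<le> 1"
    and K: "rho (\<lambda>t. 2 * h t) \<le> ennreal K" and s: "0 < s" "s < 1" "s * K \<le> \<kappa>" "0 \<le> K"
  shows "rho (\<lambda>t. (1 + s) * h t) \<le> 1"
proof -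
  have "rho (\<lambda>t. (1 + s) * h t) \<le> ennreal (1 - s) * rho h + ennreal s * rho (\<lambda>t. 2 * h t)"
  proof (rule rho_le_combination[OF h])
    have "\<phi> \<bar>(1 + s) * h t\<bar> \<le> (1 - s) * \<phi> \<bar>h t\<bar> + s * \<phi> \<bar>2 * h t\<bar>" for t
    proof -
      have "\<bar>(1 + s) * h t\<bar> = (1 + s) * \<bar>h t\<bar>" using s by (simp add: abs_mult)
      also have "\<dots> = (1 - s) * \<bar>h t\<bar> + s * \<bar>2 * h t\<bar>" by (simp add: abs_mult algebra_simps)
      finally have "\<bar>(1 + s) * h t\<bar> = (1 - s) * \<bar>h t\<bar> + s * \<bar>2 * h t\<bar>" .
      then show ?thesis using Orlicz_function_convexD[OF orlicz, of "1 - s" s "\<bar>h t\<bar>" "\<bar>2 * h t\<bar>"] s by simp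
    qed
    then show "AE t in lebesgue. t \<in> I \<longrightarrow> \<phi> \<bar>(1 + s) * h t\<bar> \<le> (1 - s) * \<phi> \<bar>h t\<bar> + s * \<phi> \<bar>2 * h t\<bar>" by simp
  qed (use s in simp_all)
  also have "\<dots> \<le> ennreal 1 * rho h + ennreal s * ennreal K"
    using s K by (intro add_mono mult_right_mono mult_left_mono ennreal_leI) simp_all
  also have "\<dots> \<le> rho h + ennreal \<kappa>" using s by (simp add: ennreal_leI flip: ennreal_mult')
  finally show ?thesis using r by (rule order_trans)
qed

lemma small_weakly_open:
  assumes sup: "filterlim (\<lambda>u. \<phi> u / u) at_top at_top"
    and dbl: "\<gamma> = \<infinity> \<and> Delta2 \<phi> \<or> \<gamma> < \<infinity> \<and> Delta2_infinity \<phi>"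
  obtains V where "openin (subtopology (weak_topology_on S N) (unit_ball_on S N)) V" "V \<noteq> {}"
    "diameter_wrt N V < 2"
proof -
  obtain M where M: "0 < M" "ereal M < \<gamma>" using gamma_pos
    by (metis ereal_dense2 ereal_less(2))
  define Wr where "Wr = enn2real (W M)"
  have Wr: "0 < Wr" "W M = ennreal Wr"
    using W_pos[OF M(1)] W_finite[of M] by (simp_all add: Wr_def enn2real_positive_iff)
  \<comment> \<open>With \<open>\<tau> = 2 * u\<close> this gives
    \<open>\<phi> (\<tau> / 2) * W M = 2\<close>, more than the level condition of
    \<open>rho_gain\<close> asks for.\<close>
  obtain u where u: "0 \<le> u" "\<phi> u = 2 / Wr" using Orlicz_function_surj[OF orlicz, of "2 / Wr"] Wr by auto
  define \<tau> where "\<tau> = 2 * u"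
  have "u \<noteq> 0" using u(2) Wr phi_0 by auto
  then have \<tau>: "0 < \<tau>" using u(1) by (simp add: \<tau>_def)
  define \<beta> where "\<beta> = \<phi> (\<tau> / 2)"
  have \<beta>: "0 < \<beta>" unfolding \<beta>_def using \<tau> by (intro phi_pos) simp
  have "\<phi> (\<tau> / 2) * Wr = 2" using u Wr by (simp add: \<tau>_def)
  then have lvl: "1 < ennreal (\<phi> (\<tau> / 2)) * W M"
    using Wr \<beta> by (simp add: Wr(2) \<beta>_def flip: ennreal_mult')
  obtain a where a: "0 < a" "a \<le> M" "Psi (3 / 4 * a) + ennreal (\<tau> * a) < Psi a" "Psi a < top"
    by (rule Psi_gap[OF sup M \<tau>])
  obtain f0 B where f0[measurable]: "f0 \<in> borel_measurable lebesgue" and rf0: "rho f0 \<le> 1"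
    and B[measurable]: "B \<in> sets lebesgue" and BI: "B \<subseteq> I" and Ba: "emeasure lebesgue B \<le> ennreal a"
    and gap: "Psi (3 / 4 * a) + ennreal (\<tau> * a) < (\<integral>\<^sup>+t. ennreal \<bar>f0 t\<bar> * indicator B t \<partial>lebesgue)"
    using less_PsiE[OF a(3)] .
  let ?P = "\<integral>\<^sup>+t. ennreal \<bar>f0 t\<bar> * indicator B t \<partial>lebesgue"
  have Pfin: "?P < top" using Psi_upper[OF f0 rf0 B BI Ba] a(4) by (rule le_less_trans)
  define p where "p = enn2real (Psi (3 / 4 * a) + ennreal (\<tau> * a))"
  define P where "P = enn2real ?P"
  have p: "Psi (3 / 4 * a) + ennreal (\<tau> * a) = ennreal p" "0 \<le> p"
    using less_trans[OF gap Pfin] by (simp_all add: p_def)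
  have P: "?P = ennreal P" "0 \<le> P" using Pfin by (simp_all add: P_def)
  have pP: "p < P" using gap p P by (simp add: ennreal_less_iff)
  \<comment> \<open>Four thresholds \<open>p < q' < q < P\<close>: \<open>P\<close> is reached by a
    member of the unit ball, \<open>q\<close> defines the slice, and \<open>q'\<close> survives
    division by \<open>e\<close>, so the integral stays above the value \<open>p\<close> required by
    \<open>large_on_most\<close>.\<close>
  define q' where "q' = p + (P - p) / 3"
  define q where "q = p + 2 * (P - p) / 3"
  have q: "p < q'" "q' < q" "q < P" "0 < q'" using pP p by (simp_all add: q_def q'_def field_simps)
  define \<omega> where "\<omega> = enn2real (wt M)"
  have \<omega>: "0 < \<omega>" "wt M = ennreal \<omega>"
    using wt_pos[OF M] wt_finite[of M] by (simp_all add: \<omega>_def enn2real_positive_iff)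
  \<comment> \<open>The gain in \<open>rho_gain\<close>: the weight at \<open>M\<close>, times
    \<open>\<phi> (\<tau> / 2)\<close>, times the guaranteed overlap \<open>a / 2\<close> of two
    large sets.\<close>
  define \<kappa> where "\<kappa> = \<omega> * (\<beta> * (a / 2))"
  have \<kappa>: "0 < \<kappa>" using \<omega> \<beta> a by (simp add: \<kappa>_def)
  obtain K where K: "0 \<le> K"
    "\<And>f. f \<in> borel_measurable lebesgue \<Longrightarrow> rho f \<le> 1 \<Longrightarrow> rho (\<lambda>t. 2 * f t) \<le> ennreal K"
    by (rule rho_double[OF dbl]) blast
  define s where "s = min (1 / 2) (\<kappa> / (K + 1))"
  have s: "0 < s" "s < 1" "s * K \<le> \<kappa>"
  proof -
    show "0 < s" "s < 1" using \<kappa> K by (simp_all add: s_def)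
    have "s * K \<le> \<kappa> / (K + 1) * (K + 1)"
      using \<kappa> K(1) by (intro mult_mono) (simp_all add: s_def)
    then show "s * K \<le> \<kappa>" using K by simp
  qed
  \<comment> \<open>\<open>e\<close> is the divisor above 1 that replaces the norm bound 1. Its
    first bound keeps the integral above \<open>q'\<close>, its second keeps the final estimate
    \<open>2 * e / (1 + s)\<close> below 2.\<close>
  define e where "e = min (q / q') (1 + s / 2)"
  have e: "1 < e" "q' \<le> q / e" "e \<le> 1 + s / 2"
  proof -
    show "1 < e" using q s by (simp add: e_def)
    then show "q' \<le> q / e" using q by (simp add: e_def field_simps min_def split: if_splits)
    show "e \<le> 1 + s / 2" by (simp add: e_def)
  qed
  define V where "V = {x \<in> S. integral_over B x \<in> {q<..}} \<inter> unit_ball_on S N"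
  show thesis
  proof (rule that)
    have "openin (weak_topology_on S N) {x \<in> S. integral_over B x \<in> {q<..}}"
      unfolding weak_topology_on_def
      by (rule topology_generated_by_Basis)
        (use integral_over_dual[OF B BI Ba a(4)] open_greaterThan[of q] in blast)
    then show "openin (subtopology (weak_topology_on S N) (unit_ball_on S N)) V"
      unfolding openin_subtopology V_def by blast
    \<comment> \<open>Absolute values remove cancellation in the integral over \<open>B\<close>, and
      the cut-off makes the class vanish outside the interval.\<close>
    let ?f1 = "\<lambda>t. \<bar>f0 t\<bar> * indicator I t"
    have f1: "?f1 \<in> borel_measurable lebesgue" by measurable
    have "rho ?f1 \<le> rho f0" by (rule rho_mono[OF f0 f1]) (simp add: indicator_def)
    then have b1: "abs_meas_class ?f1 \<in> unit_ball_on S N"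
      using rf0 by (intro mem_unit_ballI f1) (auto simp: indicator_def intro: order_trans)
    have "integral_over B (abs_meas_class ?f1) = (LINT t|lebesgue. \<bar>f0 t\<bar> * indicator B t)"
      unfolding integral_over_abs_meas_class[OF f1 B] using BI
      by (intro Bochner_Integration.integral_cong refl) (auto simp: indicator_def)
    also have "\<dots> = enn2real (\<integral>\<^sup>+t. ennreal (\<bar>f0 t\<bar> * indicator B t) \<partial>lebesgue)"
      by (intro integral_eq_nn_integral) simp_all
    also have "(\<integral>\<^sup>+t. ennreal (\<bar>f0 t\<bar> * indicator B t) \<partial>lebesgue) = ?P"
      by (intro nn_integral_cong) (simp add: indicator_def)
    finally have "integral_over B (abs_meas_class ?f1) = P" by (simp add: P_def)
    then have "abs_meas_class ?f1 \<in> V" using b1 q by (simp add: V_def unit_ball_on_def)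
    then show "V \<noteq> {}" by blast
    have bound: "N (x - y) \<le> 2 * (1 + s / 2) / (1 + s)" if x: "x \<in> V" and y: "y \<in> V" for x y
    proof -
      have slice: "\<exists>f. f \<in> borel_measurable lebesgue \<and> x = abs_meas_class (\<lambda>t. e * f t) \<and> rho f \<le> 1 \<and>
          {t \<in> B. \<tau> \<le> f t} \<in> sets lebesgue \<and> ennreal (3 / 4 * a) < emeasure lebesgue {t \<in> B. \<tau> \<le> f t}"
        if x: "x \<in> V" for x
      proof -
        obtain f where f[measurable]: "f \<in> borel_measurable lebesgue" and xf: "x = abs_meas_class f" by (rule meas_class_cases)
        have xV: "abs_meas_class f \<in> S" "q < integral_over B (abs_meas_class f)" "N (abs_meas_class f) \<le> 1"
          using x by (simp_all add: V_def unit_ball_on_def xf)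
        let ?g = "\<lambda>t. f t / e"
        have g: "?g \<in> borel_measurable lebesgue" by measurable
        have rg: "rho ?g \<le> 1" using xV e by (intro rho_le_1_of_norm_less f) simp_all
        have z: "AE t in lebesgue. t \<notin> I \<longrightarrow> ?g t = 0"
          using xV(1) unfolding mem_space_iff[OF f] by (auto elim: eventually_mono)
        have "q / e < (LINT t|lebesgue. indicator B t * f t) / e"
          using xV(2) e unfolding integral_over_abs_meas_class[OF f B] by (intro divide_strict_right_mono) simp_all
        also have "\<dots> = (LINT t|lebesgue. indicator B t * ?g t)" by simp
        finally have "p < (LINT t|lebesgue. indicator B t * ?g t)" using q e by linarith
        then have "ennreal p < ennreal (LINT t|lebesgue. indicator B t * ?g t)" using p by (simp add: ennreal_less_iff)
        then have most: "ennreal (3 / 4 * a) < emeasure lebesgue {t \<in> B. \<tau> \<le> ?g t}"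
          unfolding p(1)[symmetric] by (intro large_on_most[OF g rg B BI Ba a(4) \<tau> z]) (simp_all add: a)
        have "B \<inter> {t \<in> space lebesgue. \<tau> \<le> ?g t} \<in> sets lebesgue" by measurable
        then have "{t \<in> B. \<tau> \<le> ?g t} \<in> sets lebesgue"
          by (rule back_subst[of "\<lambda>A. A \<in> sets lebesgue"]) auto
        moreover have "(\<lambda>t. e * ?g t) = f" using e by (simp add: fun_eq_iff)
        ultimately show ?thesis using g rg most xf by (intro exI[of _ ?g]) simp
      qed
      obtain f where f[measurable]: "f \<in> borel_measurable lebesgue" and xf: "x = abs_meas_class (\<lambda>t. e * f t)" and rf: "rho f \<le> 1"
        and Df[measurable]: "{t \<in> B. \<tau> \<le> f t} \<in> sets lebesgue" and mf: "ennreal (3 / 4 * a) < emeasure lebesgue {t \<in> B. \<tau> \<le> f t}"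
        using slice[OF x] by blast
      obtain g where g[measurable]: "g \<in> borel_measurable lebesgue" and yg: "y = abs_meas_class (\<lambda>t. e * g t)" and rg: "rho g \<le> 1"
        and Dg[measurable]: "{t \<in> B. \<tau> \<le> g t} \<in> sets lebesgue" and mg: "ennreal (3 / 4 * a) < emeasure lebesgue {t \<in> B. \<tau> \<le> g t}"
        using slice[OF y] by blast
      let ?F = "{t \<in> B. \<tau> \<le> f t}" and ?G = "{t \<in> B. \<tau> \<le> g t}"
      have D: "ennreal (a / 2) \<le> emeasure lebesgue (?F \<inter> ?G)"
      proof -
        have "ennreal a + ennreal (a / 2) = ennreal (3 / 4 * a) + ennreal (3 / 4 * a)"
          using a(1) by (simp flip: ennreal_plus)
        also have "\<dots> \<le> emeasure lebesgue ?F + emeasure lebesgue ?G"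
          using mf mg by (intro add_mono less_imp_le)
        also have "\<dots> = emeasure lebesgue (?F \<union> ?G) + emeasure lebesgue (?F \<inter> ?G)"
          by (rule emeasure_Un_Int[OF Df Dg])
        also have "emeasure lebesgue (?F \<union> ?G) \<le> emeasure lebesgue B"
          by (rule emeasure_mono[OF _ B]) auto
        then have "emeasure lebesgue (?F \<union> ?G) + emeasure lebesgue (?F \<inter> ?G) \<le> ennreal a + emeasure lebesgue (?F \<inter> ?G)"
          using Ba by (intro add_mono) (auto intro: order_trans)
        finally show ?thesis by (auto simp add: ennreal_add_left_cancel_le)
      qed
      define h where "h t = (f t - g t) / 2" for t
      define k where "k t = (\<bar>f t\<bar> + \<bar>g t\<bar>) / 2" for t
      have h[measurable]: "h \<in> borel_measurable lebesgue" unfolding h_def by measurable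
      have k[measurable]: "k \<in> borel_measurable lebesgue" unfolding k_def by measurable
      have rk: "rho k \<le> 1"
        by (rule rho_midpoint[OF f g k _ rf rg]) (simp add: k_def)
      have "rho h + wt M * (ennreal (\<phi> (\<tau> / 2)) * emeasure lebesgue (?F \<inter> ?G)) \<le> 1"
      proof (rule rho_gain[OF k h _ _ rk M(1) \<tau> lvl])
        show "?F \<inter> ?G \<in> sets lebesgue" by measurable
        show "?F \<inter> ?G \<subseteq> I" using BI by auto
        show "\<bar>h t\<bar> \<le> \<bar>k t\<bar>" for t by (simp add: h_def k_def abs_divide divide_right_mono)
        show "\<bar>h t\<bar> + \<tau> \<le> \<bar>k t\<bar>" if "t \<in> ?F \<inter> ?G" for t
        proof -
          have fg: "\<tau> \<le> f t" "\<tau> \<le> g t" using that by simp_all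
          \<comment> \<open>The mean of two positive numbers minus half their distance is the
            smaller of them, and both are at least \<open>\<tau>\<close>.\<close>
          then have "\<bar>h t\<bar> \<le> k t - \<tau>"
            using \<tau> by (intro abs_leI) (simp_all add: h_def k_def field_simps)
          then show ?thesis by simp
        qed
      qed
      moreover have "ennreal \<kappa> \<le> wt M * (ennreal (\<phi> (\<tau> / 2)) * emeasure lebesgue (?F \<inter> ?G))"
      proof -
        have "ennreal \<kappa> = wt M * (ennreal (\<phi> (\<tau> / 2)) * ennreal (a / 2))"
          unfolding \<kappa>_def \<omega>(2) \<beta>_def[symmetric] using \<omega>(1) \<beta> by (metis ennreal_mult' less_imp_le)
        also have "\<dots> \<le> wt M * (ennreal (\<phi> (\<tau> / 2)) * emeasure lebesgue (?F \<inter> ?G))"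
          using D by (intro mult_left_mono) simp_all
        finally show ?thesis .
      qed
      ultimately have rh: "rho h + ennreal \<kappa> \<le> 1" by (meson add_left_mono order_trans)
      then have "rho h \<le> 1" by (rule order_trans[rotated]) simp
      from norm_drop[OF h rh K(2)[OF h this] s K(1)]
      have "rho (\<lambda>t. (e * f t - e * g t) / (2 * e / (1 + s))) \<le> 1"
      proof -
        have "(e * f t - e * g t) / (2 * e / (1 + s)) = (1 + s) * h t" for t
          using e s by (simp add: h_def field_simps)
        then show ?thesis using \<open>rho (\<lambda>t. (1 + s) * h t) \<le> 1\<close> by simp
      qed
      then have "N (x - y) \<le> 2 * e / (1 + s)"
        unfolding xf yg using e s
        by (subst abs_meas_class_diff) (auto intro!: norm_le)
      also have "\<dots> \<le> 2 * (1 + s / 2) / (1 + s)"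
        using e s by (intro divide_right_mono mult_left_mono) simp_all
      finally show ?thesis .
    qed
    have "diameter_wrt N V \<le> ereal (2 * (1 + s / 2) / (1 + s))"
      unfolding diameter_wrt_def using bound by (intro SUP_least) auto
    also have "\<dots> < 2" using s by (simp add: field_simps)
    finally show "diameter_wrt N V < 2" .
  qed
qed

end

theorem theorem2p7:
  fixes \<gamma> :: ereal and w \<phi> :: "real \<Rightarrow> real"
  assumes "0 < \<gamma>"
    and "decreasing_weight \<gamma> w"
    and "\<gamma> = \<infinity> \<Longrightarrow> (\<integral>\<^sup>+t\<in>{0<..}. ennreal (w t) \<partial>lebesgue) = \<infinity>"
    and "Orlicz_N_function \<phi>"
  shows "(\<forall>V. openin (subtopology
                  (weak_topology_on (OL_space \<gamma> \<phi> w) (Luxemburg_norm \<gamma> \<phi> w))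
                  (unit_ball_on (OL_space \<gamma> \<phi> w) (Luxemburg_norm \<gamma> \<phi> w))) V \<and> V \<noteq> {} \<longrightarrow>
            diameter_wrt (Luxemburg_norm \<gamma> \<phi> w) V = 2) \<longleftrightarrow>
         (\<gamma> = \<infinity> \<longrightarrow> \<not> Delta2 \<phi>) \<and> (\<gamma> < \<infinity> \<longrightarrow> \<not> Delta2_infinity \<phi>)"
    (is "?D2P \<longleftrightarrow> ?growth")
proof -
  interpret orlicz_lorentz \<gamma> w \<phi>
    using assms by unfold_locales (simp_all add: Orlicz_N_function_def)
  show ?thesis
  proof
    assume d2p: ?D2P
    show ?growth
    proof (rule ccontr)
      assume "\<not> ?growth"
      then have "\<gamma> = \<infinity> \<and> Delta2 \<phi> \<or> \<gamma> < \<infinity> \<and> Delta2_infinity \<phi>" by blast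
      moreover have "filterlim (\<lambda>u. \<phi> u / u) at_top at_top"
        using assms(4) by (simp add: Orlicz_N_function_def)
      ultimately obtain V where "openin (subtopology (weak_topology_on S N) (unit_ball_on S N)) V" "V \<noteq> {}"
          "diameter_wrt N V < 2"
        using small_weakly_open by blast
      then show False using d2p by (metis less_irrefl)
    qed
  next
    assume growth: ?growth
    show ?D2P
    proof (intro allI impI, elim conjE)
      fix V assume V: "openin (subtopology (weak_topology_on S N) (unit_ball_on S N)) V" "V \<noteq> {}"
      show "diameter_wrt N V = 2"
      proof (rule diameter_two[OF _ V])
        fix \<eta> \<epsilon> L :: real assume "0 < \<eta>" "0 < \<epsilon>" "0 < L"
        then show "\<exists>u m. 0 < u \<and> 0 < m \<and> (\<gamma> < \<infinity> \<longrightarrow> m \<le> L) \<and> ennreal (\<phi> u) * W m \<le> ennreal \<epsilon> \<and>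
            1 < ennreal (\<phi> ((1 + \<eta>) * u)) * W m"
          using steps_infinite[OF _ assms(3)] steps_finite growth by (cases "\<gamma> = \<infinity>") simp_all
      qed
    qed
  qed
qed

end
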